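(* For every integer $r\ge 1$ there is a constant $c_r>0$, depending only on $r$, such that for every prime $p$ and every colouring of $\mathbb{F}_p$ with $r$ colours, there are at least $c_r p^2$ monochromatic quadruples of the form $(x,y,x+y,xy)$; that is, at least $c_r p^2$ pairs $(x,y)\in\mathbb{F}_p\times\mathbb{F}_p$ for which $x$, $y$, $x+y$ and $xy$ all have the same colour.
   Context: $\mathbb{F}_p$ denotes the finite field with $p$ elements, $p$ prime. An $r$-colouring of a set $S$ is a map $S\to\{1,\dots,r\}$. *)

theory Defs
  imports Complex_Main "HOL-Library.FuncSet" "HOL-Number_Theory.Residues"
begin

abbreviation prime_field :: "nat \<Rightarrow> int ring"
  where "prime_field p \<equiv> residue_ring (int p)"

(* A quadruple (x, y, x + y, x y) is determined by the pair (x, y), so quadruples are counted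
   as pairs; degenerate ones (x = y, or x or y zero) are included. *)
definition mono_pairs :: "nat \<Rightarrow> (int \<Rightarrow> nat) \<Rightarrow> (int \<times> int) set" where
  "mono_pairs p \<chi> =
     {(x, y) \<in> carrier (prime_field p) \<times> carrier (prime_field p).
        \<chi> x = \<chi> y \<and>
        \<chi> x = \<chi> (x \<oplus>\<^bsub>prime_field p\<^esub> y) \<and>
        \<chi> x = \<chi> (x \<otimes>\<^bsub>prime_field p\<^esub> y)}"

end

theory Submission
  imports Defs "HOL-Library.Ramsey" "HOL-Number_Theory.Residue_Primitive_Roots"
    "HOL-Analysis.Convex" "HOL-Real_Asymp.Real_Asymp"
begin

text \<open>
  The count of \<open>f\<^sub>1(x) f\<^sub>2(y) f\<^sub>3(x + y) f\<^sub>4(xy)\<close> is insensitive to changes of \<open>f\<^sub>3\<close> that are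
  orthogonal to all quadratic phases and to changes of \<open>f\<^sub>4\<close> that are orthogonal to all products of
  an additive and a multiplicative character. Hence \<open>f\<^sub>3\<close> and \<open>f\<^sub>4\<close> may be replaced by smoothings
  with kernels of bounded complexity, which depend only on the approximate position of the argument:
  for \<open>f\<^sub>3\<close> on \<open>(x, x\<^sup>2)\<close>, for \<open>f\<^sub>4\<close> on \<open>x\<close> and its discrete logarithm. The triples
  \<open>(x, x\<^sup>2, ind x)\<close> are equidistributed, so it remains to find positions of \<open>x\<close>, \<open>y\<close>, \<open>x + y\<close>, \<open>xy\<close>
  at which one colour class is dense. At the level of positions the product is independent of
  the factors, except that \<open>(x + y)\<^sup>2 = x\<^sup>2 + y\<^sup>2 + 2xy\<close>, and such positions come from differences
  of random sequences by Ramsey's theorem. Positive definiteness of the smoothing ensures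
  that a colour class is rarely met where its own smoothing is small.
\<close>

section \<open>Averages\<close>

text \<open>Two obstacles shape the proof. The first is the order of constants: the lower bound for
  the smoothed count must not depend on the complexity \<open>C\<close> of the smoothing, because
  the accuracy of the replacement, and hence \<open>C\<close>, is chosen in terms of that bound. So
  positions are taken at a second, much finer scale, on which the coarse smoothings are nearly
  constant; the complexity of the fine kernels enters only in terms with a power of
  \<open>tau\<close>, which vanish as p grows. The second is that the product of the colour classes
  is controlled by quadratic phases at all. Two Cauchy-Schwarz rounds remove every function but
  \<open>f\<close> at x + y, and a change of variables leaves correlations of derivatives of
  \<open>f\<close>. These see the Fourier mass of the derivatives only along lines through the
  origin, where a quadratic twist makes it a \<open>U\<^sup>2\<close> norm. For equidistribution any
  power saving is enough, so no Weil bound is used: a fourth moment over all phases, spread out by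
  the dilations x -> lx, suffices.\<close>

definition mean :: "'b set \<Rightarrow> ('b \<Rightarrow> 'a::real_vector) \<Rightarrow> 'a" where
  "mean A f = (\<Sum>x\<in>A. f x) /\<^sub>R real (card A)"

abbreviation Z :: "nat \<Rightarrow> int set" where "Z N \<equiv> {0..<int N}"

lemma mean_cong: "(\<And>x. x \<in> A \<Longrightarrow> f x = g x) \<Longrightarrow> mean A f = mean A g"
  by (simp add: mean_def)

lemma mean_add: "mean A (\<lambda>x. f x + g x) = mean A f + mean A g"
  by (simp add: mean_def sum.distrib scaleR_add_right)

lemma mean_diff: "mean A (\<lambda>x. f x - g x) = mean A f - mean A g"
  by (simp add: mean_def sum_subtractf scaleR_diff_right)

lemma mean_sum: "mean A (\<lambda>x. \<Sum>i\<in>I. f i x) = (\<Sum>i\<in>I. mean A (f i))"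
  unfolding mean_def by (subst sum.swap) (simp add: scaleR_sum_right)

lemma mean_mult_left: "mean A (\<lambda>x. c * f x) = c * mean A f"
  for c :: "'a::real_algebra"
  by (simp add: mean_def sum_distrib_left)

lemma mean_mult_right: "mean A (\<lambda>x. f x * c) = mean A f * c"
  for c :: "'a::real_algebra"
  by (simp add: mean_def sum_distrib_right)

lemma mean_divide: "mean A (\<lambda>x. f x / c) = mean A f / c"
  for c :: "'a::{real_algebra,field}"
  using mean_mult_right[of A f "inverse c"] by (simp add: field_class.field_divide_inverse)

lemma mean_const: "finite A \<Longrightarrow> A \<noteq> {} \<Longrightarrow> mean A (\<lambda>x. c) = c"
  by (simp add: mean_def scaleR_conv_of_real sum_constant_scaleR)

lemma mean_zero [simp]: "mean A (\<lambda>x. 0) = 0"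
  by (simp add: mean_def)

lemma mean_mono: "(\<And>x. x \<in> A \<Longrightarrow> f x \<le> g x) \<Longrightarrow> mean A f \<le> mean A g"
  for f :: "'b \<Rightarrow> real"
  by (simp add: mean_def mult_left_mono sum_mono)

lemma mean_nonneg: "(\<And>x. x \<in> A \<Longrightarrow> 0 \<le> f x) \<Longrightarrow> 0 \<le> mean A f"
  for f :: "'b \<Rightarrow> real"
  by (simp add: mean_def sum_nonneg)

lemma norm_mean_le: "norm (mean A f) \<le> mean A (\<lambda>x. norm (f x))"
  by (simp add: mean_def mult_left_mono norm_sum)

lemma norm_mean_bound:
  assumes "finite A" "A \<noteq> {}" "\<And>x. x \<in> A \<Longrightarrow> norm (f x) \<le> B"
  shows "norm (mean A f) \<le> B"
proof -
  have "norm (mean A f) \<le> mean A (\<lambda>x. B)"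
    using norm_mean_le[of A f] mean_mono[of A "\<lambda>x. norm (f x)" "\<lambda>x. B"] assms by fastforce
  thus ?thesis using assms by (simp add: mean_const)
qed

lemma mean_bound:
  fixes f :: "'b \<Rightarrow> real"
  assumes "finite A" "A \<noteq> {}" "\<And>x. x \<in> A \<Longrightarrow> f x \<le> B"
  shows "mean A f \<le> B"
  using mean_mono[of A f "\<lambda>x. B"] assms by (simp add: mean_const)

lemma mean_swap: "mean A (\<lambda>x. mean B (\<lambda>y. f x y)) = mean B (\<lambda>y. mean A (\<lambda>x. f x y))"
  unfolding mean_def scaleR_sum_right[symmetric]
  by (subst sum.swap) (simp add: mult.commute)

lemma mean_mult: "mean A f * mean B g = mean A (\<lambda>x. mean B (\<lambda>y. f x * g y))"
  for f :: "'b \<Rightarrow> 'a::real_algebra"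
  by (simp add: mean_mult_left mean_mult_right)

lemma mean_of_real: "mean A (\<lambda>x. of_real (f x)) = of_real (mean A f)"
  by (simp add: mean_def scaleR_conv_of_real)

lemma mean_cnj: "cnj (mean A f) = mean A (\<lambda>x. cnj (f x))"
  by (simp add: mean_def)

lemma mean_Re: "Re (mean A f) = mean A (\<lambda>x. Re (f x))"
  by (simp add: mean_def)

lemma mean_square_le: "(mean A f)\<^sup>2 \<le> mean A (\<lambda>x. (f x)\<^sup>2)"
  for f :: "'b \<Rightarrow> real"
proof (cases "finite A \<and> A \<noteq> {}")
  case True
  hence c: "real (card A) > 0" by (simp add: card_gt_0_iff)
  have "(sum f A)\<^sup>2 \<le> (\<Sum>x\<in>A. (f x)\<^sup>2) * real (card A)"
    using sum_squared_le_sum_of_squares[of f A] True by (simp add: mult.commute)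
  thus ?thesis using c by (simp add: mean_def power2_eq_square field_simps)
qed (auto simp: mean_def)

lemma cmod_mean_square_le: "(cmod (mean A f))\<^sup>2 \<le> mean A (\<lambda>x. (cmod (f x))\<^sup>2)"
proof -
  have "(cmod (mean A f))\<^sup>2 \<le> (mean A (\<lambda>x. cmod (f x)))\<^sup>2"
    by (intro power_mono norm_mean_le) auto
  also have "\<dots> \<le> mean A (\<lambda>x. (cmod (f x))\<^sup>2)" by (rule mean_square_le)
  finally show ?thesis .
qed

lemma cmod_square_mean:
  "of_real ((cmod (mean A f))\<^sup>2) = mean A (\<lambda>x. mean A (\<lambda>y. f x * cnj (f y)))"
  unfolding complex_norm_square mean_cnj mean_mult ..

lemma mean_Times:
  "finite A \<Longrightarrow> finite B \<Longrightarrow> mean (A \<times> B) f = mean A (\<lambda>x. mean B (\<lambda>y. f (x, y)))"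
  unfolding mean_def scaleR_sum_right[symmetric] sum.cartesian_product'
  by (simp add: card_cartesian_product mult.commute)

text \<open>The second half of the Gowers--Cauchy--Schwarz inequality for bipartite weights.\<close>

lemma mean_Gowers_half:
  fixes G :: "'a \<Rightarrow> 'b \<Rightarrow> complex"
  assumes b: "\<And>u. u \<in> B \<Longrightarrow> cmod (b u) \<le> 1"
  shows "(mean A (\<lambda>x. (cmod (mean B (\<lambda>u. b u * G x u)))\<^sup>2))\<^sup>2
       \<le> mean A (\<lambda>x. mean A (\<lambda>z. (cmod (mean B (\<lambda>u. G x u * cnj (G z u))))\<^sup>2))"
proof -
  define S where "S = mean A (\<lambda>x. (cmod (mean B (\<lambda>u. b u * G x u)))\<^sup>2)"
  \<comment> \<open>\<open>T\<close> is the Gram kernel of the columns of \<open>G\<close>.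
    Expanding the square makes \<open>S\<close> a form in \<open>b\<close> with kernel
    \<open>T\<close>, from which Cauchy-Schwarz removes \<open>b\<close>.\<close>
  define T where "T u w = mean A (\<lambda>x. G x u * cnj (G x w))" for u w
  have "complex_of_real S = mean A (\<lambda>x. mean B (\<lambda>u. mean B (\<lambda>w. (b u * cnj (b w)) * (G x u * cnj (G x w)))))"
    unfolding S_def mean_of_real[symmetric] cmod_square_mean complex_cnj_mult
    by (intro mean_cong) (simp only: mult_ac)
  also have "\<dots> = mean B (\<lambda>u. mean B (\<lambda>w. mean A (\<lambda>x. (b u * cnj (b w)) * (G x u * cnj (G x w)))))"
    unfolding mean_swap[of A] ..
  also have "\<dots> = mean B (\<lambda>u. mean B (\<lambda>w. (b u * cnj (b w)) * T u w))"
    unfolding T_def mean_mult_left ..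
  finally have S: "complex_of_real S = \<dots>" .
  have "S\<^sup>2 = (cmod (complex_of_real S))\<^sup>2" by simp
  also have "\<dots> \<le> mean B (\<lambda>u. (cmod (mean B (\<lambda>w. (b u * cnj (b w)) * T u w)))\<^sup>2)"
    unfolding S by (rule cmod_mean_square_le)
  also have "\<dots> \<le> mean B (\<lambda>u. mean B (\<lambda>w. (cmod ((b u * cnj (b w)) * T u w))\<^sup>2))"
    by (intro mean_mono cmod_mean_square_le)
  also have "\<dots> \<le> mean B (\<lambda>u. mean B (\<lambda>w. (cmod (T u w))\<^sup>2))"
  proof (intro mean_mono)
    fix u w assume "u \<in> B" "w \<in> B"
    hence "cmod (b u) * cmod (b w) \<le> 1" using b by (simp add: mult_le_one)
    hence "cmod ((b u * cnj (b w)) * T u w) \<le> cmod (T u w)"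
      by (simp add: norm_mult mult_left_le_one_le)
    thus "(cmod ((b u * cnj (b w)) * T u w))\<^sup>2 \<le> (cmod (T u w))\<^sup>2" by (intro power_mono) auto
  qed
  finally have le: "S\<^sup>2 \<le> \<dots>" .
  \<comment> \<open>The Gram kernels of the columns and of the rows of \<open>G\<close> have the
    same Hilbert-Schmidt norm.\<close>
  have "complex_of_real (mean B (\<lambda>u. mean B (\<lambda>w. (cmod (T u w))\<^sup>2)))
      = mean B (\<lambda>u. mean B (\<lambda>w. mean A (\<lambda>x. mean A (\<lambda>z.
        (G x u * cnj (G z u)) * cnj (G x w * cnj (G z w))))))"
    unfolding mean_of_real[symmetric] T_def cmod_square_mean complex_cnj_mult complex_cnj_cnj
    by (intro mean_cong) (simp only: mult_ac)
  also have "\<dots> = mean B (\<lambda>u. mean A (\<lambda>x. mean A (\<lambda>z. mean B (\<lambda>w.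
        (G x u * cnj (G z u)) * cnj (G x w * cnj (G z w))))))"
    by (subst mean_swap[of B A], subst mean_swap[of B A]) (rule refl)
  also have "\<dots> = mean A (\<lambda>x. mean A (\<lambda>z. mean B (\<lambda>u. mean B (\<lambda>w.
      (G x u * cnj (G z u)) * cnj (G x w * cnj (G z w))))))"
    by (subst mean_swap[of B A], subst mean_swap[of B A]) (rule refl)
  also have "\<dots> = complex_of_real (mean A (\<lambda>x. mean A (\<lambda>z. (cmod (mean B (\<lambda>u. G x u * cnj (G z u))))\<^sup>2)))"
    unfolding mean_of_real[symmetric] cmod_square_mean ..
  finally show ?thesis using le unfolding S_def of_real_eq_iff by simp
qed

section \<open>Periodic functions and Fourier analysis on cyclic groups\<close>

text \<open>Residue classes are represented by integers throughout, so a function on Z/N is a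
  function on \<open>int\<close> with this invariance.\<close>

definition per :: "nat \<Rightarrow> (int \<Rightarrow> 'a) \<Rightarrow> bool" where
  "per N f \<longleftrightarrow> (\<forall>x y. [x = y] (mod int N) \<longrightarrow> f x = f y)"

lemma perD: "per N f \<Longrightarrow> [x = y] (mod int N) \<Longrightarrow> f x = f y"
  by (auto simp: per_def)

lemma perI: "(\<And>x y. [x = y] (mod int N) \<Longrightarrow> f x = f y) \<Longrightarrow> per N f"
  by (auto simp: per_def)

lemma card_Z [simp]: "card (Z N) = N" by simp

text \<open>Injectivity on a finite complete residue system forces bijectivity; translations and
  multiplications by units are the instances used.\<close>

lemma sum_Z_reindex:
  assumes N: "N > 0" and f: "per N f"
    and inj: "\<And>x y. x \<in> Z N \<Longrightarrow> y \<in> Z N \<Longrightarrow> [g x = g y] (mod int N) \<Longrightarrow> x = y"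
  shows "(\<Sum>x\<in>Z N. f (g x)) = (\<Sum>x\<in>Z N. f x)"
proof -
  have inj': "inj_on (\<lambda>x. g x mod int N) (Z N)"
    by (intro inj_onI inj) (auto simp: Cong.cong_def)
  have "(\<lambda>x. g x mod int N) ` Z N = Z N"
  proof (rule card_subset_eq)
    show "(\<lambda>x. g x mod int N) ` Z N \<subseteq> Z N" using N by auto
    show "card ((\<lambda>x. g x mod int N) ` Z N) = card (Z N)" by (rule card_image[OF inj'])
  qed auto
  hence "(\<Sum>x\<in>Z N. f x) = (\<Sum>x\<in>(\<lambda>x. g x mod int N) ` Z N. f x)" by simp
  also have "\<dots> = (\<Sum>x\<in>Z N. f (g x mod int N))"
    using sum.reindex[OF inj', of f] by simp
  also have "\<dots> = (\<Sum>x\<in>Z N. f (g x))"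
    by (intro sum.cong refl perD[OF f]) (simp add: Cong.cong_def)
  finally show ?thesis ..
qed

lemma Z_cong_eq: "x \<in> Z N \<Longrightarrow> y \<in> Z N \<Longrightarrow> [x = y] (mod int N) \<Longrightarrow> x = y"
  by (simp add: Cong.cong_def)

lemma sum_Z_shift: "N > 0 \<Longrightarrow> per N f \<Longrightarrow> (\<Sum>x\<in>Z N. f (x + a)) = (\<Sum>x\<in>Z N. f x)"
  by (rule sum_Z_reindex) (simp_all only: cong_add_rcancel Z_cong_eq)

lemma sum_Z_mult:
  "N > 0 \<Longrightarrow> per N f \<Longrightarrow> coprime a (int N) \<Longrightarrow> (\<Sum>x\<in>Z N. f (a * x)) = (\<Sum>x\<in>Z N. f x)"
  by (rule sum_Z_reindex) (simp_all only: cong_mult_lcancel Z_cong_eq)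

lemma mean_Z_shift: "N > 0 \<Longrightarrow> per N f \<Longrightarrow> mean (Z N) (\<lambda>x. f (x + a)) = mean (Z N) f"
  by (simp add: mean_def sum_Z_shift)

lemma mean_Z_mult:
  "N > 0 \<Longrightarrow> per N f \<Longrightarrow> coprime a (int N) \<Longrightarrow> mean (Z N) (\<lambda>x. f (a * x)) = mean (Z N) f"
  by (simp add: mean_def sum_Z_mult)

lemma mean_Z_uminus: "N > 0 \<Longrightarrow> per N f \<Longrightarrow> mean (Z N) (\<lambda>x. f (- x)) = mean (Z N) f"
  using mean_Z_mult[of N f "-1"] by simp

lemma mean_Z_reflect: "N > 0 \<Longrightarrow> per N f \<Longrightarrow> mean (Z N) (\<lambda>x. f (a - x)) = mean (Z N) f"
proof -
  assume a: "N > 0" "per N f"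
  have "per N (\<lambda>x. f (a + x))" by (intro perI perD[OF a(2)]) (auto intro: cong_add)
  from mean_Z_uminus[OF a(1) this] mean_Z_shift[OF a, of a] show ?thesis by (simp add: add.commute)
qed

section \<open>Additive characters and the Fourier transform on Z/N\<close>

definition ee :: "nat \<Rightarrow> int \<Rightarrow> complex" where
  "ee N k = cis (2 * pi * real_of_int k / real N)"

lemma ee_add: "ee N (a + b) = ee N a * ee N b"
  by (simp add: ee_def cis_mult add_divide_distrib distrib_left)

lemma ee_0 [simp]: "ee N 0 = 1" by (simp add: ee_def)

lemma cmod_ee [simp]: "cmod (ee N k) = 1" by (simp add: ee_def)

lemma ee_minus: "ee N (- k) = cnj (ee N k)" by (simp add: ee_def cis_cnj)

lemma ee_diff: "ee N (a - b) = ee N a * cnj (ee N b)"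
  using ee_add[of N a "-b"] by (simp add: ee_minus)

lemma ee_mult_cnj [simp]: "ee N k * cnj (ee N k) = 1" "cnj (ee N k) * ee N k = 1"
  using ee_diff[of N k k] by (simp_all add: mult.commute)

lemma ee_power: "ee N (int n * k) = ee N k ^ n"
  by (simp add: ee_def DeMoivre mult_ac)

lemma ee_eq_1_iff: "N > 0 \<Longrightarrow> ee N k = 1 \<longleftrightarrow> int N dvd k"
proof -
  assume N: "N > 0"
  have "ee N k = 1 \<longleftrightarrow> cos (2 * pi * real_of_int k / real N) = 1"
    by (auto simp: ee_def complex_eq_iff dest: cos_one_sin_zero)
  also have "\<dots> \<longleftrightarrow> (\<exists>n::int. 2 * pi * real_of_int k / real N = real_of_int n * 2 * pi)"
    by (simp add: cos_one_2pi_int)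
  also have "\<dots> \<longleftrightarrow> (\<exists>n::int. real_of_int k = real_of_int (n * int N))"
    using N by (simp add: field_simps)
  also have "\<dots> \<longleftrightarrow> int N dvd k"
    by (simp only: of_int_eq_iff dvd_def mult.commute[of "int N"])
  finally show ?thesis .
qed

lemma per_ee: "N > 0 \<Longrightarrow> per N (ee N)"
proof (rule perI)
  fix x y assume "N > 0" "[x = y] (mod int N)"
  hence "ee N (x - y) = 1" by (simp add: ee_eq_1_iff cong_iff_dvd_diff)
  thus "ee N x = ee N y" by (metis add.commute diff_add_cancel ee_add mult.right_neutral)
qed

lemmas ee_cong = perD[OF per_ee]

lemma mean_ee:
  assumes N: "N > 0"
  shows "mean (Z N) (\<lambda>x. ee N (k * x)) = (if int N dvd k then 1 else 0)"
proof (cases "int N dvd k")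
  case True
  hence "ee N (k * x) = 1" for x using N by (simp add: ee_eq_1_iff)
  thus ?thesis using True N by (simp add: mean_const)
next
  case False
  define S where "S = (\<Sum>x\<in>Z N. ee N (k * x))"
  have "per N (\<lambda>x. ee N (k * x))" by (intro perI ee_cong N cong_scalar_left)
  hence "(\<Sum>x\<in>Z N. ee N (k * (x + 1))) = S" unfolding S_def
    by (rule sum_Z_shift[OF N])
  hence "S * ee N k = S" by (simp add: S_def distrib_left ee_add sum_distrib_right)
  hence "S * (ee N k - 1) = 0" by (simp add: algebra_simps)
  with False N have "S = 0" by (simp add: ee_eq_1_iff)
  thus ?thesis using False by (simp add: mean_def S_def)
qed

text \<open>Averages on the group side, sums on the frequency side: the coefficients of a 1-bounded
  function then have square sum at most 1.\<close>

definition ft :: "nat \<Rightarrow> (int \<Rightarrow> complex) \<Rightarrow> int \<Rightarrow> complex" where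
  "ft N f \<xi> = mean (Z N) (\<lambda>v. f v * ee N (- (\<xi> * v)))"

lemma per_ft: "N > 0 \<Longrightarrow> per N (ft N f)"
  unfolding ft_def
  by (intro perI mean_cong arg_cong2[where f = "(*)"] refl ee_cong) (auto intro!: cong_mult simp: cong_minus_minus_iff)

lemma sum_ee_Z: "N > 0 \<Longrightarrow> (\<Sum>x\<in>Z N. ee N (k * x)) = (if int N dvd k then of_nat N else 0)"
  using mean_ee[of N k] by (auto simp: mean_def scaleR_conv_of_real field_simps split: if_splits)

lemma ft_inversion:
  assumes N: "N > 0" and f: "per N f"
  shows "f v = (\<Sum>\<xi>\<in>Z N. ft N f \<xi> * ee N (\<xi> * v))"
proof -
  have "(\<Sum>\<xi>\<in>Z N. ft N f \<xi> * ee N (\<xi> * v)) = mean (Z N) (\<lambda>x. f x * (\<Sum>\<xi>\<in>Z N. ee N ((v - x) * \<xi>)))"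
    unfolding ft_def mean_mult_right[symmetric] mean_sum[symmetric] sum_distrib_left
    by (simp add: mult.assoc ee_add[symmetric] algebra_simps)
  also have "\<dots> = (\<Sum>x\<in>Z N. if x = v mod int N then f x else 0)"
    unfolding mean_def scaleR_sum_right
  proof (intro sum.cong refl)
    fix x assume x: "x \<in> Z N"
    have "int N dvd (v - x) \<longleftrightarrow> x = v mod int N"
      using x by (metis atLeastLessThan_iff mod_eq_dvd_iff mod_pos_pos_trivial)
    thus "(f x * (\<Sum>\<xi>\<in>Z N. ee N ((v - x) * \<xi>))) /\<^sub>R real (card (Z N)) = (if x = v mod int N then f x else 0)"
      using N by (simp add: sum_ee_Z scaleR_conv_of_real)
  qed
  also have "\<dots> = f (v mod int N)" using N by simp
  also have "\<dots> = f v" by (rule perD[OF f]) (simp add: Cong.cong_def)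
  finally show ?thesis ..
qed

lemma parseval_coeffs:
  assumes N: "N > 0"
  shows "mean (Z N) (\<lambda>m. (cmod (\<Sum>\<xi>\<in>Z N. c \<xi> * ee N (\<xi> * m)))\<^sup>2) = (\<Sum>\<xi>\<in>Z N. (cmod (c \<xi>))\<^sup>2)"
proof -
  have "complex_of_real (mean (Z N) (\<lambda>m. (cmod (\<Sum>\<xi>\<in>Z N. c \<xi> * ee N (\<xi> * m)))\<^sup>2))
     = mean (Z N) (\<lambda>m. \<Sum>\<xi>\<in>Z N. \<Sum>\<zeta>\<in>Z N. (c \<xi> * cnj (c \<zeta>)) * ee N ((\<xi> - \<zeta>) * m))"
    unfolding mean_of_real[symmetric] complex_norm_square cnj_sum sum_product left_diff_distrib ee_diff complex_cnj_mult
    by (simp only: mult_ac)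
  also have "\<dots> = (\<Sum>\<xi>\<in>Z N. \<Sum>\<zeta>\<in>Z N. (c \<xi> * cnj (c \<zeta>)) * (if int N dvd \<xi> - \<zeta> then 1 else 0))"
    unfolding mean_sum mean_mult_left mean_ee[OF N] ..
  also have "\<dots> = (\<Sum>\<xi>\<in>Z N. \<Sum>\<zeta>\<in>Z N. if \<zeta> = \<xi> then c \<xi> * cnj (c \<zeta>) else 0)"
  proof (intro sum.cong refl)
    fix \<xi> \<zeta> assume x: "\<xi> \<in> Z N" "\<zeta> \<in> Z N"
    have "int N dvd \<xi> - \<zeta> \<longleftrightarrow> \<zeta> = \<xi>" using Z_cong_eq[OF x] by (auto simp: cong_iff_dvd_diff)
    thus "(c \<xi> * cnj (c \<zeta>)) * (if int N dvd \<xi> - \<zeta> then 1 else 0) = (if \<zeta> = \<xi> then c \<xi> * cnj (c \<zeta>) else 0)"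
      by simp
  qed
  also have "\<dots> = complex_of_real (\<Sum>\<xi>\<in>Z N. (cmod (c \<xi>))\<^sup>2)"
    by (simp add: complex_norm_square[symmetric])
  finally show ?thesis by (simp only: of_real_eq_iff)
qed

lemma parseval:
  assumes N: "N > 0" and f: "per N f"
  shows "(\<Sum>\<xi>\<in>Z N. (cmod (ft N f \<xi>))\<^sup>2) = mean (Z N) (\<lambda>x. (cmod (f x))\<^sup>2)"
  unfolding parseval_coeffs[OF N, symmetric] ft_inversion[OF N f, symmetric] ..

section \<open>Quadratic phases twisted by multiplicative characters\<close>

lemma of_bool_mean_single:
  assumes "N > 0" "a \<in> Z N"
  shows "mean (Z N) (\<lambda>x. if x = a then c else 0) = c /\<^sub>R real N"
  using assms by (simp add: mean_def)

section \<open>Arithmetic modulo an odd prime: inverses and discrete logarithm\<close>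

locale prime_modulus =
  fixes p :: nat
  assumes prime: "prime p" and p_gt_2: "p > 2"
begin

definition q :: nat where "q = p - 1"

lemma p_pos: "p > 0" and q_pos: "q > 0" using p_gt_2 by (auto simp: q_def)

lemma Zp_ne [simp]: "Z p \<noteq> {}" "Z q \<noteq> {}" using p_gt_2 by (auto simp: q_def)

lemma prime_int: "prime (int p)" using prime by simp

lemma coprime_iff: "coprime a (int p) \<longleftrightarrow> \<not> int p dvd a"
  using prime_int prime_imp_coprime[of "int p" a] by (auto simp: coprime_commute prime_int_iff coprime_absorb_left)

lemma two_coprime: "\<not> int p dvd 2"
  using p_gt_2 zdvd_imp_le[of "int p" 2] by auto

lemma Z_nonzero: "x \<in> Z p - {0} \<Longrightarrow> \<not> int p dvd x"
  using zdvd_imp_le[of "int p" x] by auto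

lemma Z_dvd_iff: "x \<in> Z p \<Longrightarrow> int p dvd x \<longleftrightarrow> x = 0"
  using Z_nonzero by auto

text \<open>The choice depends on x only through its residue class, which makes \<open>iv\<close>
  periodic.\<close>

definition iv :: "int \<Rightarrow> int" where
  "iv x = (SOME y. [x * y = 1] (mod int p))"

lemma iv: "\<not> int p dvd x \<Longrightarrow> [x * iv x = 1] (mod int p)"
  unfolding iv_def using someI_ex[OF cong_solve_coprime_int, of x "int p"] by (simp add: coprime_iff)

lemma iv': "\<not> int p dvd x \<Longrightarrow> [iv x * x = 1] (mod int p)"
  using iv[of x] by (simp add: mult.commute)

lemma iv_nonzero: "\<not> int p dvd x \<Longrightarrow> \<not> int p dvd iv x"
proof
  assume "\<not> int p dvd x" "int p dvd iv x"
  hence "[0 = 1] (mod int p)" using iv[of x] by (metis cong_sym cong_trans cong_0_iff dvd_mult)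
  thus False using p_gt_2 by (simp add: Cong.cong_def)
qed

definition gen :: nat where "gen = (SOME g. residue_primroot p g)"

lemma gen: "residue_primroot p gen"
  unfolding gen_def using prime_primitive_root_exists[OF _ prime] p_gt_2 by (metis someI_ex prime_gt_1_nat prime)

text \<open>The discrete logarithm; its values at multiples of \<open>p\<close> are junk.\<close>

definition ind :: "int \<Rightarrow> int" where
  "ind x = int (SOME i. [int gen ^ i = x] (mod int p))"

lemma per_ind: "per p ind"
  unfolding ind_def by (rule perI) (metis cong_sym cong_trans)

lemma ind: assumes "\<not> int p dvd x" shows "[int gen ^ nat (ind x) = x] (mod int p)"
proof -
  have "nat (x mod int p) \<in> totatives p"
  proof -
    have a: "x mod int p > 0" using assms p_pos
      by (metis dvd_eq_mod_eq_0 le_less of_nat_0_less_iff pos_mod_sign)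
    moreover have "x mod int p < int p" using p_pos by simp
    ultimately show ?thesis using prime by (auto simp: totatives_prime)
  qed
  then obtain i where "gen ^ i mod p = nat (x mod int p)"
    using residue_primroot_is_generator[OF _ gen] p_gt_2 unfolding bij_betw_def
    by (metis (no_types, lifting) imageE less_trans one_less_numeral_iff semiring_norm(76))
  hence "int (gen ^ i mod p) = x mod int p" using p_pos by simp
  hence "[int gen ^ i = x] (mod int p)" by (simp add: Cong.cong_def zmod_int)
  hence "[int gen ^ (SOME i. [int gen ^ i = x] (mod int p)) = x] (mod int p)" by (rule someI)
  thus ?thesis by (simp add: ind_def)
qed

lemma gen_pow_cong: "[int gen ^ m = int gen ^ n] (mod int p) \<longleftrightarrow> [m = n] (mod q)"
proof -
  have "[int gen ^ m = int gen ^ n] (mod int p) \<longleftrightarrow> [gen ^ m = gen ^ n] (mod p)"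
    by (metis cong_int_iff of_nat_power)
  also have "\<dots> \<longleftrightarrow> [m = n] (mod ord p gen)"
    using gen by (intro order_divides_expdiff) (simp add: residue_primroot_def)
  also have "ord p gen = q" using gen prime by (simp add: residue_primroot_def totient_prime q_def)
  finally show ?thesis .
qed

lemma ind_nonneg: "ind x \<ge> 0" by (simp add: ind_def)

lemma cong_nat_int: "a \<ge> 0 \<Longrightarrow> b \<ge> 0 \<Longrightarrow> [nat a = nat b] (mod n) \<longleftrightarrow> [a = b] (mod int n)"
  using cong_int_iff[of "nat a" "nat b" n] by simp

lemma not_dvd_mult: "\<not> int p dvd x \<Longrightarrow> \<not> int p dvd y \<Longrightarrow> \<not> int p dvd x * y"
  using prime_dvd_mult_iff[OF prime_int] by blast

lemma ind_mult:
  assumes "\<not> int p dvd x" "\<not> int p dvd y"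
  shows "[ind (x * y) = ind x + ind y] (mod int q)"
proof -
  have "[int gen ^ nat (ind x + ind y) = x * y] (mod int p)"
    using cong_mult[OF ind[OF assms(1)] ind[OF assms(2)]]
    by (simp add: nat_add_distrib ind_nonneg power_add)
  hence "[int gen ^ nat (ind (x * y)) = int gen ^ nat (ind x + ind y)] (mod int p)"
    using ind[OF not_dvd_mult[OF assms]] by (metis cong_sym cong_trans)
  thus ?thesis by (simp add: gen_pow_cong cong_nat_int ind_nonneg)
qed

lemma gen_not_dvd: "\<not> int p dvd int gen ^ n"
proof -
  have "coprime p gen" using gen by (simp add: residue_primroot_def)
  hence "coprime (int gen ^ n) (int p)" by (simp add: coprime_commute)
  thus ?thesis by (simp add: coprime_iff)
qed

text \<open>Exponentiation on Z/q, inverse to \<open>ind\<close>. Reducing k first makes it periodic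
  in k and meaningful for negative k.\<close>

definition gp :: "int \<Rightarrow> int" where "gp k = int gen ^ nat (k mod int q)"

lemma gp_not_dvd: "\<not> int p dvd gp k" by (simp add: gp_def gen_not_dvd)

lemma ind_gp: "[ind (gp k) = k] (mod int q)"
proof -
  have "[int gen ^ nat (ind (gp k)) = gp k] (mod int p)" by (rule ind[OF gp_not_dvd])
  hence "[ind (gp k) = k mod int q] (mod int q)"
    using q_pos by (simp add: gp_def gen_pow_cong cong_nat_int ind_nonneg)
  thus ?thesis by (simp add: Cong.cong_def)
qed

lemma gp_add: "[gp (k + l) = gp k * gp l] (mod int p)"
proof -
  have "gp k * gp l = int gen ^ (nat (k mod int q) + nat (l mod int q))"
    by (simp add: gp_def power_add)
  moreover have "[nat ((k + l) mod int q) = nat (k mod int q) + nat (l mod int q)] (mod q)"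
  proof -
    have "[int (nat ((k + l) mod int q)) = int (nat (k mod int q) + nat (l mod int q))] (mod int q)"
      using q_pos by (simp add: Cong.cong_def mod_add_eq)
    thus ?thesis by (simp only: cong_int_iff)
  qed
  ultimately show ?thesis by (simp add: gen_pow_cong gp_def)
qed

lemma sum_nonzero_gp:
  assumes f: "per p f"
  shows "(\<Sum>x\<in>Z p - {0}. f x) = (\<Sum>k\<in>Z q. f (gp k))"
proof -
  have inj: "inj_on (\<lambda>k. gp k mod int p) (Z q)"
  proof (rule inj_onI)
    fix k l assume kl: "k \<in> Z q" "l \<in> Z q" and "gp k mod int p = gp l mod int p"
    hence "ind (gp k) = ind (gp l)" by (intro perD[OF per_ind]) (simp add: Cong.cong_def)
    hence "[k = l] (mod int q)" using ind_gp by (metis cong_sym cong_trans)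
    thus "k = l" using kl Z_cong_eq by blast
  qed
  have "(\<lambda>k. gp k mod int p) ` Z q = Z p - {0}"
  proof (rule card_subset_eq)
    show "(\<lambda>k. gp k mod int p) ` Z q \<subseteq> Z p - {0}"
      using gp_not_dvd p_pos by (auto simp: dvd_eq_mod_eq_0)
    show "card ((\<lambda>k. gp k mod int p) ` Z q) = card (Z p - {0})"
      using p_pos unfolding card_image[OF inj] by (simp add: q_def)
  qed auto
  hence "(\<Sum>x\<in>Z p - {0}. f x) = (\<Sum>k\<in>Z q. f (gp k mod int p))"
    using sum.reindex[OF inj, of f] by simp
  also have "\<dots> = (\<Sum>k\<in>Z q. f (gp k))"
    by (intro sum.cong refl perD[OF f]) (simp add: Cong.cong_def)
  finally show ?thesis .
qed

text \<open>a and b are a quadratic and a linear additive frequency, k is a multiplicative one.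
  Unlike a Dirichlet character, \<open>ph\<close> has modulus 1 also at multiples of p; for means
  this matters only up to 1/p.\<close>

definition ph :: "int \<Rightarrow> int \<Rightarrow> int \<Rightarrow> int \<Rightarrow> complex" where
  "ph a b k x = ee p (a * x\<^sup>2 + b * x) * ee q (k * ind x)"

lemma cmod_ph [simp]: "cmod (ph a b k x) = 1" by (simp add: ph_def norm_mult)

lemma ph_add: "ph (a + a') (b + b') (k + k') x = ph a b k x * ph a' b' k' x"
  by (simp add: ph_def distrib_right ee_add)

lemma ph_minus: "ph (- a) (- b) (- k) x = cnj (ph a b k x)"
  using ee_minus[of p "a * x\<^sup>2 + b * x"] ee_minus[of q "k * ind x"] by (simp add: ph_def)

lemma ph_diff: "ph (a - a') (b - b') (k - k') x = ph a b k x * cnj (ph a' b' k' x)"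
  using ph_add[of a "- a'" b "- b'" k "- k'"] by (simp add: ph_minus)

lemma ph_0 [simp]: "ph 0 0 0 x = 1" by (simp add: ph_def)

lemma ph_mult_cnj [simp]: "ph a b k x * cnj (ph a b k x) = 1"
  using ph_diff[of a a b b k k x] by simp

lemma ph_cong:
  assumes "[a = a'] (mod int p)" "[b = b'] (mod int p)" "[k = k'] (mod int q)"
  shows "ph a b k = ph a' b' k'"
  unfolding ph_def
  by (intro ext arg_cong2[where f = "(*)"] ee_cong p_pos q_pos cong_add cong_mult assms cong_refl)

lemma per_ph: "per p (ph a b k)"
proof (rule perI)
  fix x y assume xy: "[x = y] (mod int p)"
  have "ind x = ind y" by (rule perD[OF per_ind xy])
  moreover have "ee p (a * x\<^sup>2 + b * x) = ee p (a * y\<^sup>2 + b * y)"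
    by (intro ee_cong p_pos cong_add cong_mult cong_pow cong_refl xy)
  ultimately show "ph a b k x = ph a b k y" by (simp add: ph_def)
qed

text \<open>The fourth root undoes the fourth power in \<open>ph_nonzero_bound\<close>; 1/p pays for
  the value at 0.\<close>

definition tau :: real where "tau = root 4 (4 / (real p - 1)) + 1 / real p"

section \<open>Power-saving bounds for the means of twisted quadratic phases\<close>

lemma square_fiber_card: "card {l \<in> Z p. [l\<^sup>2 = c] (mod int p)} \<le> 2"
proof (cases "{l \<in> Z p. [l\<^sup>2 = c] (mod int p)} = {}")
  case False
  then obtain m where m: "m \<in> Z p" "[m\<^sup>2 = c] (mod int p)" by auto
  have "{l \<in> Z p. [l\<^sup>2 = c] (mod int p)} \<subseteq> {m, (- m) mod int p}"
  proof
    fix l assume "l \<in> {l \<in> Z p. [l\<^sup>2 = c] (mod int p)}"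
    hence l: "l \<in> Z p" "[l\<^sup>2 = c] (mod int p)" by auto
    have "[l\<^sup>2 = m\<^sup>2] (mod int p)" using l m by (metis cong_sym cong_trans)
    hence "int p dvd (l - m) * (l + m)"
      by (simp add: cong_iff_dvd_diff power2_eq_square algebra_simps)
    hence "int p dvd l - m \<or> int p dvd l - (- m)" using prime_dvd_mult_iff[OF prime_int] by simp
    thus "l \<in> {m, (- m) mod int p}"
    proof
      assume "int p dvd l - m"
      thus ?thesis using Z_cong_eq[OF l(1) m(1)] by (simp add: cong_iff_dvd_diff)
    next
      assume "int p dvd l - (- m)"
      hence "[l = - m] (mod int p)" by (simp add: cong_iff_dvd_diff)
      thus ?thesis using l(1) by (simp add: Cong.cong_def)
    qed
  qed
  hence "card {l \<in> Z p. [l\<^sup>2 = c] (mod int p)} \<le> card {m, (- m) mod int p}"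
    by (rule card_mono[rotated]) simp
  also have "\<dots> \<le> 2" by (simp add: card_insert_if)
  finally show ?thesis .
qed (metis card.empty zero_le)

text \<open>Fourth moment over all quadratic phases; only the diagonal solutions of
  \<open>x + y = z + w\<close>, \<open>x\<^sup>2 + y\<^sup>2 = z\<^sup>2 + w\<^sup>2\<close> survive.\<close>

lemma fourth_moment:
  assumes u: "\<And>x. cmod (u x) \<le> 1"
  shows "mean (Z p) (\<lambda>a. mean (Z p) (\<lambda>b. cmod (mean (Z p) (\<lambda>x. u x * ee p (a * x\<^sup>2 + b * x))) ^ 4)) \<le> 2 / real p ^ 2"
proof -
  define A where "A x y z w = x\<^sup>2 + y\<^sup>2 - (z\<^sup>2 + w\<^sup>2)" for x y z w :: int
  define B where "B x y z w = x + y - (z + w)" for x y z w :: int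
  define c where "c x y z w = u x * u y * cnj (u z * u w)" for x y z w
  let ?M = "mean (Z p)"
  define I where "I x y z w = (if int p dvd A x y z w then 1 else 0) * (if int p dvd B x y z w then 1 else 0 :: real)" for x y z w
  define S where "S a b = ?M (\<lambda>x. u x * ee p (a * x\<^sup>2 + b * x))" for a b
  have S4: "complex_of_real (cmod (S a b) ^ 4) = ?M (\<lambda>x. ?M (\<lambda>y. ?M (\<lambda>z. ?M (\<lambda>w.
      c x y z w * (ee p (A x y z w * a) * ee p (B x y z w * b))))))" for a b
  proof -
    have S2: "S a b * S a b = ?M (\<lambda>x. ?M (\<lambda>y. (u x * ee p (a * x\<^sup>2 + b * x)) * (u y * ee p (a * y\<^sup>2 + b * y))))"
      unfolding S_def by (rule mean_mult)
    have "complex_of_real (cmod (S a b) ^ 4) = complex_of_real ((cmod (S a b * S a b))\<^sup>2)"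
      by (simp add: norm_mult power4_eq_xxxx power2_eq_square)
    also have "\<dots> = (S a b * S a b) * cnj (S a b * S a b)" by (rule complex_norm_square)
    also have "\<dots> = ?M (\<lambda>x. ?M (\<lambda>y. ((u x * ee p (a * x\<^sup>2 + b * x)) * (u y * ee p (a * y\<^sup>2 + b * y))) *
       ?M (\<lambda>z. ?M (\<lambda>w. cnj ((u z * ee p (a * z\<^sup>2 + b * z)) * (u w * ee p (a * w\<^sup>2 + b * w)))))))"
      unfolding S2 by (simp only: mean_cnj mean_mult_right)
    also have "\<dots> = ?M (\<lambda>x. ?M (\<lambda>y. ?M (\<lambda>z. ?M (\<lambda>w.
      c x y z w * (ee p (A x y z w * a) * ee p (B x y z w * b))))))"
      unfolding mean_mult_left[symmetric]
    proof (intro mean_cong)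
      fix x y z w
      have "ee p (A x y z w * a) * ee p (B x y z w * b) =
        ee p ((a * x\<^sup>2 + b * x) + (a * y\<^sup>2 + b * y) - ((a * z\<^sup>2 + b * z) + (a * w\<^sup>2 + b * w)))"
        unfolding ee_add[symmetric] A_def B_def by (rule arg_cong[where f = "ee p"]) (simp add: algebra_simps)
      also have "\<dots> = ee p (a * x\<^sup>2 + b * x) * ee p (a * y\<^sup>2 + b * y) *
         (cnj (ee p (a * z\<^sup>2 + b * z)) * cnj (ee p (a * w\<^sup>2 + b * w)))"
        by (simp only: ee_diff[of p "(a * x\<^sup>2 + b * x) + (a * y\<^sup>2 + b * y)"]
              ee_add[of p "a * x\<^sup>2 + b * x"] ee_add[of p "a * z\<^sup>2 + b * z"] complex_cnj_mult)
      finally show "((u x * ee p (a * x\<^sup>2 + b * x)) * (u y * ee p (a * y\<^sup>2 + b * y))) *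
         cnj ((u z * ee p (a * z\<^sup>2 + b * z)) * (u w * ee p (a * w\<^sup>2 + b * w))) =
         c x y z w * (ee p (A x y z w * a) * ee p (B x y z w * b))"
        by (simp only: c_def complex_cnj_mult mult_ac)
    qed
    finally show ?thesis .
  qed
  have avg: "?M (\<lambda>a. ?M (\<lambda>b. c x y z w * (ee p (A x y z w * a) * ee p (B x y z w * b)))) = c x y z w * complex_of_real (I x y z w)" for x y z w
  proof -
    have "?M (\<lambda>a. ?M (\<lambda>b. c x y z w * (ee p (A x y z w * a) * ee p (B x y z w * b)))) =
      c x y z w * (?M (\<lambda>a. ee p (A x y z w * a)) * ?M (\<lambda>b. ee p (B x y z w * b)))"
      by (simp only: mean_mult_left mean_mult_right)
    thus ?thesis by (simp add: mean_ee[OF p_pos] I_def)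
  qed
  define R where "R = ?M (\<lambda>a. ?M (\<lambda>b. cmod (S a b) ^ 4))"
  have "complex_of_real R = ?M (\<lambda>a. ?M (\<lambda>b. ?M (\<lambda>x. ?M (\<lambda>y. ?M (\<lambda>z. ?M (\<lambda>w.
      c x y z w * (ee p (A x y z w * a) * ee p (B x y z w * b))))))))"
    unfolding R_def mean_of_real[symmetric] S4 ..
  also have "\<dots> = ?M (\<lambda>x. ?M (\<lambda>y. ?M (\<lambda>z. ?M (\<lambda>w. ?M (\<lambda>a. ?M (\<lambda>b.
      c x y z w * (ee p (A x y z w * a) * ee p (B x y z w * b))))))))"
  proof -
    have sw: "?M (\<lambda>b. ?M (\<lambda>x. ?M (\<lambda>y. ?M (\<lambda>z. ?M (\<lambda>w. F b x y z w))))) =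
       ?M (\<lambda>x. ?M (\<lambda>y. ?M (\<lambda>z. ?M (\<lambda>w. ?M (\<lambda>b. F b x y z w)))))" for F :: "int \<Rightarrow> int \<Rightarrow> int \<Rightarrow> int \<Rightarrow> int \<Rightarrow> complex"
    proof -
      have "?M (\<lambda>b. ?M (\<lambda>x. ?M (\<lambda>y. ?M (\<lambda>z. ?M (\<lambda>w. F b x y z w))))) = ?M (\<lambda>x. ?M (\<lambda>b. ?M (\<lambda>y. ?M (\<lambda>z. ?M (\<lambda>w. F b x y z w)))))"
        by (rule mean_swap)
      also have "\<dots> = ?M (\<lambda>x. ?M (\<lambda>y. ?M (\<lambda>b. ?M (\<lambda>z. ?M (\<lambda>w. F b x y z w)))))"
        by (intro mean_cong mean_swap)
      also have "\<dots> = ?M (\<lambda>x. ?M (\<lambda>y. ?M (\<lambda>z. ?M (\<lambda>b. ?M (\<lambda>w. F b x y z w)))))"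
        by (rule mean_cong, rule mean_cong, rule mean_swap)
      also have "\<dots> = ?M (\<lambda>x. ?M (\<lambda>y. ?M (\<lambda>z. ?M (\<lambda>w. ?M (\<lambda>b. F b x y z w)))))"
        by (rule mean_cong, rule mean_cong, rule mean_cong, rule mean_swap)
      finally show ?thesis .
    qed
    show ?thesis by (rule trans[OF mean_cong[OF sw] sw])
  qed
  also have "\<dots> = ?M (\<lambda>x. ?M (\<lambda>y. ?M (\<lambda>z. ?M (\<lambda>w. c x y z w * complex_of_real (I x y z w)))))"
    unfolding avg ..
  finally have R: "complex_of_real R = \<dots>" .
  have "R \<le> cmod (complex_of_real R)" by simp
  also have "\<dots> \<le> ?M (\<lambda>x. ?M (\<lambda>y. ?M (\<lambda>z. ?M (\<lambda>w. cmod (c x y z w * complex_of_real (I x y z w))))))"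
    unfolding R by (rule order.trans[OF norm_mean_le mean_mono], rule order.trans[OF norm_mean_le mean_mono],
        rule order.trans[OF norm_mean_le mean_mono], rule norm_mean_le)
  also have "\<dots> \<le> ?M (\<lambda>x. ?M (\<lambda>y. ?M (\<lambda>z. ?M (\<lambda>w. I x y z w))))"
  proof (intro mean_mono)
    fix x y z w
    have "cmod (c x y z w) \<le> 1" unfolding c_def
      by (simp add: norm_mult mult_le_one u)
    moreover have "I x y z w \<ge> 0" by (simp add: I_def)
    ultimately show "cmod (c x y z w * complex_of_real (I x y z w)) \<le> I x y z w"
      by (simp add: norm_mult mult_left_le_one_le)
  qed
  also have "\<dots> \<le> 2 / real p ^ 2"
  proof (rule mean_bound[OF _ Zp_ne(1)], simp, rule mean_bound[OF _ Zp_ne(1)], simp)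
    fix x y assume x: "x \<in> Z p" and y: "y \<in> Z p"
    have "?M (\<lambda>w. I x y z w) \<le> ((if z = x then 1 else 0) + (if z = y then 1 else 0)) * (1 / real p)" if z: "z \<in> Z p" for z
    proof -
      have "I x y z w \<le> ((if z = x then 1 else 0) + (if z = y then 1 else 0)) * (if w = (x + y - z) mod int p then 1 else 0)" if w: "w \<in> Z p" for w
      proof (cases "int p dvd A x y z w \<and> int p dvd B x y z w")
        case True
        hence "[w = x + y - z] (mod int p)"
          by (simp add: B_def cong_iff_dvd_diff) (metis add.commute diff_diff_eq dvd_minus_iff minus_diff_eq)
        hence w': "w = (x + y - z) mod int p" using w by (simp add: Cong.cong_def)
        \<comment> \<open>Combining the two congruences gives 2(z - x)(z - y) = 0, so z is x or y
          because p is odd.\<close>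
        have "2 * ((z - x) * (z - y)) = - (A x y z w) + B x y z w * (x + y - z + w)"
          by (simp add: A_def B_def power2_eq_square algebra_simps)
        hence "int p dvd 2 * ((z - x) * (z - y))" using True by simp
        hence "int p dvd z - x \<or> int p dvd z - y"
          using two_coprime prime_dvd_mult_iff[OF prime_int] by blast
        hence "z = x \<or> z = y" using Z_cong_eq[OF z x] Z_cong_eq[OF z y] by (auto simp: cong_iff_dvd_diff)
        thus ?thesis using w' by (auto simp: I_def)
      qed (auto simp: I_def)
      hence "?M (\<lambda>w. I x y z w) \<le> ?M (\<lambda>w. ((if z = x then 1 else 0) + (if z = y then 1 else 0)) * (if w = (x + y - z) mod int p then 1 else 0))"
        by (rule mean_mono)
      also have "\<dots> = ((if z = x then 1 else 0) + (if z = y then 1 else 0)) * (1 / real p)"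
        unfolding mean_mult_left using p_pos by (subst of_bool_mean_single) (auto simp: divide_inverse)
      finally show ?thesis .
    qed
    hence "?M (\<lambda>z. ?M (\<lambda>w. I x y z w)) \<le> ?M (\<lambda>z. ((if z = x then 1 else 0) + (if z = y then 1 else 0)) * (1 / real p))"
      by (rule mean_mono)
    also have "\<dots> = 2 / real p ^ 2"
      unfolding mean_mult_right mean_add of_bool_mean_single[OF p_pos x] of_bool_mean_single[OF p_pos y]
      by (simp add: power2_eq_square divide_inverse)
    finally show "?M (\<lambda>z. ?M (\<lambda>w. I x y z w)) \<le> 2 / real p ^ 2" .
  qed
  finally show ?thesis unfolding R_def S_def .
qed

text \<open>Substituting lx for x multiplies the multiplicative character by a constant and sends
  (a, b) to \<open>(a * l\<^sup>2, b * l)\<close>. So one sum is as large as all those on its orbit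
  of p - 1 dilates, and the fourth moment over all (a, b) bounds their total.\<close>

lemma ph_nonzero_bound:
  assumes ab: "\<not> (int p dvd a \<and> int p dvd b)"
  shows "cmod (mean (Z p) (\<lambda>x. (if int p dvd x then 0 else ee q (k * ind x)) * ee p (a * x\<^sup>2 + b * x))) ^ 4 \<le> 4 / (real p - 1)"
proof -
  define u where "u x = (if int p dvd x then 0 else ee q (k * ind x))" for x
  have peru: "per p u"
    unfolding u_def by (rule perI) (metis per_ind perD cong_dvd_iff)
  define S where "S a b = cmod (mean (Z p) (\<lambda>x. u x * ee p (a * x\<^sup>2 + b * x))) ^ 4" for a b
  have S0: "S a b \<ge> 0" for a b by (simp add: S_def)
  have percong: "S a b = S a' b'" if "[a = a'] (mod int p)" "[b = b'] (mod int p)" for a b a' b'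
    unfolding S_def
    by (intro arg_cong[where f = "\<lambda>z. cmod z ^ 4"] mean_cong arg_cong2[where f = "(*)"] refl ee_cong[OF p_pos] cong_add cong_mult that cong_refl)
  have dil: "S (a * l\<^sup>2) (b * l) = S a b" if l: "l \<in> Z p - {0}" for l
  proof -
    have l': "\<not> int p dvd l" using Z_nonzero[OF l] .
    have "mean (Z p) (\<lambda>x. u x * ee p (a * x\<^sup>2 + b * x)) = mean (Z p) (\<lambda>x. u (l * x) * ee p (a * (l * x)\<^sup>2 + b * (l * x)))"
    proof (rule mean_Z_mult[OF p_pos, symmetric])
      show "per p (\<lambda>x. u x * ee p (a * x\<^sup>2 + b * x))"
      proof (rule perI)
        fix x y assume xy: "[x = y] (mod int p)"
        have "ee p (a * x\<^sup>2 + b * x) = ee p (a * y\<^sup>2 + b * y)"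
          by (intro ee_cong p_pos cong_add cong_mult cong_pow cong_refl xy)
        thus "u x * ee p (a * x\<^sup>2 + b * x) = u y * ee p (a * y\<^sup>2 + b * y)"
          using perD[OF peru xy] by simp
      qed
      show "coprime l (int p)" using l' by (simp add: coprime_iff)
    qed
    also have "\<dots> = mean (Z p) (\<lambda>x. ee q (k * ind l) * (u x * ee p (a * l\<^sup>2 * x\<^sup>2 + b * l * x)))"
    proof (rule mean_cong)
      fix x
      have "u (l * x) = ee q (k * ind l) * u x"
      proof (cases "int p dvd x")
        case False
        have "ee q (k * ind (l * x)) = ee q (k * (ind l + ind x))"
          by (intro ee_cong q_pos cong_mult cong_refl ind_mult l' False)
        thus ?thesis using False l' not_dvd_mult[OF l' False] by (simp add: u_def distrib_left ee_add)
      qed (simp add: u_def)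
      moreover have "ee p (a * (l * x)\<^sup>2 + b * (l * x)) = ee p (a * l\<^sup>2 * x\<^sup>2 + b * l * x)"
        by (simp add: power_mult_distrib mult_ac)
      ultimately show "u (l * x) * ee p (a * (l * x)\<^sup>2 + b * (l * x)) = ee q (k * ind l) * (u x * ee p (a * l\<^sup>2 * x\<^sup>2 + b * l * x))"
        by simp
    qed
    finally show ?thesis by (simp add: S_def mean_mult_left norm_mult)
  qed
  have "S a b * (real p - 1) = (\<Sum>l\<in>Z p - {0}. S (a * l\<^sup>2) (b * l))"
    using p_pos by (simp add: dil card_Diff_singleton_if of_nat_diff)
  also have "\<dots> \<le> (\<Sum>l\<in>Z p. S (a * l\<^sup>2) (b * l))"
    by (intro sum_mono2) (auto simp: S0)
  \<comment> \<open>The orbit map is injective in l if b is nonzero and at most two-to-one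
    otherwise; the factor 2 covers both cases.\<close>
  also have "\<dots> \<le> 2 * (\<Sum>a\<in>Z p. \<Sum>b\<in>Z p. S a b)"
  proof (cases "int p dvd b")
    case False
    have "(\<Sum>l\<in>Z p. S (a * l\<^sup>2) (b * l)) \<le> (\<Sum>l\<in>Z p. \<Sum>c\<in>Z p. S c (b * l))"
    proof (intro sum_mono)
      fix l
      have "S (a * l\<^sup>2) (b * l) = S ((a * l\<^sup>2) mod int p) (b * l)" by (intro percong) (auto simp: Cong.cong_def)
      also have "\<dots> \<le> (\<Sum>c\<in>Z p. S c (b * l))" using p_pos by (intro member_le_sum) (auto simp: S0)
      finally show "S (a * l\<^sup>2) (b * l) \<le> (\<Sum>c\<in>Z p. S c (b * l))" .
    qed
    also have "\<dots> = (\<Sum>l\<in>Z p. \<Sum>c\<in>Z p. S c l)"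
      by (rule sum_Z_mult[OF p_pos, of "\<lambda>l. \<Sum>c\<in>Z p. S c l"])
         (auto simp: coprime_iff False intro!: perI sum.cong percong)
    also have "\<dots> = (\<Sum>a\<in>Z p. \<Sum>b\<in>Z p. S a b)" by (rule sum.swap)
    also have "\<dots> \<le> 2 * \<dots>" by (simp add: S0 sum_nonneg)
    finally show ?thesis .
  next
    case True
    hence a: "\<not> int p dvd a" using ab by simp
    have "(\<Sum>l\<in>Z p. S (a * l\<^sup>2) (b * l)) = (\<Sum>l\<in>Z p. \<Sum>c\<in>Z p. if [l\<^sup>2 = c] (mod int p) then S (a * c) 0 else 0)"
    proof (intro sum.cong refl)
      fix l
      have "(\<Sum>c\<in>Z p. if [l\<^sup>2 = c] (mod int p) then S (a * c) 0 else 0) = (\<Sum>c\<in>Z p. if c = l\<^sup>2 mod int p then S (a * c) 0 else 0)"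
        by (intro sum.cong refl) (auto simp: Cong.cong_def)
      also have "\<dots> = S (a * (l\<^sup>2 mod int p)) 0" using p_pos by simp
      also have "\<dots> = S (a * l\<^sup>2) (b * l)"
        using True by (intro percong cong_mult) (auto simp: Cong.cong_def)
      finally show "S (a * l\<^sup>2) (b * l) = (\<Sum>c\<in>Z p. if [l\<^sup>2 = c] (mod int p) then S (a * c) 0 else 0)" ..
    qed
    also have "\<dots> = (\<Sum>c\<in>Z p. \<Sum>l\<in>Z p. if [l\<^sup>2 = c] (mod int p) then S (a * c) 0 else 0)" by (rule sum.swap)
    also have "\<dots> = (\<Sum>c\<in>Z p. real (card {l \<in> Z p. [l\<^sup>2 = c] (mod int p)}) * S (a * c) 0)"
      by (simp add: sum.inter_filter[symmetric])
    also have "\<dots> \<le> (\<Sum>c\<in>Z p. 2 * S (a * c) 0)"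
      using square_fiber_card by (intro sum_mono mult_right_mono S0) (metis of_nat_le_iff of_nat_numeral)
    also have "\<dots> = 2 * (\<Sum>c\<in>Z p. S (a * c) 0)" by (simp add: sum_distrib_left)
    also have "(\<Sum>c\<in>Z p. S (a * c) 0) = (\<Sum>c\<in>Z p. S c 0)"
      by (rule sum_Z_mult[OF p_pos, of "\<lambda>c. S c 0"]) (auto simp: coprime_iff a intro!: perI percong)
    also have "\<dots> \<le> (\<Sum>c\<in>Z p. \<Sum>b\<in>Z p. S c b)"
      using p_pos by (intro sum_mono member_le_sum) (auto simp: S0)
    finally show ?thesis by simp
  qed
  also have "\<dots> = 2 * (real p ^ 2 * mean (Z p) (\<lambda>a. mean (Z p) (\<lambda>b. S a b)))"
    using p_pos by (simp add: mean_def power2_eq_square sum_distrib_left[symmetric] sum_divide_distrib[symmetric] divide_inverse[symmetric] field_simps)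
  also have "\<dots> \<le> 2 * (real p ^ 2 * (2 / real p ^ 2))"
    unfolding S_def by (intro mult_left_mono fourth_moment) (auto simp: u_def)
  also have "\<dots> = 4" using p_pos by simp
  finally have "S a b \<le> 4 / (real p - 1)" using p_gt_2 by (simp add: field_simps)
  thus ?thesis by (simp add: S_def u_def)
qed

lemma tau_nonneg: "tau \<ge> 0"
  using p_gt_2 by (simp add: tau_def)

lemma cmod_mean_ph:
  assumes "\<not> (int p dvd a \<and> int p dvd b \<and> int q dvd k)"
  shows "cmod (mean (Z p) (ph a b k)) \<le> tau"
proof -
  define u where "u x = (if int p dvd x then 0 else ee q (k * ind x))" for x
  define T where "T = mean (Z p) (\<lambda>x. u x * ee p (a * x\<^sup>2 + b * x))"
  have T: "cmod T \<le> root 4 (4 / (real p - 1))"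
  proof (cases "int p dvd a \<and> int p dvd b")
    case False
    hence "cmod T ^ 4 \<le> 4 / (real p - 1)" unfolding T_def u_def by (rule ph_nonzero_bound)
    hence "root 4 (cmod T ^ 4) \<le> root 4 (4 / (real p - 1))" by simp
    thus ?thesis by (simp add: real_root_power_cancel)
  next
    case True
    \<comment> \<open>Only a nontrivial multiplicative character is left, and its sum over the full
      group vanishes.\<close>
    hence k: "\<not> int q dvd k" using assms by simp
    have e1: "ee p (a * x\<^sup>2 + b * x) = 1" for x using True by (simp add: ee_eq_1_iff p_pos)
    have peru: "per p u"
      unfolding u_def by (rule perI) (metis per_ind perD cong_dvd_iff)
    have "(\<Sum>x\<in>Z p. u x) = (\<Sum>x\<in>Z p - {0}. u x)"
      by (rule sum.mono_neutral_right) (auto simp: u_def)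
    also have "\<dots> = (\<Sum>j\<in>Z q. u (gp j))" by (rule sum_nonzero_gp[OF peru])
    also have "\<dots> = (\<Sum>j\<in>Z q. ee q (k * j))"
      by (intro sum.cong refl) (auto simp: u_def gp_not_dvd intro!: ee_cong q_pos cong_mult ind_gp)
    also have "\<dots> = 0" using k by (simp add: sum_ee_Z q_pos)
    finally have "T = 0" by (simp add: T_def e1 mean_def)
    thus ?thesis using p_gt_2 by simp
  qed
  have "mean (Z p) (ph a b k) - T = mean (Z p) (\<lambda>x. if x = 0 then ph a b k 0 else 0)"
    unfolding T_def mean_diff[symmetric]
    by (intro mean_cong) (auto simp: u_def ph_def Z_dvd_iff mult.commute)
  also have "\<dots> = ph a b k 0 /\<^sub>R real p" using p_pos by (intro of_bool_mean_single) auto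
  finally have "cmod (mean (Z p) (ph a b k) - T) = 1 / real p" by (simp add: divide_inverse)
  thus ?thesis using T norm_triangle_sub[of "mean (Z p) (ph a b k)" T] by (simp add: tau_def)
qed

end

section \<open>The counting lemma\<close>

text \<open>The form in which a single residue where a substitution degenerates, usually 0, is
  discarded.\<close>

lemma mean_indicator_le:
  fixes f g :: "int \<Rightarrow> real"
  assumes "N > 0" "\<And>x. x \<in> Z N \<Longrightarrow> f x \<le> g x + (if x = a then 1 else 0)"
  shows "mean (Z N) f \<le> mean (Z N) g + 1 / real N"
proof -
  have "mean (Z N) f \<le> mean (Z N) (\<lambda>x. g x + (if x = a then 1 else 0))"
    by (rule mean_mono) (rule assms)
  also have "\<dots> = mean (Z N) g + mean (Z N) (\<lambda>x. if x = a then 1 else 0)" by (rule mean_add)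
  also have "mean (Z N) (\<lambda>x. if x = a then 1 else 0 :: real) \<le> 1 / real N"
    using assms(1) by (simp add: mean_def divide_inverse)
  finally show ?thesis by simp
qed

lemma per_comp: "per N f \<Longrightarrow> (\<And>x y. [x = y] (mod int N) \<Longrightarrow> [g x = g y] (mod int N)) \<Longrightarrow> per N (\<lambda>x. f (g x))"
  by (auto intro!: perI dest: perD)

context prime_modulus
begin

definition L :: "(int \<Rightarrow> complex) \<Rightarrow> (int \<Rightarrow> complex) \<Rightarrow> (int \<Rightarrow> complex) \<Rightarrow> (int \<Rightarrow> complex) \<Rightarrow> complex" where
  "L f1 f2 f3 f4 = mean (Z p) (\<lambda>x. mean (Z p) (\<lambda>y. f1 x * f2 y * f3 (x + y) * f4 (x * y)))"

abbreviation M :: "(int \<Rightarrow> 'a::real_vector) \<Rightarrow> 'a" where "M \<equiv> mean (Z p)"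

lemma per_iv: "per p iv"
  unfolding iv_def
  by (rule perI) (metis cong_scalar_right cong_sym cong_trans)

lemma cmod_M_le: "(\<And>x. x \<in> Z p \<Longrightarrow> cmod (f x) \<le> 1) \<Longrightarrow> cmod (M f) \<le> 1"
  by (rule norm_mean_bound) (use Zp_ne in auto)

lemma M_le: "(\<And>x. x \<in> Z p \<Longrightarrow> f x \<le> B) \<Longrightarrow> M f \<le> B" for f :: "int \<Rightarrow> real"
  by (rule mean_bound) (use Zp_ne in auto)

lemma square_M_le_1: "(\<And>x. x \<in> Z p \<Longrightarrow> cmod (f x) \<le> 1) \<Longrightarrow> (cmod (M f))\<^sup>2 \<le> 1"
  using cmod_M_le[of f] by (simp add: power_le_one)

text \<open>The multiplicative derivative of f in direction h, as in the Gowers norms.\<close>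

definition dd :: "(int \<Rightarrow> complex) \<Rightarrow> int \<Rightarrow> int \<Rightarrow> complex" where
  "dd f h v = f v * cnj (f (v + h))"

lemma per_dd: assumes f: "per p f" shows "per p (dd f h)"
  unfolding dd_def by (intro perI arg_cong2[where f = "(*)"] arg_cong[where f = cnj] perD[OF f] cong_add cong_refl)

lemma dd_cong: assumes f: "per p f" and h: "[h = h'] (mod int p)" shows "dd f h = dd f h'"
  unfolding dd_def by (intro ext arg_cong2[where f = "(*)"] arg_cong[where f = cnj] refl perD[OF f] cong_add cong_refl h)

text \<open>A quadratic phase turns the derivative spectrum along the line \<open>\<xi> = \<theta> h\<close> into a
  \<open>U\<^sup>2\<close> norm.\<close>

lemma derivative_spectrum_on_line:
  assumes f: "per p f" and f1: "\<And>x. cmod (f x) \<le> 1"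
    and unif: "\<And>a b. cmod (M (\<lambda>s. f s * ph a b 0 s)) \<le> \<eta>"
  shows "M (\<lambda>h. (cmod (ft p (dd f h) (\<theta> * h)))\<^sup>2) \<le> \<eta>\<^sup>2"
proof -
  define t where "t = \<theta> * iv 2"
  have t: "[2 * t = \<theta>] (mod int p)"
    using cong_scalar_left[OF iv[OF two_coprime], of \<theta>] by (simp add: t_def mult_ac)
  \<comment> \<open>As 2t = \<theta>, the derivative of this twist in direction h is
    \<open>dd f h v\<close> times \<open>ee p (- (\<theta> * h * v))\<close>, up to a constant
    phase. Its mean therefore has the modulus of the coefficient at \<theta>h.\<close>
  define g where "g v = f v * ee p (t * v\<^sup>2)" for v
  have g: "per p g"
  proof (rule perI)
    fix x y assume xy: "[x = y] (mod int p)"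
    have "ee p (t * x\<^sup>2) = ee p (t * y\<^sup>2)" by (intro ee_cong p_pos cong_mult cong_pow cong_refl xy)
    thus "g x = g y" using perD[OF f xy] by (simp add: g_def)
  qed
  define c where "c = ft p g"
  have c: "cmod (c \<xi>) \<le> \<eta>" for \<xi>
  proof -
    have "c \<xi> = M (\<lambda>s. f s * ph t (- \<xi>) 0 s)"
      unfolding c_def ft_def g_def ph_def by (simp add: mult.assoc ee_add[symmetric])
    thus ?thesis using unif by simp
  qed
  have dg: "M (\<lambda>v. g v * cnj (g (v + h))) = (\<Sum>\<xi>\<in>Z p. c \<xi> * cnj (c \<xi>) * cnj (ee p (\<xi> * h)))" for h
  proof -
    have "M (\<lambda>v. g v * cnj (g (v + h))) = M (\<lambda>v. \<Sum>\<xi>\<in>Z p. (g v * ee p (- (\<xi> * v))) * (cnj (c \<xi>) * cnj (ee p (\<xi> * h))))"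
      by (rule mean_cong, subst ft_inversion[OF p_pos g, of "_ + h"])
         (simp add: c_def cnj_sum sum_distrib_left distrib_left ee_add ee_minus mult_ac)
    also have "\<dots> = (\<Sum>\<xi>\<in>Z p. c \<xi> * (cnj (c \<xi>) * cnj (ee p (\<xi> * h))))"
      unfolding mean_sum mean_mult_right c_def by (simp add: ft_def)
    finally show ?thesis by (simp add: mult.assoc)
  qed
  have key: "cmod (ft p (dd f h) (\<theta> * h)) = cmod (\<Sum>\<xi>\<in>Z p. (c \<xi> * cnj (c \<xi>)) * ee p (\<xi> * h))" for h
  proof -
    have "M (\<lambda>v. g v * cnj (g (v + h))) = M (\<lambda>v. (dd f h v * ee p (- (\<theta> * h * v))) * ee p (- (t * h\<^sup>2)))"
    proof (rule mean_cong)
      fix v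
      have "ee p (t * v\<^sup>2) * cnj (ee p (t * (v + h)\<^sup>2)) = ee p (t * v\<^sup>2 - t * (v + h)\<^sup>2)"
        by (simp only: ee_diff)
      also have "t * v\<^sup>2 - t * (v + h)\<^sup>2 = - (2 * t * h * v) + - (t * h\<^sup>2)"
        by (simp add: power2_eq_square algebra_simps)
      also have "ee p \<dots> = ee p (- (\<theta> * h * v)) * ee p (- (t * h\<^sup>2))"
        unfolding ee_add by (intro arg_cong2[where f = "(*)"] ee_cong p_pos refl)
          (auto simp: cong_minus_minus_iff intro!: cong_mult t)
      finally show "g v * cnj (g (v + h)) = (dd f h v * ee p (- (\<theta> * h * v))) * ee p (- (t * h\<^sup>2))"
        by (simp add: g_def dd_def mult_ac)
    qed
    hence "cmod (M (\<lambda>v. g v * cnj (g (v + h)))) = cmod (ft p (dd f h) (\<theta> * h))"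
      by (simp add: mean_mult_right norm_mult ft_def)
    hence "cmod (ft p (dd f h) (\<theta> * h)) = cmod (cnj (\<Sum>\<xi>\<in>Z p. c \<xi> * cnj (c \<xi>) * cnj (ee p (\<xi> * h))))"
      by (simp only: dg complex_mod_cnj)
    thus ?thesis by (simp add: cnj_sum mult_ac)
  qed
  \<comment> \<open>By \<open>key\<close> and Parseval the average is the sum of the fourth powers
    of the coefficients of \<open>g\<close>. Uniformity bounds two of the four factors, Parseval the
    sum over the other two.\<close>
  have "M (\<lambda>h. (cmod (ft p (dd f h) (\<theta> * h)))\<^sup>2) = (\<Sum>\<xi>\<in>Z p. (cmod (c \<xi> * cnj (c \<xi>)))\<^sup>2)"
    unfolding key by (rule parseval_coeffs[OF p_pos])
  also have "\<dots> \<le> (\<Sum>\<xi>\<in>Z p. \<eta>\<^sup>2 * (cmod (c \<xi>))\<^sup>2)"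
  proof (rule sum_mono)
    fix \<xi>
    have "(cmod (c \<xi>))\<^sup>2 \<le> \<eta>\<^sup>2" by (intro power_mono c) simp
    thus "(cmod (c \<xi> * cnj (c \<xi>)))\<^sup>2 \<le> \<eta>\<^sup>2 * (cmod (c \<xi>))\<^sup>2"
      unfolding norm_mult complex_mod_cnj power_mult_distrib by (rule mult_right_mono) simp
  qed
  also have "\<dots> = \<eta>\<^sup>2 * M (\<lambda>x. (cmod (g x))\<^sup>2)"
    by (simp add: sum_distrib_left[symmetric] c_def parseval[OF p_pos g])
  also have "\<dots> \<le> \<eta>\<^sup>2 * 1"
    using f1 by (intro mult_left_mono M_le) (auto simp: g_def norm_mult power_le_one)
  finally show ?thesis by simp
qed

text \<open>By Parseval in m, the inner average is the sum over \<xi> of the products of the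
  spectral masses of \<open>dd f k\<close> at \<xi> and of \<open>dd f (r * k)\<close> at r\<xi>.
  For fixed k nonzero and \<xi>, the points (rk, r\<xi>) run along a line as r varies, so averaging
  over r first gives \<open>\<eta>\<^sup>2\<close>, and the remaining masses sum to at most 1. The
  direction k = 0 costs 1/p.\<close>

lemma mean_derivative_correlation:
  assumes f: "per p f" and f1: "\<And>x. cmod (f x) \<le> 1"
    and unif: "\<And>a b. cmod (M (\<lambda>s. f s * ph a b 0 s)) \<le> \<eta>"
  shows "M (\<lambda>r. M (\<lambda>k. M (\<lambda>m. (cmod (M (\<lambda>v. dd f (r * k) v * cnj (dd f k (r * v + m)))))\<^sup>2)))
    \<le> \<eta>\<^sup>2 + 1 / real p"
proof -
  define a where "a k \<xi> = (cmod (ft p (dd f k) \<xi>))\<^sup>2" for k \<xi>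
  have d1: "cmod (dd f h v) \<le> 1" for h v by (simp add: dd_def norm_mult mult_le_one f1)
  have a0: "a k \<xi> \<ge> 0" for k \<xi> by (simp add: a_def)
  have a1: "a k \<xi> \<le> 1" for k \<xi>
    unfolding a_def ft_def by (rule square_M_le_1) (simp add: norm_mult d1)
  have asum: "(\<Sum>\<xi>\<in>Z p. a k \<xi>) \<le> 1" for k
    unfolding a_def parseval[OF p_pos per_dd[OF f]] by (rule M_le) (simp add: d1 power_le_one)
  have inner: "M (\<lambda>m. (cmod (M (\<lambda>v. dd f (r * k) v * cnj (dd f k (r * v + m)))))\<^sup>2) = (\<Sum>\<xi>\<in>Z p. a k \<xi> * a (r * k) (\<xi> * r))" for r k
  proof -
    have "cnj (M (\<lambda>v. dd f (r * k) v * cnj (dd f k (r * v + m)))) =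
      (\<Sum>\<xi>\<in>Z p. (ft p (dd f k) \<xi> * cnj (ft p (dd f (r * k)) (\<xi> * r))) * ee p (\<xi> * m))" for m
    proof -
      have "cnj (M (\<lambda>v. dd f (r * k) v * cnj (dd f k (r * v + m)))) = M (\<lambda>v. \<Sum>\<xi>\<in>Z p.
          (ft p (dd f k) \<xi> * ee p (\<xi> * m)) * cnj (dd f (r * k) v * ee p (- (\<xi> * r * v))))"
        unfolding mean_cnj
        by (rule mean_cong, subst ft_inversion[OF p_pos per_dd[OF f, of k], of "_ + m"])
           (simp add: cnj_sum sum_distrib_left distrib_left ee_add ee_minus mult_ac)
      also have "\<dots> = (\<Sum>\<xi>\<in>Z p. (ft p (dd f k) \<xi> * ee p (\<xi> * m)) * cnj (ft p (dd f (r * k)) (\<xi> * r)))"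
        unfolding mean_sum mean_mult_left mean_cnj[symmetric] ft_def ..
      finally show ?thesis by (simp add: mult_ac)
    qed
    hence "cmod (M (\<lambda>v. dd f (r * k) v * cnj (dd f k (r * v + m)))) =
      cmod (\<Sum>\<xi>\<in>Z p. (ft p (dd f k) \<xi> * cnj (ft p (dd f (r * k)) (\<xi> * r))) * ee p (\<xi> * m))" for m
      by (metis complex_mod_cnj)
    thus ?thesis by (simp add: parseval_coeffs[OF p_pos] norm_mult power_mult_distrib a_def)
  qed
  have line: "M (\<lambda>r. a (r * k) (\<xi> * r)) \<le> \<eta>\<^sup>2 + (if k = 0 then 1 else 0)" if k: "k \<in> Z p" for k \<xi>
  proof (cases "k = 0")
    case True
    have "M (\<lambda>r. a (r * k) (\<xi> * r)) \<le> 1" by (rule M_le) (rule a1)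
    thus ?thesis using True by (simp add: add_increasing)
  next
    case False
    hence k': "\<not> int p dvd k" using k Z_nonzero by auto
    have "M (\<lambda>r. a (r * k) (\<xi> * r)) = M (\<lambda>r. a (k * r) (\<xi> * iv k * (k * r)))"
    proof (rule mean_cong)
      fix r
      have "[\<xi> * (iv k * k) * r = \<xi> * 1 * r] (mod int p)" by (intro cong_mult cong_refl iv' k')
      hence "ft p g (\<xi> * iv k * (k * r)) = ft p g (\<xi> * r)" for g
        by (intro perD[OF per_ft[OF p_pos]]) (simp add: mult_ac)
      thus "a (r * k) (\<xi> * r) = a (k * r) (\<xi> * iv k * (k * r))" by (simp add: a_def mult.commute)
    qed
    also have "\<dots> = M (\<lambda>h. a h (\<xi> * iv k * h))"
    proof (rule mean_Z_mult[OF p_pos, where f = "\<lambda>h. a h (\<xi> * iv k * h)"])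
      show "per p (\<lambda>h. a h (\<xi> * iv k * h))"
      proof (rule perI)
        fix x y assume xy: "[x = y] (mod int p)"
        have "ft p (dd f x) (\<xi> * iv k * x) = ft p (dd f y) (\<xi> * iv k * y)"
          unfolding dd_cong[OF f xy] by (rule perD[OF per_ft[OF p_pos]]) (intro cong_mult cong_refl xy)
        thus "a x (\<xi> * iv k * x) = a y (\<xi> * iv k * y)" by (simp add: a_def)
      qed
      show "coprime k (int p)" using k' by (simp add: coprime_iff)
    qed
    also have "\<dots> \<le> \<eta>\<^sup>2"
      unfolding a_def by (rule derivative_spectrum_on_line[OF f f1 unif])
    finally show ?thesis using False by simp
  qed
  have "M (\<lambda>r. M (\<lambda>k. \<Sum>\<xi>\<in>Z p. a k \<xi> * a (r * k) (\<xi> * r))) = M (\<lambda>k. \<Sum>\<xi>\<in>Z p. a k \<xi> * M (\<lambda>r. a (r * k) (\<xi> * r)))"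
    by (subst mean_swap) (simp only: mean_sum mean_mult_left)
  also have "\<dots> \<le> M (\<lambda>k. \<eta>\<^sup>2 + (if k = 0 then 1 else 0))"
  proof (rule mean_mono)
    fix k assume k: "k \<in> Z p"
    have "(\<Sum>\<xi>\<in>Z p. a k \<xi> * M (\<lambda>r. a (r * k) (\<xi> * r))) \<le> (\<Sum>\<xi>\<in>Z p. a k \<xi> * (\<eta>\<^sup>2 + (if k = 0 then 1 else 0)))"
      by (intro sum_mono mult_left_mono line a0 k)
    also have "\<dots> = (\<Sum>\<xi>\<in>Z p. a k \<xi>) * (\<eta>\<^sup>2 + (if k = 0 then 1 else 0))"
      by (simp add: sum_distrib_right)
    also have "\<dots> \<le> 1 * (\<eta>\<^sup>2 + (if k = 0 then 1 else 0))"
      by (intro mult_right_mono asum) auto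
    finally show "(\<Sum>\<xi>\<in>Z p. a k \<xi> * M (\<lambda>r. a (r * k) (\<xi> * r))) \<le> \<eta>\<^sup>2 + (if k = 0 then 1 else 0)" by simp
  qed
  also have "\<dots> \<le> M (\<lambda>k. \<eta>\<^sup>2) + 1 / real p"
    by (rule mean_indicator_le[OF p_pos]) auto
  also have "M (\<lambda>k. \<eta>\<^sup>2) = \<eta>\<^sup>2" by (rule mean_const) (use Zp_ne in auto)
  finally show ?thesis unfolding inner .
qed

text \<open>Cauchy-Schwarz removes \<open>f1\<close>, then \<open>f2\<close>. Suitable coordinates
  make the factors coming from \<open>g\<close> independent of x, so \<open>mean_Gowers_half\<close>
  removes them as well. What remains involves \<open>f\<close> alone and is, in further coordinates,
  the average of \<open>mean_derivative_correlation\<close>.\<close>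

lemma counting_sum_uniform:
  assumes f: "per p f" and g: "per p g"
    and b1: "\<And>x. cmod (f1 x) \<le> 1" and b2: "\<And>x. cmod (f2 x) \<le> 1"
    and bf: "\<And>x. cmod (f x) \<le> 1" and bg: "\<And>x. cmod (g x) \<le> 1"
    and unif: "\<And>a b. cmod (M (\<lambda>s. f s * ph a b 0 s)) \<le> \<eta>"
  shows "cmod (L f1 f2 f g) ^ 4 \<le> sqrt (\<eta>\<^sup>2 + 5 / real p) + 1 / real p"
proof -
  define G where "G x y = f (x + y) * g (x * y)" for x y
  \<comment> \<open>With x' = xl and y = u/x the products xy and x'y become u and lu. All of
    \<open>g\<close> then sits in \<open>w\<close>, which does not depend on x.\<close>
  define A where "A l x u = f (x + iv x * u) * cnj (f (x * l + iv x * u))" for l x u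
  define w where "w l u = g u * cnj (g (l * u))" for l u
  have bG: "cmod (G x y) \<le> 1" for x y by (simp add: G_def norm_mult mult_le_one bf bg)
  have bA: "cmod (A l x u) \<le> 1" for l x u by (simp add: A_def norm_mult mult_le_one bf)
  have bw: "cmod (w l u) \<le> 1" for l u by (simp add: w_def norm_mult mult_le_one bg)
  define B where "B x x' = (cmod (M (\<lambda>y. G x y * cnj (G x' y))))\<^sup>2" for x x'
  have B1: "B x x' \<le> 1" for x x'
    unfolding B_def by (rule square_M_le_1) (simp add: norm_mult mult_le_one bG)
  have L4: "cmod (L f1 f2 f g) ^ 4 \<le> M (\<lambda>x. M (\<lambda>x'. B x x'))"
  proof -
    have "L f1 f2 f g = M (\<lambda>x. f1 x * M (\<lambda>y. f2 y * G x y))"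
      unfolding L_def mean_mult_left[symmetric] G_def by (simp add: mult.assoc)
    hence "(cmod (L f1 f2 f g))\<^sup>2 \<le> M (\<lambda>x. (cmod (f1 x * M (\<lambda>y. f2 y * G x y)))\<^sup>2)"
      by (simp only: cmod_mean_square_le)
    also have "\<dots> \<le> M (\<lambda>x. (cmod (M (\<lambda>y. f2 y * G x y)))\<^sup>2)"
      by (intro mean_mono power_mono) (simp_all add: norm_mult mult_left_le_one_le b1)
    finally have le: "(cmod (L f1 f2 f g))\<^sup>2 \<le> M (\<lambda>x. (cmod (M (\<lambda>y. f2 y * G x y)))\<^sup>2)" .
    have "((cmod (L f1 f2 f g))\<^sup>2)\<^sup>2 \<le> (M (\<lambda>x. (cmod (M (\<lambda>y. f2 y * G x y)))\<^sup>2))\<^sup>2"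
      by (rule power_mono[OF le]) simp
    also have "\<dots> \<le> M (\<lambda>x. M (\<lambda>x'. (cmod (M (\<lambda>y. G x y * cnj (G x' y))))\<^sup>2))"
      by (rule mean_Gowers_half) (rule b2)
    finally show ?thesis by (simp add: B_def)
  qed
  have sub1: "M (\<lambda>x'. B x x') = M (\<lambda>l. (cmod (M (\<lambda>u. w l u * A l x u)))\<^sup>2)" if x: "\<not> int p dvd x" for x
  proof -
    have cop: "coprime x (int p)" "coprime (iv x) (int p)" using x iv_nonzero by (auto simp: coprime_iff)
    have "per p (\<lambda>x'. B x x')"
    proof (rule perI)
      fix a b assume ab: "[a = b] (mod int p)"
      have "G a y = G b y" for y
        unfolding G_def using perD[OF f cong_add[OF ab cong_refl]] perD[OF g cong_mult[OF ab cong_refl]] by simp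
      thus "B x a = B x b" by (simp add: B_def)
    qed
    hence "M (\<lambda>x'. B x x') = M (\<lambda>l. B x (x * l))" by (rule mean_Z_mult[OF p_pos _ cop(1), symmetric])
    also have "\<dots> = M (\<lambda>l. (cmod (M (\<lambda>u. w l u * A l x u)))\<^sup>2)"
    proof (rule mean_cong)
      fix l
      have "per p (\<lambda>y. G x y * cnj (G (x * l) y))"
      proof (rule perI)
        fix a b assume ab: "[a = b] (mod int p)"
        have "G x a = G x b" for x
          unfolding G_def using perD[OF f cong_add[OF cong_refl ab]] perD[OF g cong_mult[OF cong_refl ab]] by simp
        thus "G x a * cnj (G (x * l) a) = G x b * cnj (G (x * l) b)" by simp
      qed
      hence "M (\<lambda>y. G x y * cnj (G (x * l) y)) = M (\<lambda>u. G x (iv x * u) * cnj (G (x * l) (iv x * u)))"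
        by (rule mean_Z_mult[OF p_pos _ cop(2), symmetric])
      also have "\<dots> = M (\<lambda>u. w l u * A l x u)"
      proof (rule mean_cong)
        fix u
        have c: "[(x * iv x) * u = 1 * u] (mod int p)" "[(x * iv x) * (l * u) = 1 * (l * u)] (mod int p)"
          by (intro cong_mult iv[OF x] cong_refl)+
        have "g (x * (iv x * u)) = g u" "g (x * l * (iv x * u)) = g (l * u)"
          by (rule perD[OF g]; use c in \<open>simp add: mult_ac\<close>)+
        thus "G x (iv x * u) * cnj (G (x * l) (iv x * u)) = w l u * A l x u"
          by (simp add: G_def w_def A_def mult_ac)
      qed
      finally show "B x (x * l) = (cmod (M (\<lambda>u. w l u * A l x u)))\<^sup>2" by (simp add: B_def)
    qed
    finally show ?thesis .
  qed
  define s where "s l = M (\<lambda>x. (cmod (M (\<lambda>u. w l u * A l x u)))\<^sup>2)" for l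
  have "M (\<lambda>x. M (\<lambda>x'. B x x')) \<le> M (\<lambda>x. M (\<lambda>l. (cmod (M (\<lambda>u. w l u * A l x u)))\<^sup>2)) + 1 / real p"
  proof (rule mean_indicator_le[OF p_pos, of _ _ 0])
    fix x assume x: "x \<in> Z p"
    show "M (\<lambda>x'. B x x') \<le> M (\<lambda>l. (cmod (M (\<lambda>u. w l u * A l x u)))\<^sup>2) + (if x = 0 then 1 else 0)"
    proof (cases "x = 0")
      case True
      have "M (\<lambda>x'. B x x') \<le> 1" by (rule M_le) (rule B1)
      moreover have "0 \<le> M (\<lambda>l. (cmod (M (\<lambda>u. w l u * A l x u)))\<^sup>2)" by (rule mean_nonneg) simp
      ultimately show ?thesis using True by simp
    next
      case False
      thus ?thesis using sub1[of x] Z_nonzero x by simp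
    qed
  qed
  also have "M (\<lambda>x. M (\<lambda>l. (cmod (M (\<lambda>u. w l u * A l x u)))\<^sup>2)) = M s"
    unfolding s_def by (rule mean_swap)
  finally have Ls: "cmod (L f1 f2 f g) ^ 4 \<le> M s + 1 / real p" using L4 by simp
  define W where "W l x z = (cmod (M (\<lambda>u. A l x u * cnj (A l z u))))\<^sup>2" for l x z
  have W1: "W l x z \<le> 1" for l x z
    unfolding W_def by (rule square_M_le_1) (simp add: norm_mult mult_le_one bA)
  have s2: "(s l)\<^sup>2 \<le> M (\<lambda>x. M (\<lambda>z. W l x z))" for l
    unfolding s_def W_def by (rule mean_Gowers_half) (rule bw)
  define V where "V r k m = (cmod (M (\<lambda>v. dd f (r * k) v * cnj (dd f k (r * v + m)))))\<^sup>2" for r k m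
  have V1: "V r k m \<le> 1" and V0: "V r k m \<ge> 0" for r k m
    unfolding V_def by (rule square_M_le_1) (simp_all add: norm_mult mult_le_one dd_def bf)
  have perA1: "A l x u = A l x' u" if "[x = x'] (mod int p)" for l x x' u
    unfolding A_def
    by (intro arg_cong2[where f = "(*)"] arg_cong[where f = cnj] perD[OF f] cong_add cong_mult that cong_refl)
       (simp_all add: perD[OF per_iv that])
  have perA2: "A l x u = A l' x u'" if "[l = l'] (mod int p)" "[u = u'] (mod int p)" for l l' x u u'
    unfolding A_def
    by (intro arg_cong2[where f = "(*)"] arg_cong[where f = cnj] perD[OF f] cong_add cong_mult that cong_refl)
  have WL: "W l x z = W l' x z" if "[l = l'] (mod int p)" for l l' x z
    unfolding W_def by (simp only: perA2[OF that cong_refl])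
  have WX: "W l x z = W l x' z" if "[x = x'] (mod int p)" for l x x' z
    unfolding W_def by (simp only: perA1[OF that])
  \<comment> \<open>Put x = zr, l = 1 + k/z and u = zr(v - zr). The four arguments of f become v, v
    + rk, rv + m and rv + m + k with \<open>m = (1 - r\<^sup>2) * z\<close>.\<close>
  have sub2: "M (\<lambda>l. W l (z * r) z) = M (\<lambda>k. V r k ((1 - r\<^sup>2) * z))"
    if z: "\<not> int p dvd z" and r: "\<not> int p dvd r" for z r
  proof -
    have x: "\<not> int p dvd z * r" by (rule not_dvd_mult[OF z r])
    have "per p (\<lambda>l. W (1 + l) (z * r) z)"
      by (intro perI WL cong_add cong_refl)
    hence "M (\<lambda>l. W (1 + l) (z * r) z) = M (\<lambda>k. W (1 + iv z * k) (z * r) z)"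
      using mean_Z_mult[OF p_pos, of "\<lambda>l. W (1 + l) (z * r) z" "iv z"] iv_nonzero[OF z] by (simp add: coprime_iff)
    moreover have "per p (\<lambda>l. W l (z * r) z)"
      by (intro perI WL)
    hence "M (\<lambda>l. W (1 + l) (z * r) z) = M (\<lambda>l. W l (z * r) z)"
      using mean_Z_shift[OF p_pos, of "\<lambda>l. W l (z * r) z" 1] by (simp add: add.commute)
    moreover have "W (1 + iv z * k) (z * r) z = V r k ((1 - r\<^sup>2) * z)" for k
    proof -
      define l where "l = 1 + iv z * k"
      define H where "H u = A l (z * r) u * cnj (A l z u)" for u
      have perH: "per p H"
        unfolding H_def by (intro perI arg_cong2[where f = "(*)"] arg_cong[where f = cnj] perA2 cong_refl)
      hence "per p (\<lambda>v. H (z * r * v))" by (rule per_comp) (intro cong_mult cong_refl)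
      hence "M (\<lambda>v. H (z * r * (v + - (z * r)))) = M (\<lambda>v. H (z * r * v))"
        by (rule mean_Z_shift[OF p_pos])
      also have "\<dots> = M H" using x by (intro mean_Z_mult p_pos perH) (simp add: coprime_iff)
      finally have "M H = M (\<lambda>v. H (z * r * (v + - (z * r))))" ..
      also have "\<dots> = M (\<lambda>v. dd f (r * k) v * cnj (dd f k (r * v + (1 - r\<^sup>2) * z)))"
      proof (rule mean_cong)
        fix v
        define u where "u = z * r * (v + - (z * r))"
        have cx: "[iv (z * r) * u = v - z * r] (mod int p)"
          using cong_scalar_right[OF iv'[OF x], of "v - z * r"] by (simp add: u_def mult.assoc)
        have cz: "[iv z * u = r * (v - z * r)] (mod int p)"
          using cong_scalar_right[OF iv'[OF z], of "r * (v - z * r)"] by (simp add: u_def mult.assoc)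
        have kz: "[z * iv z * k = k] (mod int p)"
          using cong_scalar_right[OF iv[OF z], of k] by simp
        have e1: "f (z * r + iv (z * r) * u) = f v"
          using cong_add[OF cong_refl[of "z * r"] cx] by (intro perD[OF f]) simp
        have e2: "f (z * r * l + iv (z * r) * u) = f (v + r * k)"
        proof (rule perD[OF f])
          have "[z * r * l + iv (z * r) * u = z * r + r * (z * iv z * k) + iv (z * r) * u] (mod int p)"
            by (simp add: l_def algebra_simps)
          also have "[z * r + r * (z * iv z * k) + iv (z * r) * u = z * r + r * k + (v - z * r)] (mod int p)"
            by (intro cong_add cong_mult kz cx cong_refl)
          finally show "[z * r * l + iv (z * r) * u = v + r * k] (mod int p)" by (simp add: add.commute)
        qed
        have e3: "f (z + iv z * u) = f (r * v + (1 - r\<^sup>2) * z)"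
          using cong_add[OF cong_refl[of z] cz] by (intro perD[OF f]) (simp add: algebra_simps power2_eq_square)
        have e4: "f (z * l + iv z * u) = f (r * v + (1 - r\<^sup>2) * z + k)"
        proof (rule perD[OF f])
          have "[z * l + iv z * u = z + z * iv z * k + iv z * u] (mod int p)"
            by (simp add: l_def algebra_simps)
          also have "[z + z * iv z * k + iv z * u = z + k + r * (v - z * r)] (mod int p)"
            by (intro cong_add kz cz cong_refl)
          finally show "[z * l + iv z * u = r * v + (1 - r\<^sup>2) * z + k] (mod int p)"
            by (simp add: algebra_simps power2_eq_square)
        qed
        show "H (z * r * (v + - (z * r))) = dd f (r * k) v * cnj (dd f k (r * v + (1 - r\<^sup>2) * z))"
          unfolding H_def A_def u_def[symmetric] e1 e2 e3 e4 dd_def ..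
      qed
      finally have e: "M H = M (\<lambda>v. dd f (r * k) v * cnj (dd f k (r * v + (1 - r\<^sup>2) * z)))" .
      show ?thesis unfolding W_def V_def e[symmetric] H_def[abs_def] l_def ..
    qed
    ultimately show ?thesis by simp
  qed
  have Q1: "M (\<lambda>x. M (\<lambda>l. W l x z)) \<le> M (\<lambda>r. M (\<lambda>k. V r k ((1 - r\<^sup>2) * z))) + 1 / real p + (if z = 0 then 1 else 0)"
    if z: "z \<in> Z p" for z
  proof (cases "z = 0")
    case True
    have "M (\<lambda>x. M (\<lambda>l. W l x z)) \<le> 1" by (intro M_le W1)
    moreover have "0 \<le> M (\<lambda>r. M (\<lambda>k. V r k ((1 - r\<^sup>2) * z)))" by (intro mean_nonneg V0)
    ultimately show ?thesis using True by (simp add: add_increasing)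
  next
    case False
    hence z': "\<not> int p dvd z" using z Z_nonzero by simp
    have "per p (\<lambda>x. M (\<lambda>l. W l x z))"
      by (intro perI mean_cong WX)
    hence "M (\<lambda>x. M (\<lambda>l. W l x z)) = M (\<lambda>r. M (\<lambda>l. W l (z * r) z))"
      using mean_Z_mult[OF p_pos, of "\<lambda>x. M (\<lambda>l. W l x z)" z] z' by (simp add: coprime_iff)
    also have "\<dots> \<le> M (\<lambda>r. M (\<lambda>k. V r k ((1 - r\<^sup>2) * z))) + 1 / real p"
    proof (rule mean_indicator_le[OF p_pos, of _ _ 0])
      fix r assume r: "r \<in> Z p"
      show "M (\<lambda>l. W l (z * r) z) \<le> M (\<lambda>k. V r k ((1 - r\<^sup>2) * z)) + (if r = 0 then 1 else 0)"
      proof (cases "r = 0")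
        case True
        have "M (\<lambda>l. W l (z * r) z) \<le> 1" by (intro M_le W1)
        moreover have "0 \<le> M (\<lambda>k. V r k ((1 - r\<^sup>2) * z))" by (intro mean_nonneg V0)
        ultimately show ?thesis using True by simp
      next
        case False
        thus ?thesis using sub2[OF z'] Z_nonzero r by simp
      qed
    qed
    finally show ?thesis using False by simp
  qed
  have card2: "(\<Sum>r\<in>Z p. if [r\<^sup>2 = 1] (mod int p) then 1 else 0 :: real) \<le> 2"
    using square_fiber_card[of 1] by (simp add: sum.inter_filter[symmetric])
  have "M (\<lambda>l. M (\<lambda>x. M (\<lambda>z. W l x z))) = M (\<lambda>z. M (\<lambda>x. M (\<lambda>l. W l x z)))"
  proof -
    have "M (\<lambda>l. M (\<lambda>x. M (\<lambda>z. W l x z))) = M (\<lambda>l. M (\<lambda>z. M (\<lambda>x. W l x z)))"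
      by (intro mean_cong mean_swap)
    also have "\<dots> = M (\<lambda>z. M (\<lambda>l. M (\<lambda>x. W l x z)))" by (rule mean_swap)
    also have "\<dots> = M (\<lambda>z. M (\<lambda>x. M (\<lambda>l. W l x z)))" by (rule mean_cong, rule mean_swap)
    finally show ?thesis .
  qed
  also have "\<dots> \<le> M (\<lambda>z. M (\<lambda>r. M (\<lambda>k. V r k ((1 - r\<^sup>2) * z))) + 1 / real p) + 1 / real p"
    by (rule mean_indicator_le[OF p_pos]) (rule Q1)
  also have "\<dots> = M (\<lambda>r. M (\<lambda>z. M (\<lambda>k. V r k ((1 - r\<^sup>2) * z)))) + 2 / real p"
    unfolding mean_add using Zp_ne by (subst mean_swap) (simp add: mean_const)
  \<comment> \<open>Unless \<open>r\<^sup>2\<close> is 1, the shift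
    \<open>(1 - r\<^sup>2) * z\<close> is uniformly distributed as z varies; the at most two
    exceptional r are counted separately.\<close>
  also have "M (\<lambda>r. M (\<lambda>z. M (\<lambda>k. V r k ((1 - r\<^sup>2) * z))))
      \<le> M (\<lambda>r. M (\<lambda>k. M (\<lambda>m. V r k m)) + (if [r\<^sup>2 = 1] (mod int p) then 1 else 0))"
  proof (rule mean_mono)
    fix r
    show "M (\<lambda>z. M (\<lambda>k. V r k ((1 - r\<^sup>2) * z))) \<le> M (\<lambda>k. M (\<lambda>m. V r k m)) + (if [r\<^sup>2 = 1] (mod int p) then 1 else 0)"
    proof (cases "[r\<^sup>2 = 1] (mod int p)")
      case True
      have "M (\<lambda>z. M (\<lambda>k. V r k ((1 - r\<^sup>2) * z))) \<le> 1" by (intro M_le V1)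
      moreover have "0 \<le> M (\<lambda>k. M (\<lambda>m. V r k m))" by (intro mean_nonneg V0)
      ultimately show ?thesis using True by simp
    next
      case False
      have perV: "per p (V r k)" for k
        unfolding V_def
        by (intro perI arg_cong[where f = "\<lambda>z. (cmod z)\<^sup>2"] mean_cong arg_cong2[where f = "(*)"] arg_cong[where f = cnj]
            perD[OF per_dd[OF f]] refl cong_add cong_refl)
      have "coprime (1 - r\<^sup>2) (int p)"
        using False by (simp add: coprime_iff cong_iff_dvd_diff dvd_diff_commute)
      hence "M (\<lambda>z. V r k ((1 - r\<^sup>2) * z)) = M (V r k)" for k
        by (intro mean_Z_mult p_pos perV)
      hence "M (\<lambda>z. M (\<lambda>k. V r k ((1 - r\<^sup>2) * z))) = M (\<lambda>k. M (V r k))"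
        by (subst mean_swap) simp
      thus ?thesis using False by simp
    qed
  qed
  also have "\<dots> \<le> \<eta>\<^sup>2 + 1 / real p + 2 / real p"
  proof -
    have "M (\<lambda>r. if [r\<^sup>2 = 1] (mod int p) then 1 else 0 :: real) \<le> 2 / real p"
      using card2 p_pos by (simp add: mean_def divide_simps)
    moreover have "M (\<lambda>r. M (\<lambda>k. M (\<lambda>m. V r k m))) \<le> \<eta>\<^sup>2 + 1 / real p"
      unfolding V_def by (rule mean_derivative_correlation[OF f bf unif])
    ultimately show ?thesis unfolding mean_add by simp
  qed
  \<comment> \<open>The 5/p consists of 1/p for r = 0, 1/p for z = 0, 2/p for the square roots of 1,
    and 1/p from \<open>mean_derivative_correlation\<close>.\<close>
  finally have Q: "M (\<lambda>l. M (\<lambda>x. M (\<lambda>z. W l x z))) \<le> \<eta>\<^sup>2 + 5 / real p" by simp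
  have "(M s)\<^sup>2 \<le> M (\<lambda>l. (s l)\<^sup>2)" by (rule mean_square_le)
  also have "\<dots> \<le> M (\<lambda>l. M (\<lambda>x. M (\<lambda>z. W l x z)))" by (intro mean_mono s2)
  finally have "(M s)\<^sup>2 \<le> \<eta>\<^sup>2 + 5 / real p" using Q by simp
  hence "M s \<le> sqrt (\<eta>\<^sup>2 + 5 / real p)" by (rule real_le_rsqrt)
  thus ?thesis using Ls by simp
qed

end

section \<open>Kernels with non-negative Fourier coefficients\<close>

text \<open>A trigonometric polynomial with H 0 = 1 and at most C frequencies. Non-negative
  coefficients make it positive definite, non-negative values make it usable as a weight. Its mean
  is \<open>a 0\<close>, so \<open>a \<xi> / a 0\<close> is the multiplier of the kernel after
  normalisation to mean 1.\<close>

definition kern :: "nat \<Rightarrow> nat \<Rightarrow> (int \<Rightarrow> real) \<Rightarrow> (int \<Rightarrow> real) \<Rightarrow> bool" where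
  "kern N C a H \<longleftrightarrow> N > 0 \<and> (\<forall>\<xi>. 0 \<le> a \<xi>) \<and> per N a \<and> (\<forall>\<xi>. a (- \<xi>) = a \<xi>) \<and>
     (\<Sum>\<xi>\<in>Z N. a \<xi>) = 1 \<and> card {\<xi> \<in> Z N. a \<xi> \<noteq> 0} \<le> C \<and> (\<forall>v. 0 \<le> H v) \<and>
     (\<forall>v. complex_of_real (H v) = (\<Sum>\<xi>\<in>Z N. complex_of_real (a \<xi>) * ee N (\<xi> * v)))"

lemma kernD:
  assumes "kern N C a H"
  shows "N > 0" "0 \<le> a \<xi>" "per N a" "a (- \<xi>) = a \<xi>" "(\<Sum>\<xi>\<in>Z N. a \<xi>) = 1"
    "card {\<xi> \<in> Z N. a \<xi> \<noteq> 0} \<le> C" "0 \<le> H v"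
    "complex_of_real (H v) = (\<Sum>\<xi>\<in>Z N. complex_of_real (a \<xi>) * ee N (\<xi> * v))"
  using assms unfolding kern_def by blast+

lemma Z_cong_iff: "\<xi> \<in> Z N \<Longrightarrow> [y = \<xi>] (mod int N) \<longleftrightarrow> \<xi> = y mod int N"
  unfolding Cong.cong_def by auto

lemma kern_weaken: "kern N C a H \<Longrightarrow> C \<le> C' \<Longrightarrow> kern N C' a H"
  unfolding kern_def by (meson order.trans)

text \<open>The frequencies \<open>x j\<close> may coincide modulo N, so their coefficients are
  collected in \<open>a\<close>. Evenness of \<open>a\<close> comes from H being real.\<close>

lemma kern_of_rep:
  assumes N: "N > 0" and J: "finite J" "card J \<le> C" and c: "\<And>j. j \<in> J \<Longrightarrow> 0 \<le> c j" "(\<Sum>j\<in>J. c j) = 1"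
    and H: "\<And>v. 0 \<le> H v" "\<And>v. complex_of_real (H v) = (\<Sum>j\<in>J. complex_of_real (c j) * ee N (x j * v))"
  shows "\<exists>a. kern N C a H"
proof -
  define a where "a \<xi> = (\<Sum>j\<in>J. if [x j = \<xi>] (mod int N) then c j else 0)" for \<xi>
  have a: "complex_of_real (a \<xi>) = mean (Z N) (\<lambda>v. complex_of_real (H v) * ee N (- \<xi> * v))" for \<xi>
  proof -
    have "mean (Z N) (\<lambda>v. complex_of_real (H v) * ee N (- \<xi> * v)) =
       mean (Z N) (\<lambda>v. \<Sum>j\<in>J. complex_of_real (c j) * ee N ((x j - \<xi>) * v))"
      unfolding H(2) sum_distrib_right by (simp add: mult.assoc ee_add[symmetric] left_diff_distrib)
    also have "\<dots> = (\<Sum>j\<in>J. complex_of_real (c j) * (if int N dvd x j - \<xi> then 1 else 0))"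
      unfolding mean_sum mean_mult_left mean_ee[OF N] ..
    also have "\<dots> = complex_of_real (a \<xi>)"
      unfolding a_def of_real_sum by (intro sum.cong refl) (simp add: cong_iff_dvd_diff)
    finally show ?thesis ..
  qed
  have "per N a" unfolding a_def
    by (intro perI sum.cong refl if_cong) (metis cong_sym cong_trans)
  moreover have "a (- \<xi>) = a \<xi>" for \<xi>
  proof -
    have "complex_of_real (a (- \<xi>)) = cnj (complex_of_real (a \<xi>))"
      unfolding a mean_cnj by (simp add: ee_minus[symmetric])
    thus ?thesis by simp
  qed
  moreover have "(\<Sum>\<xi>\<in>Z N. a \<xi>) = 1"
  proof -
    have "(\<Sum>\<xi>\<in>Z N. a \<xi>) = (\<Sum>j\<in>J. \<Sum>\<xi>\<in>Z N. if \<xi> = x j mod int N then c j else 0)"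
      unfolding a_def by (subst sum.swap) (intro sum.cong refl, simp only: Z_cong_iff)
    also have "\<dots> = (\<Sum>j\<in>J. c j)" using N by (intro sum.cong refl) simp
    finally show ?thesis using c by simp
  qed
  moreover have "card {\<xi> \<in> Z N. a \<xi> \<noteq> 0} \<le> C"
  proof -
    have "{\<xi> \<in> Z N. a \<xi> \<noteq> 0} \<subseteq> (\<lambda>j. x j mod int N) ` J"
    proof
      fix \<xi> assume "\<xi> \<in> {\<xi> \<in> Z N. a \<xi> \<noteq> 0}"
      hence \<xi>: "\<xi> \<in> Z N" "a \<xi> \<noteq> 0" by auto
      obtain j where j: "j \<in> J" "[x j = \<xi>] (mod int N)"
      proof (rule ccontr)
        assume "\<not> thesis"
        hence "\<forall>j\<in>J. \<not> [x j = \<xi>] (mod int N)" using that by blast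
        hence "a \<xi> = 0" unfolding a_def by (intro sum.neutral) simp
        thus False using \<xi> by simp
      qed
      thus "\<xi> \<in> (\<lambda>j. x j mod int N) ` J" using Z_cong_iff[OF \<xi>(1)] by blast
    qed
    hence "card {\<xi> \<in> Z N. a \<xi> \<noteq> 0} \<le> card ((\<lambda>j. x j mod int N) ` J)" using J by (intro card_mono) auto
    also have "\<dots> \<le> card J" using J by (intro card_image_le)
    finally show ?thesis using J by simp
  qed
  moreover have "complex_of_real (H v) = (\<Sum>\<xi>\<in>Z N. complex_of_real (a \<xi>) * ee N (\<xi> * v))" for v
  proof -
    have "(\<Sum>\<xi>\<in>Z N. complex_of_real (a \<xi>) * ee N (\<xi> * v)) =
      (\<Sum>\<xi>\<in>Z N. \<Sum>j\<in>J. if \<xi> = x j mod int N then complex_of_real (c j) * ee N (x j * v) else 0)"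
      unfolding a_def of_real_sum sum_distrib_right
    proof (intro sum.cong refl)
      fix \<xi> j assume \<xi>: "\<xi> \<in> Z N"
      note iff = Z_cong_iff[OF \<xi>, of "x j"]
      have "ee N (\<xi> * v) = ee N (x j * v)" if "[x j = \<xi>] (mod int N)"
        using that by (intro ee_cong N cong_mult cong_refl) (rule cong_sym)
      thus "complex_of_real (if [x j = \<xi>] (mod int N) then c j else 0) * ee N (\<xi> * v) =
        (if \<xi> = x j mod int N then complex_of_real (c j) * ee N (x j * v) else 0)"
        unfolding iff by auto
    qed
    also have "\<dots> = (\<Sum>j\<in>J. \<Sum>\<xi>\<in>Z N. if \<xi> = x j mod int N then complex_of_real (c j) * ee N (x j * v) else 0)"
      by (rule sum.swap)
    also have "\<dots> = (\<Sum>j\<in>J. complex_of_real (c j) * ee N (x j * v))" using N by (intro sum.cong refl) simp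
    finally show ?thesis using H by simp
  qed
  ultimately have "kern N C a H"
    unfolding kern_def using N H(1) c by (auto simp: a_def intro!: sum_nonneg)
  thus ?thesis by blast
qed

lemma kern_one: "N > 0 \<Longrightarrow> \<exists>a. kern N 1 a (\<lambda>_. 1)"
  by (rule kern_of_rep[where J = "{()}" and c = "\<lambda>_. 1" and x = "\<lambda>_. 0"]) auto

text \<open>Multiplying kernels convolves their coefficients, which preserves positivity and
  multiplies the numbers of frequencies.\<close>

lemma kern_mult:
  assumes "kern N C a H" "kern N C' a' H'"
  shows "\<exists>b. kern N (C * C') b (\<lambda>v. H v * H' v)"
proof -
  note k = kernD[OF assms(1)] and k' = kernD[OF assms(2)]
  let ?S = "{\<xi> \<in> Z N. a \<xi> \<noteq> 0}" and ?S' = "{\<xi> \<in> Z N. a' \<xi> \<noteq> 0}"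
  have r: "(\<Sum>\<xi>\<in>?S. g (a \<xi>) * h \<xi>) = (\<Sum>\<xi>\<in>Z N. g (a \<xi>) * h \<xi>)" if "g 0 = 0" for g :: "real \<Rightarrow> 'z::comm_ring_1" and h
    by (rule sum.mono_neutral_left) (auto simp: that)
  have r': "(\<Sum>\<xi>\<in>?S'. g (a' \<xi>) * h \<xi>) = (\<Sum>\<xi>\<in>Z N. g (a' \<xi>) * h \<xi>)" if "g 0 = 0" for g :: "real \<Rightarrow> 'z::comm_ring_1" and h
    by (rule sum.mono_neutral_left) (auto simp: that)
  show ?thesis
  proof (rule kern_of_rep[where J = "?S \<times> ?S'" and c = "\<lambda>(\<xi>, \<zeta>). a \<xi> * a' \<zeta>" and x = "\<lambda>(\<xi>, \<zeta>). \<xi> + \<zeta>"])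
    show "finite (?S \<times> ?S')"
      by (intro finite_SigmaI) (auto intro: finite_subset[of _ "Z N"])
    show "card (?S \<times> ?S') \<le> C * C'"
      unfolding card_cartesian_product by (rule mult_le_mono[OF k(6) k'(6)])
    have "(\<Sum>j\<in>?S \<times> ?S'. case j of (\<xi>, \<zeta>) \<Rightarrow> a \<xi> * a' \<zeta>) = (\<Sum>\<xi>\<in>?S. a \<xi> * 1) * (\<Sum>\<zeta>\<in>?S'. a' \<zeta> * 1)"
      by (simp add: sum_product sum.cartesian_product)
    also have "\<dots> = 1" using r[of id "\<lambda>_. 1"] r'[of id "\<lambda>_. 1"] k(5) k'(5) by simp
    finally show "(\<Sum>j\<in>?S \<times> ?S'. case j of (\<xi>, \<zeta>) \<Rightarrow> a \<xi> * a' \<zeta>) = 1" .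
    fix v
    have "complex_of_real (H v * H' v) = (\<Sum>\<xi>\<in>?S. complex_of_real (a \<xi>) * ee N (\<xi> * v)) * (\<Sum>\<zeta>\<in>?S'. complex_of_real (a' \<zeta>) * ee N (\<zeta> * v))"
      unfolding of_real_mult k(8) k'(8)
      by (simp only: r[of complex_of_real "\<lambda>\<xi>. ee N (\<xi> * v)"] r'[of complex_of_real "\<lambda>\<xi>. ee N (\<xi> * v)"] of_real_0)
    also have "\<dots> = (\<Sum>j\<in>?S \<times> ?S'. complex_of_real (case j of (\<xi>, \<zeta>) \<Rightarrow> a \<xi> * a' \<zeta>) * ee N ((case j of (\<xi>, \<zeta>) \<Rightarrow> \<xi> + \<zeta>) * v))"
      unfolding sum_product sum.cartesian_product by (intro sum.cong refl) (auto simp: distrib_right ee_add)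
    finally show "complex_of_real (H v * H' v) = \<dots>" .
  qed (use k(1,2,7) k'(2,7) in auto)
qed

text \<open>On the unit circle (1 + Re z)/2 equals \<open>(z + 1)\<^sup>2 * cnj z / 4\<close>. Its
  m-th power has the coefficients (2m choose j) / 4^m, which are non-negative and sum to 1.\<close>

lemma kern_cos_power:
  assumes N: "N > 0"
  shows "\<exists>a. kern N (2 * m + 1) a (\<lambda>v. ((1 + Re (ee N (\<theta> * v))) / 2) ^ m)"
proof (rule kern_of_rep[where J = "{..2 * m}" and c = "\<lambda>j. real ((2 * m) choose j) / 4 ^ m" and x = "\<lambda>j. (int j - int m) * \<theta>"])
  have "(\<Sum>j\<le>2 * m. real ((2 * m) choose j) / 4 ^ m) = real (\<Sum>j\<le>2 * m. (2 * m) choose j) / 4 ^ m"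
    by (simp add: sum_divide_distrib)
  also have "\<dots> = 1" by (simp add: choose_row_sum power_mult)
  finally show "(\<Sum>j\<le>2 * m. real ((2 * m) choose j) / 4 ^ m) = 1" .
  fix v
  have "- 1 \<le> Re (ee N (\<theta> * v))" using abs_Re_le_cmod[of "ee N (\<theta> * v)"] by simp
  thus "0 \<le> ((1 + Re (ee N (\<theta> * v))) / 2) ^ m" by simp
  define z where "z = ee N (\<theta> * v)"
  have zc: "z * cnj z = 1" by (simp add: z_def)
  have e: "ee N ((int j - int m) * \<theta> * v) = z ^ j * cnj z ^ m" for j
  proof -
    have "ee N ((int j - int m) * \<theta> * v) = ee N (int j * (\<theta> * v) - int m * (\<theta> * v))" by (simp add: algebra_simps)
    thus ?thesis by (simp only: ee_diff ee_power z_def complex_cnj_power)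
  qed
  have "complex_of_real (((1 + Re z) / 2) ^ m) = (((z + 1)\<^sup>2 * cnj z) / 4) ^ m"
  proof -
    have "(z + 1)\<^sup>2 * cnj z = z * (z * cnj z) + 2 * (z * cnj z) + cnj z" by (simp add: power2_eq_square algebra_simps)
    also have "\<dots> = z + cnj z + 2" unfolding zc by simp
    also have "\<dots> = complex_of_real (2 * Re z) + 2" by (simp only: complex_add_cnj)
    finally have "((z + 1)\<^sup>2 * cnj z) / 4 = complex_of_real ((1 + Re z) / 2)" by simp
    thus ?thesis by (simp only: of_real_power)
  qed
  also have "\<dots> = (z + 1) ^ (2 * m) * cnj z ^ m / 4 ^ m" by (simp add: power_divide power_mult_distrib power_mult)
  also have "\<dots> = (\<Sum>j\<le>2 * m. complex_of_real (real ((2 * m) choose j) / 4 ^ m) * (z ^ j * cnj z ^ m))"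
    unfolding binomial_ring sum_distrib_right sum_divide_distrib by (intro sum.cong refl) simp
  finally show "complex_of_real (((1 + Re (ee N (\<theta> * v))) / 2) ^ m) =
     (\<Sum>j\<le>2 * m. complex_of_real (real ((2 * m) choose j) / 4 ^ m) * ee N ((int j - int m) * \<theta> * v))"
    unfolding e z_def[symmetric] .
qed (use N in auto)

text \<open>The character occurs without conjugation because \<open>a\<close> is even.\<close>

lemma kern_coeff:
  assumes "kern N C a H"
  shows "mean (Z N) (\<lambda>v. complex_of_real (H v) * ee N (\<theta> * v)) = complex_of_real (a \<theta>)"
proof -
  note k = kernD[OF assms]
  have "mean (Z N) (\<lambda>v. complex_of_real (H v) * ee N (\<theta> * v)) =
     mean (Z N) (\<lambda>v. \<Sum>\<xi>\<in>Z N. complex_of_real (a \<xi>) * ee N ((\<xi> + \<theta>) * v))"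
    unfolding k(8) sum_distrib_right by (simp add: mult.assoc ee_add distrib_right)
  also have "\<dots> = (\<Sum>\<xi>\<in>Z N. complex_of_real (a \<xi>) * (if int N dvd \<xi> + \<theta> then 1 else 0))"
    unfolding mean_sum mean_mult_left mean_ee[OF k(1)] ..
  also have "\<dots> = (\<Sum>\<xi>\<in>Z N. if \<xi> = (- \<theta>) mod int N then complex_of_real (a \<theta>) else 0)"
  proof (intro sum.cong refl)
    fix \<xi> assume \<xi>: "\<xi> \<in> Z N"
    have "int N dvd \<xi> + \<theta> \<longleftrightarrow> [\<xi> = - \<theta>] (mod int N)" by (simp add: cong_iff_dvd_diff)
    also have "\<dots> \<longleftrightarrow> \<xi> = (- \<theta>) mod int N" using Z_cong_iff[OF \<xi>, of "- \<theta>"] by (simp add: cong_sym_eq)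
    finally have iff: "int N dvd \<xi> + \<theta> \<longleftrightarrow> \<xi> = (- \<theta>) mod int N" .
    have "a ((- \<theta>) mod int N) = a (- \<theta>)" by (rule perD[OF k(3)]) (simp add: Cong.cong_def)
    thus "complex_of_real (a \<xi>) * (if int N dvd \<xi> + \<theta> then 1 else 0) =
      (if \<xi> = (- \<theta>) mod int N then complex_of_real (a \<theta>) else 0)"
      unfolding iff using k(4) by auto
  qed
  also have "\<dots> = complex_of_real (a \<theta>)" using k(1) by simp
  finally show ?thesis .
qed

lemma kern_mean: "kern N C a H \<Longrightarrow> mean (Z N) H = a 0"
  using kern_coeff[of N C a H 0] by (simp add: mean_of_real)

lemma kern_coeff_Re: "kern N C a H \<Longrightarrow> mean (Z N) (\<lambda>v. H v * Re (ee N (\<theta> * v))) = a \<theta>"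
  using arg_cong[OF kern_coeff[of N C a H \<theta>], of Re] by (simp add: mean_Re)

lemma kern_le_1: assumes "kern N C a H" shows "H v \<le> 1"
proof -
  note k = kernD[OF assms]
  have "H v \<le> cmod (complex_of_real (H v))" by simp
  also have "\<dots> \<le> (\<Sum>\<xi>\<in>Z N. cmod (complex_of_real (a \<xi>) * ee N (\<xi> * v)))"
    unfolding k(8) by (rule norm_sum)
  also have "\<dots> = 1" using k(2,5) by (simp add: norm_mult)
  finally show ?thesis .
qed

lemma kern_per: assumes "kern N C a H" shows "per N H"
proof (rule perI)
  fix x y assume xy: "[x = y] (mod int N)"
  have "complex_of_real (H x) = complex_of_real (H y)"
    unfolding kernD(8)[OF assms]
    by (intro sum.cong refl arg_cong2[where f = "(*)"] ee_cong[OF kernD(1)[OF assms]] cong_mult cong_refl xy)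
  thus "H x = H y" by simp
qed

lemma kern_coeff_le: assumes "kern N C a H" shows "a \<xi> \<le> a 0"
proof -
  have "a \<xi> \<le> mean (Z N) H"
    unfolding kern_coeff_Re[OF assms, of \<xi>, symmetric]
  proof (rule mean_mono)
    fix v
    have "Re (ee N (\<xi> * v)) \<le> 1" using complex_Re_le_cmod[of "ee N (\<xi> * v)"] by simp
    thus "H v * Re (ee N (\<xi> * v)) \<le> H v" using kernD(7)[OF assms, of v] by (simp add: mult_left_le)
  qed
  thus ?thesis by (simp add: kern_mean[OF assms])
qed

text \<open>The coefficients sum to 1, at most C of them are nonzero, and \<open>a 0\<close> is the
  largest. Hence normalising a kernel to mean 1 costs at most a factor C.\<close>

lemma kern_mean_ge: assumes "kern N C a H" shows "1 \<le> real C * a 0"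
proof -
  note k = kernD[OF assms]
  have "1 = (\<Sum>\<xi>\<in>{\<xi> \<in> Z N. a \<xi> \<noteq> 0}. a \<xi>)"
    unfolding k(5)[symmetric] by (rule sum.mono_neutral_right) auto
  also have "\<dots> \<le> real (card {\<xi> \<in> Z N. a \<xi> \<noteq> 0}) * a 0"
    by (rule sum_bounded_above) (rule kern_coeff_le[OF assms])
  also have "\<dots> \<le> real C * a 0" using k(2,6) by (intro mult_right_mono) auto
  finally show ?thesis .
qed

lemma kern_pos: "kern N C a H \<Longrightarrow> a 0 > 0"
  using kern_mean_ge[of N C a H] kernD(2)[of N C a H 0] by (cases "a 0 = 0") auto

text \<open>On the unit circle the square of |1 - z| is 2 - 2 Re z, so its mean against H is 2(a 0 -
  a \<theta>). Cauchy-Schwarz with weight H passes to the first power.\<close>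

lemma kern_close:
  assumes k: "kern N C a H" and c: "(1 - \<epsilon>) * a 0 \<le> a \<theta>"
  shows "mean (Z N) (\<lambda>v. H v * cmod (1 - ee N (\<theta> * v))) \<le> sqrt (2 * \<epsilon>) * a 0"
proof -
  have H0: "H v \<ge> 0" for v by (rule kernD(7)[OF k])
  have sq: "(cmod (1 - ee N (\<theta> * v)))\<^sup>2 = 2 - 2 * Re (ee N (\<theta> * v))" for v
  proof -
    have "(Re (ee N (\<theta> * v)))\<^sup>2 + (Im (ee N (\<theta> * v)))\<^sup>2 = 1"
      using cmod_power2[of "ee N (\<theta> * v)"] by simp
    thus ?thesis unfolding cmod_power2 by (simp add: power2_eq_square algebra_simps)
  qed
  have "mean (Z N) (\<lambda>v. H v * (cmod (1 - ee N (\<theta> * v)))\<^sup>2) = mean (Z N) (\<lambda>v. 2 * H v - 2 * (H v * Re (ee N (\<theta> * v))))"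
    unfolding sq by (simp add: algebra_simps)
  also have "\<dots> = 2 * a 0 - 2 * a \<theta>"
    by (simp only: mean_diff mean_mult_left kern_mean[OF k] kern_coeff_Re[OF k])
  also have "\<dots> \<le> 2 * \<epsilon> * a 0" using c by (simp add: algebra_simps)
  finally have m2: "mean (Z N) (\<lambda>v. H v * (cmod (1 - ee N (\<theta> * v)))\<^sup>2) \<le> 2 * \<epsilon> * a 0" .
  have CS: "(\<Sum>v\<in>Z N. H v * cmod (1 - ee N (\<theta> * v)))\<^sup>2 \<le> (\<Sum>v\<in>Z N. H v) * (\<Sum>v\<in>Z N. H v * (cmod (1 - ee N (\<theta> * v)))\<^sup>2)"
  proof -
    have "(\<Sum>v\<in>Z N. sqrt (H v) * (sqrt (H v) * cmod (1 - ee N (\<theta> * v))))\<^sup>2 \<le>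
      (\<Sum>v\<in>Z N. (sqrt (H v))\<^sup>2) * (\<Sum>v\<in>Z N. (sqrt (H v) * cmod (1 - ee N (\<theta> * v)))\<^sup>2)"
      by (rule Cauchy_Schwarz_ineq_sum)
    thus ?thesis using H0 by (simp add: power_mult_distrib mult.assoc[symmetric])
  qed
  have "(mean (Z N) (\<lambda>v. H v * cmod (1 - ee N (\<theta> * v))))\<^sup>2 \<le>
      mean (Z N) H * mean (Z N) (\<lambda>v. H v * (cmod (1 - ee N (\<theta> * v)))\<^sup>2)"
    using CS kernD(1)[OF k] by (simp add: mean_def power_mult_distrib power2_eq_square divide_simps)
  also have "\<dots> \<le> a 0 * (2 * \<epsilon> * a 0)"
    unfolding kern_mean[OF k] using kernD(2)[OF k] by (intro mult_left_mono m2)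
  also have "\<dots> = 2 * \<epsilon> * (a 0)\<^sup>2" by (simp add: power2_eq_square)
  finally have "mean (Z N) (\<lambda>v. H v * cmod (1 - ee N (\<theta> * v))) \<le> sqrt (2 * \<epsilon> * (a 0)\<^sup>2)"
    by (rule real_le_rsqrt)
  thus ?thesis using kernD(2)[OF k] by (simp add: real_sqrt_mult)
qed

lemma exists_cos_exponent:
  fixes r e :: real
  assumes "0 \<le> r" "r < 1" "e > 0"
  shows "\<exists>m. real (2 * m + 1) ^ d * r ^ m \<le> e"
proof (cases "r = 0")
  case True
  thus ?thesis using assms by (intro exI[of _ 1]) (simp add: less_imp_le)
next
  case False
  hence r: "0 < r" using assms by simp
  have "(\<lambda>m. (2 * real m + 1) ^ d * r ^ m) \<longlonglongrightarrow> 0"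
    using r assms(2) by real_asymp
  hence "eventually (\<lambda>m. (2 * real m + 1) ^ d * r ^ m < e) sequentially"
    using assms(3) by (rule order_tendstoD)
  then obtain m where "(2 * real m + 1) ^ d * r ^ m < e" by (auto simp: eventually_sequentially)
  thus ?thesis by (intro exI[of _ m]) (simp add: less_imp_le add.commute)
qed

text \<open>A high power of \<open>\<Prod>\<theta>\<in>\<Theta>. (1 + cos (2\<pi>\<theta>v/N)) / 2\<close> concentrates where all characters in
  \<open>\<Theta>\<close> are close to 1.\<close>

lemma exists_kernel:
  fixes \<epsilon> :: real
  assumes "\<epsilon> > 0"
  shows "\<exists>C. \<forall>N \<Theta>. N > 0 \<longrightarrow> finite \<Theta> \<longrightarrow> card \<Theta> \<le> d \<longrightarrow>
     (\<exists>a H. kern N C a H \<and> (\<forall>\<theta>\<in>\<Theta>. (1 - \<epsilon>) * a 0 \<le> a \<theta>))"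
proof -
  define e where "e = min (\<epsilon> / 2) 1"
  have e: "0 < e" "e \<le> 1" "2 * e \<le> \<epsilon>" using assms by (auto simp: e_def)
  obtain m where m: "real (2 * m + 1) ^ d * (1 - e / 2) ^ m \<le> e / 2"
    using exists_cos_exponent[of "1 - e / 2" "e / 2" d] e by auto
  define C where "C = (2 * m + 1) ^ d"
  show ?thesis
  proof (intro exI[of _ C] allI impI)
    fix N :: nat and \<Theta> :: "int set"
    assume N: "N > 0" and fin: "finite \<Theta>" and card: "card \<Theta> \<le> d"
    define f where "f \<theta> v = (1 + Re (ee N (\<theta> * v))) / 2" for \<theta> v
    have f01: "0 \<le> f \<theta> v" "f \<theta> v \<le> 1" for \<theta> v
      using abs_Re_le_cmod[of "ee N (\<theta> * v)"] by (auto simp: f_def)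
    have "\<exists>a. kern N ((2 * m + 1) ^ card \<Theta>) a (\<lambda>v. \<Prod>\<theta>\<in>\<Theta>. f \<theta> v ^ m)"
      using fin
    proof (induction \<Theta> rule: finite_induct)
      case empty
      show ?case using kern_one[OF N] by simp
    next
      case (insert \<theta> \<Theta>)
      obtain a where "kern N ((2 * m + 1) ^ card \<Theta>) a (\<lambda>v. \<Prod>\<theta>\<in>\<Theta>. f \<theta> v ^ m)" using insert by blast
      moreover obtain b where "kern N (2 * m + 1) b (\<lambda>v. f \<theta> v ^ m)"
        using kern_cos_power[OF N] unfolding f_def by blast
      ultimately show ?case using kern_mult[of N "2 * m + 1" b "\<lambda>v. f \<theta> v ^ m" "(2 * m + 1) ^ card \<Theta>" a "\<lambda>v. \<Prod>\<theta>\<in>\<Theta>. f \<theta> v ^ m"] insert.hyps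
        by simp
    qed
    then obtain a where k0: "kern N ((2 * m + 1) ^ card \<Theta>) a (\<lambda>v. \<Prod>\<theta>\<in>\<Theta>. f \<theta> v ^ m)" by blast
    define H where "H v = (\<Prod>\<theta>\<in>\<Theta>. f \<theta> v ^ m)" for v
    have "(2 * m + 1) ^ card \<Theta> \<le> C" unfolding C_def using card by (intro power_increasing) auto
    hence k: "kern N C a H" using kern_weaken[OF k0] unfolding H_def[abs_def] by blast
    have "(1 - \<epsilon>) * a 0 \<le> a \<theta>" if \<theta>: "\<theta> \<in> \<Theta>" for \<theta>
    proof -
      have "a 0 - a \<theta> = mean (Z N) (\<lambda>v. H v * (1 - Re (ee N (\<theta> * v))))"
        unfolding right_diff_distrib mean_diff kern_coeff_Re[OF k] by (simp add: kern_mean[OF k])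
      \<comment> \<open>Where the character \<theta> is within e of 1 in real part, the defect is at
        most e. Elsewhere the single factor belonging to \<theta> already makes H tiny.\<close>
      also have "\<dots> \<le> mean (Z N) (\<lambda>v. e * H v + 2 * (1 - e / 2) ^ m)"
      proof (rule mean_mono)
        fix v
        have H0: "0 \<le> H v" by (rule kernD(7)[OF k])
        show "H v * (1 - Re (ee N (\<theta> * v))) \<le> e * H v + 2 * (1 - e / 2) ^ m"
        proof (cases "1 - Re (ee N (\<theta> * v)) \<le> e")
          case True
          hence "H v * (1 - Re (ee N (\<theta> * v))) \<le> H v * e" using H0 by (intro mult_left_mono)
          moreover have "0 \<le> (1 - e / 2) ^ m" using e by simp
          ultimately show ?thesis by (simp add: mult.commute)
        next
          case False
          have "H v = f \<theta> v ^ m * (\<Prod>\<theta>\<in>\<Theta> - {\<theta>}. f \<theta> v ^ m)"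
            unfolding H_def using fin \<theta> by (rule prod.remove)
          also have "\<dots> \<le> f \<theta> v ^ m * 1"
            using f01 by (intro mult_left_mono prod_le_1) (auto simp: power_le_one)
          also have "\<dots> \<le> (1 - e / 2) ^ m"
            using False f01 by (auto simp: f_def intro!: power_mono)
          finally have "H v \<le> (1 - e / 2) ^ m" .
          moreover have "1 - Re (ee N (\<theta> * v)) \<le> 2"
            using abs_Re_le_cmod[of "ee N (\<theta> * v)"] by auto
          ultimately have "H v * (1 - Re (ee N (\<theta> * v))) \<le> (1 - e / 2) ^ m * 2"
            using False e H0 by (intro mult_mono) auto
          thus ?thesis using H0 e by (simp add: mult.commute add_increasing)
        qed
      qed
      also have "\<dots> = e * a 0 + 2 * (1 - e / 2) ^ m"
        using N by (simp add: mean_add mean_mult_left kern_mean[OF k] mean_const)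
      \<comment> \<open>The tail is exponentially small in m, whereas \<open>a 0\<close> is at least
        1/C with C polynomial in m.\<close>
      also have "2 * (1 - e / 2) ^ m \<le> e * a 0"
      proof -
        have "2 * (1 - e / 2) ^ m = 2 * (1 - e / 2) ^ m * 1" by simp
        also have "\<dots> \<le> 2 * (1 - e / 2) ^ m * (real C * a 0)"
          using e by (intro mult_left_mono kern_mean_ge[OF k]) simp
        also have "\<dots> = 2 * (real (2 * m + 1) ^ d * (1 - e / 2) ^ m) * a 0" by (simp add: C_def)
        also have "\<dots> \<le> 2 * (e / 2) * a 0" using kernD(2)[OF k] m by (intro mult_right_mono mult_left_mono) auto
        finally show ?thesis by simp
      qed
      finally have "a 0 - a \<theta> \<le> 2 * e * a 0" by simp
      also have "\<dots> \<le> \<epsilon> * a 0" using e kernD(2)[OF k] by (intro mult_right_mono) auto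
      finally show ?thesis by (simp add: algebra_simps)
    qed
    thus "\<exists>a H. kern N C a H \<and> (\<forall>\<theta>\<in>\<Theta>. (1 - \<epsilon>) * a 0 \<le> a \<theta>)" using k by blast
  qed
qed

section \<open>Bilinear estimates\<close>

context prime_modulus
begin

text \<open>After Cauchy-Schwarz in x, orthogonality of the characters leaves only the diagonal in
  the two copies of y.\<close>

lemma bilinear_additive:
  assumes \<xi>: "\<not> int p dvd \<xi>" and a1: "\<And>x. cmod (a x) \<le> 1" and b1: "\<And>x. cmod (b x) \<le> 1"
  shows "(cmod (M (\<lambda>x. M (\<lambda>y. a x * b y * ee p (\<xi> * (x * y))))))\<^sup>2 \<le> 1 / real p"
proof -
  define S where "S x = M (\<lambda>y. b y * ee p (\<xi> * (x * y)))" for x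
  have "M (\<lambda>x. M (\<lambda>y. a x * b y * ee p (\<xi> * (x * y)))) = M (\<lambda>x. a x * S x)"
    unfolding S_def mean_mult_left[symmetric] by (simp add: mult.assoc)
  hence "(cmod (M (\<lambda>x. M (\<lambda>y. a x * b y * ee p (\<xi> * (x * y))))))\<^sup>2 \<le> M (\<lambda>x. (cmod (a x * S x))\<^sup>2)"
    by (simp only: cmod_mean_square_le)
  also have "\<dots> \<le> M (\<lambda>x. (cmod (S x))\<^sup>2)"
    by (intro mean_mono power_mono) (simp_all add: norm_mult mult_left_le_one_le a1)
  also have "\<dots> = cmod (complex_of_real (M (\<lambda>x. (cmod (S x))\<^sup>2)))"
    by (simp add: mean_nonneg)
  also have "complex_of_real (M (\<lambda>x. (cmod (S x))\<^sup>2)) = M (\<lambda>y. M (\<lambda>z. b y * cnj (b z) * (if z = y then 1 else 0)))"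
  proof -
    have "complex_of_real (M (\<lambda>x. (cmod (S x))\<^sup>2)) = M (\<lambda>x. M (\<lambda>y. M (\<lambda>z. b y * cnj (b z) * ee p (\<xi> * (y - z) * x))))"
      unfolding mean_of_real[symmetric] S_def cmod_square_mean
    proof (intro mean_cong)
      fix x y z
      have "ee p (\<xi> * (y - z) * x) = ee p (\<xi> * (x * y)) * cnj (ee p (\<xi> * (x * z)))"
        unfolding ee_diff[symmetric] by (rule arg_cong[where f = "ee p"]) (simp add: algebra_simps)
      thus "(b y * ee p (\<xi> * (x * y))) * cnj (b z * ee p (\<xi> * (x * z))) = b y * cnj (b z) * ee p (\<xi> * (y - z) * x)"
        by (simp only: complex_cnj_mult mult_ac)
    qed
    also have "\<dots> = M (\<lambda>y. M (\<lambda>x. M (\<lambda>z. b y * cnj (b z) * ee p (\<xi> * (y - z) * x))))" by (rule mean_swap)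
    also have "\<dots> = M (\<lambda>y. M (\<lambda>z. M (\<lambda>x. b y * cnj (b z) * ee p (\<xi> * (y - z) * x))))"
      by (rule mean_cong, rule mean_swap)
    also have "\<dots> = M (\<lambda>y. M (\<lambda>z. b y * cnj (b z) * (if z = y then 1 else 0)))"
      unfolding mean_mult_left mean_ee[OF p_pos]
    proof (intro mean_cong)
      fix y z assume yz: "y \<in> Z p" "z \<in> Z p"
      have "int p dvd \<xi> * (y - z) \<longleftrightarrow> z = y"
        using \<xi> prime_dvd_mult_iff[OF prime_int] Z_cong_eq[OF yz] by (auto simp: cong_iff_dvd_diff)
      thus "b y * cnj (b z) * (if int p dvd \<xi> * (y - z) then 1 else 0) = b y * cnj (b z) * (if z = y then 1 else 0)"
        by simp
    qed
    finally show ?thesis .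
  qed
  also have "cmod \<dots> \<le> M (\<lambda>y. 1 / real p)"
  proof (rule order.trans[OF norm_mean_le mean_mono])
    fix y assume y: "y \<in> Z p"
    have "M (\<lambda>z. b y * cnj (b z) * (if z = y then 1 else 0)) = M (\<lambda>z. if z = y then b y * cnj (b y) else 0)"
      by (intro mean_cong) auto
    also have "\<dots> = (b y * cnj (b y)) /\<^sub>R real p" by (rule of_bool_mean_single[OF p_pos y])
    also have "cmod \<dots> = cmod (b y) * cmod (b y) / real p" by (simp add: norm_mult divide_inverse)
    also have "\<dots> \<le> 1 / real p" by (intro divide_right_mono mult_le_one b1) auto
    finally show "cmod (M (\<lambda>z. b y * cnj (b z) * (if z = y then 1 else 0))) \<le> 1 / real p" .
  qed
  also have "\<dots> = 1 / real p" by (rule mean_const) (use Zp_ne in auto)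
  finally show ?thesis .
qed

lemma per_gp: "per q gp"
  unfolding gp_def by (rule perI) (simp add: Cong.cong_def)

text \<open>In logarithmic coordinates the part with x and y nonzero is a form in
  \<open>a' m * b' n * H (m + n)\<close> on Z/q, bounded by the largest Fourier coefficient of H,
  that is by the correlation of G with multiplicative characters. Of the 3/p, two parts pay for the
  lines x = 0 and y = 0 and one for the value of G at 0.\<close>

lemma bilinear_multiplicative:
  assumes G: "per p G" and a1: "\<And>x. cmod (a x) \<le> 1" and b1: "\<And>x. cmod (b x) \<le> 1" and G1: "\<And>x. cmod (G x) \<le> 1"
    and unif: "\<And>k. cmod (M (\<lambda>t. G t * ee q (k * ind t))) \<le> \<eta>"
  shows "cmod (M (\<lambda>x. M (\<lambda>y. a x * b y * G (x * y)))) \<le> \<eta> + 3 / real p"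
proof -
  \<comment> \<open>a and b are arbitrary outside \<open>Z p\<close>, so they are evaluated at
    canonical residues.\<close>
  define a' where "a' m = a (gp m mod int p)" for m
  define b' where "b' m = b (gp m mod int p)" for m
  define H where "H m = G (gp m)" for m
  have perH: "per q H" unfolding H_def by (rule perI) (metis per_gp perD)
  have perb': "per q (\<lambda>m. cnj (b' m))" unfolding b'_def by (rule perI) (metis per_gp perD)
  have \<eta>0: "\<eta> \<ge> 0" using unif[of 0] norm_ge_zero order.trans by blast
  have pq: "real q \<le> real p" by (simp add: q_def)
  have ftH: "cmod (ft q H \<kappa>) * real q \<le> real p * \<eta> + 1" for \<kappa>
  proof -
    define f where "f t = G t * ee q (- \<kappa> * ind t)" for t
    have perf: "per p f" unfolding f_def by (rule perI) (metis perD[OF G] perD[OF per_ind])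
    have "ft q H \<kappa> * of_nat q = (\<Sum>m\<in>Z q. f (gp m))"
    proof -
      have "ft q H \<kappa> * of_nat q = (\<Sum>m\<in>Z q. H m * ee q (- (\<kappa> * m)))"
        using q_pos by (simp add: ft_def mean_def scaleR_conv_of_real)
      also have "\<dots> = (\<Sum>m\<in>Z q. f (gp m))"
      proof (intro sum.cong refl)
        fix m
        have "ee q (- \<kappa> * ind (gp m)) = ee q (- \<kappa> * m)"
          by (intro ee_cong q_pos cong_mult cong_refl ind_gp)
        thus "H m * ee q (- (\<kappa> * m)) = f (gp m)" by (simp add: f_def H_def)
      qed
      finally show ?thesis .
    qed
    also have "\<dots> = (\<Sum>x\<in>Z p - {0}. f x)" by (rule sum_nonzero_gp[OF perf, symmetric])
    also have "\<dots> = (\<Sum>x\<in>Z p. f x) - f 0" using p_pos by (simp add: sum_diff1)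
    also have "(\<Sum>x\<in>Z p. f x) = of_nat p * M f" using p_pos by (simp add: mean_def scaleR_conv_of_real)
    finally have "ft q H \<kappa> * of_nat q = of_nat p * M f - f 0" .
    hence "cmod (ft q H \<kappa>) * real q = cmod (of_nat p * M f - f 0)" by (metis norm_mult norm_of_nat)
    also have "\<dots> \<le> real p * cmod (M f) + cmod (f 0)"
      by (rule order.trans[OF norm_triangle_ineq4]) (simp add: norm_mult)
    also have "\<dots> \<le> real p * \<eta> + 1"
      using unif[of "- \<kappa>"] G1 by (intro add_mono mult_left_mono) (simp_all add: f_def[abs_def] norm_mult)
    finally show ?thesis .
  qed
  define D where "D = mean (Z q) (\<lambda>m. mean (Z q) (\<lambda>n. a' m * b' n * H (m + n)))"
  have D: "cmod D * real q \<le> real p * \<eta> + 1"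
  proof -
    define B where "B \<kappa> = mean (Z q) (\<lambda>n. b' n * ee q (\<kappa> * n))" for \<kappa>
    have inner: "mean (Z q) (\<lambda>n. b' n * H (m + n)) = (\<Sum>\<kappa>\<in>Z q. (ft q H \<kappa> * B \<kappa>) * ee q (\<kappa> * m))" for m
    proof -
      have "mean (Z q) (\<lambda>n. b' n * H (m + n)) = mean (Z q) (\<lambda>n. \<Sum>\<kappa>\<in>Z q. (ft q H \<kappa> * ee q (\<kappa> * m)) * (b' n * ee q (\<kappa> * n)))"
        by (rule mean_cong, subst ft_inversion[OF q_pos perH])
           (simp add: sum_distrib_left distrib_left ee_add mult_ac)
      also have "\<dots> = (\<Sum>\<kappa>\<in>Z q. (ft q H \<kappa> * ee q (\<kappa> * m)) * B \<kappa>)"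
        unfolding mean_sum mean_mult_left B_def ..
      finally show ?thesis by (simp add: mult_ac)
    qed
    have cB: "cmod (B \<kappa>) = cmod (ft q (\<lambda>m. cnj (b' m)) \<kappa>)" for \<kappa>
    proof -
      have "cnj (B \<kappa>) = ft q (\<lambda>m. cnj (b' m)) \<kappa>" by (simp add: B_def ft_def mean_cnj ee_minus)
      thus ?thesis by (metis complex_mod_cnj)
    qed
    have "D = mean (Z q) (\<lambda>m. a' m * mean (Z q) (\<lambda>n. b' n * H (m + n)))"
      unfolding D_def mean_mult_left[symmetric] by (simp add: mult.assoc)
    hence "(cmod D)\<^sup>2 \<le> mean (Z q) (\<lambda>m. (cmod (a' m * mean (Z q) (\<lambda>n. b' n * H (m + n))))\<^sup>2)"
      by (simp only: cmod_mean_square_le)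
    also have "\<dots> \<le> mean (Z q) (\<lambda>m. (cmod (mean (Z q) (\<lambda>n. b' n * H (m + n))))\<^sup>2)"
      by (intro mean_mono power_mono) (simp_all add: norm_mult mult_left_le_one_le a1 a'_def)
    also have "\<dots> = (\<Sum>\<kappa>\<in>Z q. (cmod (ft q H \<kappa> * B \<kappa>))\<^sup>2)"
      unfolding inner by (rule parseval_coeffs[OF q_pos])
    also have "\<dots> \<le> (\<Sum>\<kappa>\<in>Z q. ((real p * \<eta> + 1) / real q)\<^sup>2 * (cmod (ft q (\<lambda>m. cnj (b' m)) \<kappa>))\<^sup>2)"
    proof (rule sum_mono)
      fix \<kappa>
      have "cmod (ft q H \<kappa>) \<le> (real p * \<eta> + 1) / real q" using ftH[of \<kappa>] q_pos by (simp add: field_simps)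
      hence "(cmod (ft q H \<kappa>))\<^sup>2 \<le> ((real p * \<eta> + 1) / real q)\<^sup>2" by (rule power_mono) simp
      thus "(cmod (ft q H \<kappa> * B \<kappa>))\<^sup>2 \<le> ((real p * \<eta> + 1) / real q)\<^sup>2 * (cmod (ft q (\<lambda>m. cnj (b' m)) \<kappa>))\<^sup>2"
        unfolding norm_mult power_mult_distrib cB by (rule mult_right_mono) simp
    qed
    also have "\<dots> = ((real p * \<eta> + 1) / real q)\<^sup>2 * mean (Z q) (\<lambda>m. (cmod (cnj (b' m)))\<^sup>2)"
      unfolding sum_distrib_left[symmetric] parseval[OF q_pos perb'] ..
    also have "\<dots> \<le> ((real p * \<eta> + 1) / real q)\<^sup>2 * 1"
    proof (rule mult_left_mono[OF mean_bound])
      fix m show "(cmod (cnj (b' m)))\<^sup>2 \<le> 1" by (simp add: b'_def b1 power_le_one)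
    qed (use Zp_ne in auto)
    finally have "(cmod D)\<^sup>2 \<le> ((real p * \<eta> + 1) / real q)\<^sup>2" by (simp only: mult_1_right)
    hence "cmod D \<le> (real p * \<eta> + 1) / real q"
      by (rule power2_le_imp_le) (simp add: \<eta>0)
    thus ?thesis using q_pos by (simp add: field_simps)
  qed
  define T where "T x y = a (x mod int p) * b (y mod int p) * G (x * y)" for x y
  have T1: "cmod (T x y) \<le> 1" for x y by (simp add: T_def norm_mult mult_le_one a1 b1 G1)
  have perT1: "per p (\<lambda>x. T x y)" for y
  proof (rule perI)
    fix x z assume xz: "[x = z] (mod int p)"
    have "G (x * y) = G (z * y)" by (intro perD[OF G] cong_mult xz cong_refl)
    moreover have "x mod int p = z mod int p" using xz by (simp only: Cong.cong_def)
    ultimately show "T x y = T z y" by (simp only: T_def)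
  qed
  have perT2: "per p (T x)" for x
  proof (rule perI)
    fix y z assume yz: "[y = z] (mod int p)"
    have "G (x * y) = G (x * z)" by (intro perD[OF G] cong_mult yz cong_refl)
    moreover have "y mod int p = z mod int p" using yz by (simp only: Cong.cong_def)
    ultimately show "T x y = T x z" by (simp only: T_def)
  qed
  have S: "(\<Sum>x\<in>Z p - {0}. \<Sum>y\<in>Z p - {0}. T x y) = (of_nat q)\<^sup>2 * D"
  proof -
    have "(\<Sum>x\<in>Z p - {0}. \<Sum>y\<in>Z p - {0}. T x y) = (\<Sum>x\<in>Z p - {0}. \<Sum>n\<in>Z q. T x (gp n))"
      by (intro sum.cong refl sum_nonzero_gp perT2)
    also have "\<dots> = (\<Sum>m\<in>Z q. \<Sum>n\<in>Z q. T (gp m) (gp n))"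
      by (rule sum_nonzero_gp) (intro perI sum.cong refl perD[OF perT1])
    also have "\<dots> = (\<Sum>m\<in>Z q. \<Sum>n\<in>Z q. a' m * b' n * H (m + n))"
    proof (intro sum.cong refl)
      fix m n
      have "G (gp m * gp n) = H (m + n)" unfolding H_def by (rule perD[OF G]) (rule cong_sym[OF gp_add])
      thus "T (gp m) (gp n) = a' m * b' n * H (m + n)" by (simp add: T_def a'_def b'_def)
    qed
    also have "\<dots> = (of_nat q)\<^sup>2 * D"
      using q_pos by (simp add: D_def mean_def scaleR_conv_of_real power2_eq_square sum_distrib_left[symmetric])
        (simp add: field_simps)
    finally show ?thesis .
  qed
  have split: "(\<Sum>x\<in>Z p. \<Sum>y\<in>Z p. T x y) =
    (\<Sum>x\<in>Z p - {0}. \<Sum>y\<in>Z p - {0}. T x y) + ((\<Sum>x\<in>Z p - {0}. T x 0) + (\<Sum>y\<in>Z p. T 0 y))"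
  proof -
    have r: "(\<Sum>x\<in>Z p. g x) = (\<Sum>x\<in>Z p - {0}. g x) + g 0" for g :: "int \<Rightarrow> complex"
      using p_pos by (subst sum.remove[of _ 0]) (auto simp: add.commute)
    have "(\<Sum>x\<in>Z p. \<Sum>y\<in>Z p. T x y) = (\<Sum>x\<in>Z p - {0}. \<Sum>y\<in>Z p. T x y) + (\<Sum>y\<in>Z p. T 0 y)" by (rule r)
    also have "(\<Sum>x\<in>Z p - {0}. \<Sum>y\<in>Z p. T x y) = (\<Sum>x\<in>Z p - {0}. (\<Sum>y\<in>Z p - {0}. T x y) + T x 0)"
      by (intro sum.cong refl r)
    finally show ?thesis by (simp add: sum.distrib)
  qed
  have "M (\<lambda>x. M (\<lambda>y. a x * b y * G (x * y))) = M (\<lambda>x. M (\<lambda>y. T x y))"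
    by (intro mean_cong) (simp add: T_def)
  also have "\<dots> = (\<Sum>x\<in>Z p. \<Sum>y\<in>Z p. T x y) / (of_nat p)\<^sup>2"
    by (simp add: mean_def scaleR_conv_of_real power2_eq_square sum_distrib_left[symmetric] divide_inverse)
  finally have "cmod (M (\<lambda>x. M (\<lambda>y. a x * b y * G (x * y)))) * (real p)\<^sup>2 = cmod (\<Sum>x\<in>Z p. \<Sum>y\<in>Z p. T x y)"
    using p_pos by (simp add: norm_divide norm_power)
  also have "\<dots> \<le> (real q)\<^sup>2 * cmod D + (real q + real p)"
  proof -
    have "cmod (\<Sum>x\<in>Z p - {0}. T x 0) \<le> (\<Sum>x\<in>Z p - {0}. 1)" by (intro sum_norm_le T1)
    moreover have "cmod (\<Sum>y\<in>Z p. T 0 y) \<le> (\<Sum>y\<in>Z p. 1)" by (intro sum_norm_le T1)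
    moreover have "real (card (Z p - {0})) = real q" using p_pos by (simp add: q_def)
    ultimately have "cmod ((\<Sum>x\<in>Z p - {0}. T x 0) + (\<Sum>y\<in>Z p. T 0 y)) \<le> real q + real p"
      using norm_triangle_ineq[of "\<Sum>x\<in>Z p - {0}. T x 0" "\<Sum>y\<in>Z p. T 0 y"] by (simp only: sum_constant mult_1_right card_Z)
    moreover have "cmod ((of_nat q)\<^sup>2 * D) = (real q)\<^sup>2 * cmod D" by (simp add: norm_mult norm_power)
    ultimately show ?thesis unfolding split S
      using norm_triangle_ineq[of "(of_nat q)\<^sup>2 * D" "(\<Sum>x\<in>Z p - {0}. T x 0) + (\<Sum>y\<in>Z p. T 0 y)"] by linarith
  qed
  also have "\<dots> \<le> real q * (real p * \<eta> + 1) + (real q + real p)"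
    using mult_left_mono[OF D, of "real q"] by (simp add: power2_eq_square mult_ac)
  also have "\<dots> \<le> real p * (real p * \<eta> + 1) + (real p + real p)"
    using pq \<eta>0 by (intro add_mono mult_right_mono) auto
  also have "\<dots> = (\<eta> + 3 / real p) * (real p)\<^sup>2" using p_pos by (simp add: field_simps power2_eq_square)
  finally show ?thesis using p_pos by simp
qed

text \<open>As \<open>(x + y)\<^sup>2 = x\<^sup>2 + y\<^sup>2 + 2 * x * y\<close>, the phase at x +
  y splits into phases of x and of y, absorbed by \<open>f1\<close> and \<open>f2\<close>, and a
  linear phase in xy, absorbed by \<open>g\<close>. The bilinear estimate then tests
  \<open>g\<close> against an additive times a multiplicative character.\<close>

lemma counting_phase:
  assumes g: "per p g" and b1: "\<And>x. cmod (f1 x) \<le> 1" and b2: "\<And>x. cmod (f2 x) \<le> 1" and bg: "\<And>x. cmod (g x) \<le> 1"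
    and unif: "\<And>b k. cmod (M (\<lambda>t. g t * ph 0 b k t)) \<le> \<eta>"
  shows "cmod (L f1 f2 (ph a b 0) g) \<le> \<eta> + 3 / real p"
proof -
  define G where "G t = g t * ee p (2 * a * t)" for t
  have "L f1 f2 (ph a b 0) g = M (\<lambda>x. M (\<lambda>y. (f1 x * ph a b 0 x) * (f2 y * ph a b 0 y) * G (x * y)))"
    unfolding L_def
  proof (intro mean_cong)
    fix x y
    have "ph a b 0 (x + y) = ph a b 0 x * ph a b 0 y * ee p (2 * a * (x * y))"
      unfolding ph_def by (simp add: ee_add[symmetric] power2_eq_square algebra_simps)
    thus "f1 x * f2 y * ph a b 0 (x + y) * g (x * y) = (f1 x * ph a b 0 x) * (f2 y * ph a b 0 y) * G (x * y)"
      by (simp add: G_def mult_ac)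
  qed
  also have "cmod \<dots> \<le> \<eta> + 3 / real p"
  proof (rule bilinear_multiplicative)
    show "per p G" unfolding G_def
    proof (rule perI)
      fix x y assume xy: "[x = y] (mod int p)"
      have "ee p (2 * a * x) = ee p (2 * a * y)" by (intro ee_cong p_pos cong_mult cong_refl xy)
      thus "g x * ee p (2 * a * x) = g y * ee p (2 * a * y)" using perD[OF g xy] by simp
    qed
    show "cmod (M (\<lambda>t. G t * ee q (k * ind t))) \<le> \<eta>" for k
      using unif[of "2 * a" k] by (simp add: G_def ph_def mult.assoc)
  qed (simp_all add: norm_mult b1 b2 bg G_def)
  finally show ?thesis .
qed

section \<open>Large spectrum\<close>

text \<open>A character of Z/p x Z/p x Z/q at an arbitrary position (v, w, u); \<open>phi\<close> is
  its restriction to the curve of the positions \<open>(x, x\<^sup>2, ind x)\<close>. In \<gamma>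
  the quadratic frequency comes first, then the linear and the multiplicative one.\<close>

definition pc :: "int \<times> int \<times> int \<Rightarrow> int \<Rightarrow> int \<Rightarrow> int \<Rightarrow> complex" where
  "pc \<gamma> v w u = ee p (fst \<gamma> * w + fst (snd \<gamma>) * v) * ee q (snd (snd \<gamma>) * u)"

abbreviation phi :: "int \<times> int \<times> int \<Rightarrow> int \<Rightarrow> complex" where
  "phi \<gamma> \<equiv> ph (fst \<gamma>) (fst (snd \<gamma>)) (snd (snd \<gamma>))"

lemma phi_pc: "phi \<gamma> x = pc \<gamma> x (x\<^sup>2) (ind x)"
  by (simp add: ph_def pc_def)

lemma cmod_pc [simp]: "cmod (pc \<gamma> v w u) = 1" by (simp add: pc_def norm_mult)

definition Dual :: "(int \<times> int \<times> int) set" where "Dual = Z p \<times> Z p \<times> Z q"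

lemma finite_Dual [simp]: "finite Dual" by (simp add: Dual_def)

definition fc :: "(int \<Rightarrow> complex) \<Rightarrow> int \<times> int \<times> int \<Rightarrow> complex" where
  "fc f \<gamma> = M (\<lambda>x. f x * cnj (phi \<gamma> x))"

lemma cmod_fc_le: "(\<And>x. cmod (f x) \<le> B) \<Longrightarrow> cmod (fc f \<gamma>) \<le> B"
  unfolding fc_def using Zp_ne by (intro norm_mean_bound) (auto simp: norm_mult)

lemma phi_orthogonal:
  assumes "\<gamma> \<in> Dual" "\<delta> \<in> Dual"
  shows "cmod (M (\<lambda>x. phi \<gamma> x * cnj (phi \<delta> x)) - (if \<gamma> = \<delta> then 1 else 0)) \<le> (if \<gamma> = \<delta> then 0 else tau)"
proof (cases "\<gamma> = \<delta>")
  case True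
  have "M (\<lambda>x. 1 :: complex) = 1" by (rule mean_const) (use Zp_ne in auto)
  thus ?thesis using True by simp
next
  case False
  obtain a b k a' b' k' where g: "\<gamma> = (a, b, k)" "\<delta> = (a', b', k')" by (metis prod_cases3)
  have mem: "a \<in> Z p" "b \<in> Z p" "k \<in> Z q" "a' \<in> Z p" "b' \<in> Z p" "k' \<in> Z q"
    using assms by (simp_all only: g Dual_def mem_Times_iff fst_conv snd_conv)
  have "\<not> (int p dvd a - a' \<and> int p dvd b - b' \<and> int q dvd k - k')"
    using False Z_cong_eq[OF mem(1,4)] Z_cong_eq[OF mem(2,5)] Z_cong_eq[OF mem(3,6)]
    by (auto simp: g cong_iff_dvd_diff)
  hence "cmod (M (ph (a - a') (b - b') (k - k'))) \<le> tau" by (rule cmod_mean_ph)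
  moreover have "M (\<lambda>x. phi \<gamma> x * cnj (phi \<delta> x)) = M (ph (a - a') (b - b') (k - k'))"
    by (simp add: g ph_diff[abs_def])
  ultimately show ?thesis by (simp only: False if_False diff_0_right)
qed

text \<open>Bessel's inequality from the non-negative mean square of f - g, where g is the partial
  expansion of f over S. The phases are only almost orthogonal, and each pair costs at most
  \<open>tau\<close>.\<close>

lemma bessel:
  assumes f1: "\<And>x. cmod (f x) \<le> 1" and S: "S \<subseteq> Dual"
  shows "(\<Sum>\<gamma>\<in>S. (cmod (fc f \<gamma>))\<^sup>2) \<le> 1 + (real (card S))\<^sup>2 * tau"
proof -
  have fin: "finite S" using S finite_Dual finite_subset by blast
  define c where "c = fc f"
  define g where "g x = (\<Sum>\<gamma>\<in>S. c \<gamma> * phi \<gamma> x)" for x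
  have c1: "cmod (c \<gamma>) \<le> 1" for \<gamma> unfolding c_def by (rule cmod_fc_le) (rule f1)
  define E where "E = (\<Sum>\<gamma>\<in>S. \<Sum>\<delta>\<in>S. c \<gamma> * cnj (c \<delta>) * (M (\<lambda>x. phi \<gamma> x * cnj (phi \<delta> x)) - (if \<gamma> = \<delta> then 1 else 0)))"
  have fg: "M (\<lambda>x. f x * cnj (g x)) = (\<Sum>\<gamma>\<in>S. complex_of_real ((cmod (c \<gamma>))\<^sup>2))"
  proof -
    have "M (\<lambda>x. f x * cnj (g x)) = M (\<lambda>x. \<Sum>\<gamma>\<in>S. cnj (c \<gamma>) * (f x * cnj (phi \<gamma> x)))"
      by (simp add: g_def cnj_sum sum_distrib_left mult_ac)
    also have "\<dots> = (\<Sum>\<gamma>\<in>S. cnj (c \<gamma>) * c \<gamma>)" unfolding mean_sum mean_mult_left c_def fc_def ..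
    finally show ?thesis unfolding complex_norm_square by (simp only: mult.commute)
  qed
  have gg: "M (\<lambda>x. g x * cnj (g x)) = (\<Sum>\<gamma>\<in>S. complex_of_real ((cmod (c \<gamma>))\<^sup>2)) + E"
  proof -
    have "M (\<lambda>x. g x * cnj (g x)) = M (\<lambda>x. \<Sum>\<gamma>\<in>S. \<Sum>\<delta>\<in>S. c \<gamma> * cnj (c \<delta>) * (phi \<gamma> x * cnj (phi \<delta> x)))"
      by (simp add: g_def cnj_sum sum_product mult_ac)
    also have "\<dots> = (\<Sum>\<gamma>\<in>S. \<Sum>\<delta>\<in>S. c \<gamma> * cnj (c \<delta>) * M (\<lambda>x. phi \<gamma> x * cnj (phi \<delta> x)))"
      unfolding mean_sum mean_mult_left ..
    also have "\<dots> = (\<Sum>\<gamma>\<in>S. \<Sum>\<delta>\<in>S. c \<gamma> * cnj (c \<delta>) * (if \<gamma> = \<delta> then 1 else 0)) + E"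
      unfolding E_def sum.distrib[symmetric] by (simp add: algebra_simps)
    also have "(\<Sum>\<gamma>\<in>S. \<Sum>\<delta>\<in>S. c \<gamma> * cnj (c \<delta>) * (if \<gamma> = \<delta> then 1 else 0)) = (\<Sum>\<gamma>\<in>S. complex_of_real ((cmod (c \<gamma>))\<^sup>2))"
    proof (intro sum.cong refl)
      fix \<gamma> assume "\<gamma> \<in> S"
      have "(\<Sum>\<delta>\<in>S. c \<gamma> * cnj (c \<delta>) * (if \<gamma> = \<delta> then 1 else 0)) = (\<Sum>\<delta>\<in>S. if \<delta> = \<gamma> then c \<gamma> * cnj (c \<gamma>) else 0)"
        by (intro sum.cong refl) auto
      thus "(\<Sum>\<delta>\<in>S. c \<gamma> * cnj (c \<delta>) * (if \<gamma> = \<delta> then 1 else 0)) = complex_of_real ((cmod (c \<gamma>))\<^sup>2)"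
        using fin \<open>\<gamma> \<in> S\<close> unfolding complex_norm_square by simp
    qed
    finally show ?thesis .
  qed
  have E: "cmod E \<le> (real (card S))\<^sup>2 * tau"
  proof -
    have "cmod E \<le> (\<Sum>\<gamma>\<in>S. \<Sum>\<delta>\<in>S. tau)"
      unfolding E_def
    proof (intro sum_norm_le)
      fix \<gamma> \<delta> assume gd: "\<gamma> \<in> S" "\<delta> \<in> S"
      have "cmod (M (\<lambda>x. phi \<gamma> x * cnj (phi \<delta> x)) - (if \<gamma> = \<delta> then 1 else 0)) \<le> (if \<gamma> = \<delta> then 0 else tau)"
        using gd S by (intro phi_orthogonal) auto
      also have "\<dots> \<le> tau" using tau_nonneg by simp
      finally have "cmod (M (\<lambda>x. phi \<gamma> x * cnj (phi \<delta> x)) - (if \<gamma> = \<delta> then 1 else 0)) \<le> tau" .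
      moreover have "cmod (c \<gamma> * cnj (c \<delta>)) \<le> 1" by (simp add: norm_mult mult_le_one c1)
      ultimately have "cmod (c \<gamma> * cnj (c \<delta>)) * cmod (M (\<lambda>x. phi \<gamma> x * cnj (phi \<delta> x)) - (if \<gamma> = \<delta> then 1 else 0)) \<le> 1 * tau"
        by (intro mult_mono) auto
      thus "cmod (c \<gamma> * cnj (c \<delta>) * (M (\<lambda>x. phi \<gamma> x * cnj (phi \<delta> x)) - (if \<gamma> = \<delta> then 1 else 0))) \<le> tau"
        by (simp only: norm_mult mult_1)
    qed
    thus ?thesis by (simp add: power2_eq_square mult_ac)
  qed
  define s where "s = (\<Sum>\<gamma>\<in>S. (cmod (c \<gamma>))\<^sup>2)"
  have "complex_of_real (M (\<lambda>x. (cmod (f x - g x))\<^sup>2)) =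
     M (\<lambda>x. f x * cnj (f x) - f x * cnj (g x) - cnj (f x * cnj (g x)) + g x * cnj (g x))"
    unfolding mean_of_real[symmetric] complex_norm_square by (simp add: algebra_simps)
  also have "\<dots> = M (\<lambda>x. f x * cnj (f x)) - complex_of_real s + E"
    by (simp add: mean_add mean_diff mean_cnj[symmetric] fg gg s_def del: complex_cnj_mult)
  finally have "complex_of_real (M (\<lambda>x. (cmod (f x - g x))\<^sup>2)) = complex_of_real (M (\<lambda>x. (cmod (f x))\<^sup>2)) - complex_of_real s + E"
    unfolding mean_of_real[symmetric] complex_norm_square .
  from arg_cong[OF this, of Re] have "M (\<lambda>x. (cmod (f x - g x))\<^sup>2) = M (\<lambda>x. (cmod (f x))\<^sup>2) - s + Re E"
    by (simp only: Re_complex_of_real minus_complex.simps plus_complex.simps)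
  moreover have "0 \<le> M (\<lambda>x. (cmod (f x - g x))\<^sup>2)" by (rule mean_nonneg) simp
  moreover have "M (\<lambda>x. (cmod (f x))\<^sup>2) \<le> 1" by (rule M_le) (simp add: f1 power_le_one)
  moreover have "Re E \<le> cmod E" by (rule complex_Re_le_cmod)
  ultimately show ?thesis using E unfolding s_def c_def by linarith
qed

text \<open>Testing a subset with exactly d elements keeps the quadratic error of
  \<open>bessel\<close> bounded, however large the spectrum might be.\<close>

lemma card_spectrum:
  assumes f1: "\<And>x. cmod (f x) \<le> 1" and d: "1 + (real d)\<^sup>2 * tau < real d * \<eta>\<^sup>2" and \<eta>: "\<eta> \<ge> 0"
  shows "card {\<gamma> \<in> Dual. cmod (fc f \<gamma>) > \<eta>} \<le> d"
proof (rule ccontr)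
  assume "\<not> card {\<gamma> \<in> Dual. cmod (fc f \<gamma>) > \<eta>} \<le> d"
  hence "d \<le> card {\<gamma> \<in> Dual. cmod (fc f \<gamma>) > \<eta>}" by simp
  then obtain S where S: "S \<subseteq> {\<gamma> \<in> Dual. cmod (fc f \<gamma>) > \<eta>}" "card S = d"
    by (rule obtain_subset_with_card_n)
  have "real d * \<eta>\<^sup>2 = (\<Sum>\<gamma>\<in>S. \<eta>\<^sup>2)" using S by simp
  also have "\<dots> \<le> (\<Sum>\<gamma>\<in>S. (cmod (fc f \<gamma>))\<^sup>2)"
    using S \<eta> by (intro sum_mono power_mono) auto
  also have "\<dots> \<le> 1 + (real d)\<^sup>2 * tau" using bessel[of f S] f1 S by auto
  finally show False using d by simp
qed

end

section \<open>Smoothing\<close>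

lemma kern_one_coeff: "kern N C a (\<lambda>_. 1) \<Longrightarrow> a \<xi> = (if int N dvd \<xi> then 1 else 0)"
proof -
  assume k: "kern N C a (\<lambda>_. 1)"
  have "complex_of_real (a \<xi>) = (if int N dvd \<xi> then 1 else 0)"
    unfolding kern_coeff[OF k, symmetric] using mean_ee[OF kernD(1)[OF k], of \<xi>] by simp
  thus ?thesis by (simp split: if_splits)
qed

lemma kern_C_pos: "kern N C a H \<Longrightarrow> C \<ge> 1"
  using kern_mean_ge[of N C a H] by (cases C) auto

text \<open>\<open>H1\<close>, \<open>H2\<close> and \<open>P\<close> act on the coordinates
  \<open>x\<close>, \<open>x\<^sup>2\<close> and \<open>ind x\<close> of a position. A coordinate is
  ignored by choosing the constant kernel 1 for it.\<close>

locale smoothing = prime_modulus +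
  fixes C :: nat and a1 H1 a2 H2 b P
  assumes k1: "kern p C a1 H1" and k2: "kern p C a2 H2" and k3: "kern q C b P"
begin

definition nrm :: real where "nrm = a1 0 * a2 0 * b 0"

text \<open>Weights the x whose position is near (v, w, u); dividing by \<open>nrm\<close> makes its
  mean over x about 1, see \<open>wt_mean\<close>.\<close>

definition wt :: "int \<Rightarrow> int \<Rightarrow> int \<Rightarrow> int \<Rightarrow> real" where
  "wt x v w u = H1 (x - v) * H2 (x\<^sup>2 - w) * P (ind x - u) / nrm"

text \<open>The multiplier by which smoothing acts on the coefficient at \<gamma>, normalised to 1
  at the trivial character.\<close>

definition mu :: "int \<times> int \<times> int \<Rightarrow> real" where
  "mu \<gamma> = a1 (fst (snd \<gamma>)) * a2 (fst \<gamma>) * b (snd (snd \<gamma>)) / nrm"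

text \<open>(v, w, u) is any point of the product group, whether or not it is the position of an
  element. \<open>sm\<close> is the real-valued version.\<close>

definition sc :: "(int \<Rightarrow> complex) \<Rightarrow> int \<Rightarrow> int \<Rightarrow> int \<Rightarrow> complex" where
  "sc f v w u = M (\<lambda>x. complex_of_real (wt x v w u) * f x)"

definition sm :: "(int \<Rightarrow> real) \<Rightarrow> int \<Rightarrow> int \<Rightarrow> int \<Rightarrow> real" where
  "sm f v w u = M (\<lambda>x. wt x v w u * f x)"

text \<open>The smoothing read off at the position of s itself: the function that replaces
  f.\<close>

definition sd :: "(int \<Rightarrow> complex) \<Rightarrow> int \<Rightarrow> complex" where
  "sd f s = sc f s (s\<^sup>2) (ind s)"

lemma pos: "a1 0 > 0" "a2 0 > 0" "b 0 > 0" "nrm > 0"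
  using kern_pos[OF k1] kern_pos[OF k2] kern_pos[OF k3] by (simp_all add: nrm_def)

lemma inverse_nrm: "1 / nrm \<le> real C ^ 3"
proof -
  have "1 / a1 0 \<le> real C" "1 / a2 0 \<le> real C" "1 / b 0 \<le> real C"
    using kern_mean_ge[OF k1] kern_mean_ge[OF k2] kern_mean_ge[OF k3] pos by (simp_all add: field_simps)
  hence "(1 / a1 0) * (1 / a2 0) * (1 / b 0) \<le> real C * real C * real C"
    using pos by (intro mult_mono) auto
  thus ?thesis by (simp add: nrm_def power3_eq_cube)
qed

lemma wt_nonneg: "wt x v w u \<ge> 0"
  unfolding wt_def using pos kernD(7)[OF k1] kernD(7)[OF k2] kernD(7)[OF k3] by simp

lemma wt_le: "wt x v w u \<le> real C ^ 3"
proof -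
  have "H1 (x - v) * H2 (x\<^sup>2 - w) * P (ind x - u) \<le> 1 * 1 * 1"
    using kern_le_1[OF k1] kern_le_1[OF k2] kern_le_1[OF k3]
      kernD(7)[OF k1] kernD(7)[OF k2] kernD(7)[OF k3] by (intro mult_mono) auto
  hence "wt x v w u \<le> 1 / nrm" unfolding wt_def using pos by (intro divide_right_mono) auto
  thus ?thesis using inverse_nrm by simp
qed

lemma mu_nonneg: "mu \<gamma> \<ge> 0"
  unfolding mu_def using pos kernD(2)[OF k1] kernD(2)[OF k2] kernD(2)[OF k3] by simp

lemma mu_le_1: "mu \<gamma> \<le> 1"
proof -
  have "a1 (fst (snd \<gamma>)) * a2 (fst \<gamma>) * b (snd (snd \<gamma>)) \<le> nrm"
    unfolding nrm_def
    using kern_coeff_le[OF k1] kern_coeff_le[OF k2] kern_coeff_le[OF k3]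
      kernD(2)[OF k1] kernD(2)[OF k2] kernD(2)[OF k3] by (intro mult_mono) auto
  thus ?thesis unfolding mu_def using pos by simp
qed

lemma mu_ge:
  assumes "(1 - \<epsilon>) * a1 0 \<le> a1 (fst (snd \<gamma>))" "(1 - \<epsilon>) * a2 0 \<le> a2 (fst \<gamma>)" "(1 - \<epsilon>) * b 0 \<le> b (snd (snd \<gamma>))" "\<epsilon> \<le> 1"
  shows "1 - 3 * \<epsilon> \<le> mu \<gamma>"
proof -
  have "((1 - \<epsilon>) * a1 0) * ((1 - \<epsilon>) * a2 0) * ((1 - \<epsilon>) * b 0) \<le> a1 (fst (snd \<gamma>)) * a2 (fst \<gamma>) * b (snd (snd \<gamma>))"
    using assms pos kernD(2)[OF k1] kernD(2)[OF k2] by (intro mult_mono) auto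
  hence "(1 - \<epsilon>) ^ 3 * nrm \<le> mu \<gamma> * nrm"
    using pos by (simp add: mu_def nrm_def power3_eq_cube mult_ac)
  hence "(1 - \<epsilon>) ^ 3 \<le> mu \<gamma>" using pos by simp
  moreover have "1 + real 3 * (- \<epsilon>) \<le> (1 + (- \<epsilon>)) ^ 3"
    using assms(4) by (intro Bernoulli_inequality) simp
  ultimately show ?thesis by simp
qed

lemma sum_mu: "(\<Sum>\<gamma>\<in>Dual. mu \<gamma>) \<le> real C ^ 3"
proof -
  have "(\<Sum>\<gamma>\<in>Dual. mu \<gamma>) = (\<Sum>\<alpha>\<in>Z p. \<Sum>\<beta>\<in>Z p. \<Sum>\<kappa>\<in>Z q. a1 \<beta> * a2 \<alpha> * b \<kappa>) / nrm"
    unfolding Dual_def mu_def sum_divide_distrib[symmetric] by (simp add: sum.cartesian_product')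
  also have "(\<Sum>\<alpha>\<in>Z p. \<Sum>\<beta>\<in>Z p. \<Sum>\<kappa>\<in>Z q. a1 \<beta> * a2 \<alpha> * b \<kappa>) = 1"
    by (simp add: sum_distrib_left[symmetric] sum_distrib_right[symmetric] kernD(5)[OF k1] kernD(5)[OF k2] kernD(5)[OF k3])
  finally show ?thesis using inverse_nrm by simp
qed

lemma wt_expand:
  "complex_of_real (wt x v w u) = (\<Sum>\<gamma>\<in>Dual. complex_of_real (mu \<gamma>) * (phi \<gamma> x * cnj (pc \<gamma> v w u)))"
proof -
  have "complex_of_real (wt x v w u) * complex_of_real nrm =
    (\<Sum>\<alpha>\<in>Z p. complex_of_real (a2 \<alpha>) * ee p (\<alpha> * (x\<^sup>2 - w))) * ((\<Sum>\<beta>\<in>Z p. complex_of_real (a1 \<beta>) * ee p (\<beta> * (x - v))) *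
     (\<Sum>\<kappa>\<in>Z q. complex_of_real (b \<kappa>) * ee q (\<kappa> * (ind x - u))))"
    unfolding kernD(8)[OF k1, symmetric] kernD(8)[OF k2, symmetric] kernD(8)[OF k3, symmetric]
    using pos by (simp add: wt_def mult_ac)
  also have "\<dots> = (\<Sum>\<gamma>\<in>Dual. (complex_of_real (a2 (fst \<gamma>)) * ee p (fst \<gamma> * (x\<^sup>2 - w))) *
     ((complex_of_real (a1 (fst (snd \<gamma>))) * ee p (fst (snd \<gamma>) * (x - v))) *
     (complex_of_real (b (snd (snd \<gamma>))) * ee q (snd (snd \<gamma>) * (ind x - u)))))"
    unfolding Dual_def sum_product by (simp add: sum.cartesian_product' sum_distrib_left)
  also have "\<dots> = (\<Sum>\<gamma>\<in>Dual. complex_of_real (mu \<gamma>) * (phi \<gamma> x * cnj (pc \<gamma> v w u))) * complex_of_real nrm"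
    unfolding sum_distrib_right
  proof (intro sum.cong refl)
    fix \<gamma> :: "int \<times> int \<times> int"
    have e1: "phi \<gamma> x * cnj (pc \<gamma> v w u) = ee p (fst \<gamma> * (x\<^sup>2 - w)) * (ee p (fst (snd \<gamma>) * (x - v)) * ee q (snd (snd \<gamma>) * (ind x - u)))"
    proof -
      have A: "ee p (fst \<gamma> * x\<^sup>2 + fst (snd \<gamma>) * x) * cnj (ee p (fst \<gamma> * w + fst (snd \<gamma>) * v)) =
          ee p (fst \<gamma> * (x\<^sup>2 - w)) * ee p (fst (snd \<gamma>) * (x - v))"
        unfolding ee_diff[symmetric] ee_add[symmetric] by (rule arg_cong[where f = "ee p"]) (simp add: algebra_simps)
      have B: "ee q (snd (snd \<gamma>) * ind x) * cnj (ee q (snd (snd \<gamma>) * u)) = ee q (snd (snd \<gamma>) * (ind x - u))"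
        unfolding ee_diff[symmetric] by (simp only: right_diff_distrib)
      have "phi \<gamma> x * cnj (pc \<gamma> v w u) =
        (ee p (fst \<gamma> * x\<^sup>2 + fst (snd \<gamma>) * x) * cnj (ee p (fst \<gamma> * w + fst (snd \<gamma>) * v))) *
        (ee q (snd (snd \<gamma>) * ind x) * cnj (ee q (snd (snd \<gamma>) * u)))"
        unfolding ph_def pc_def complex_cnj_mult by (simp only: mult_ac)
      thus ?thesis unfolding A B by (simp only: mult.assoc)
    qed
    have e2: "complex_of_real (mu \<gamma>) * complex_of_real nrm =
      complex_of_real (a2 (fst \<gamma>)) * (complex_of_real (a1 (fst (snd \<gamma>))) * complex_of_real (b (snd (snd \<gamma>))))"
      using pos by (simp add: mu_def mult_ac)
    have "complex_of_real (mu \<gamma>) * (phi \<gamma> x * cnj (pc \<gamma> v w u)) * complex_of_real nrm =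
        (complex_of_real (mu \<gamma>) * complex_of_real nrm) * (phi \<gamma> x * cnj (pc \<gamma> v w u))"
      by (simp only: mult_ac)
    also have "\<dots> = (complex_of_real (a2 (fst \<gamma>)) * ee p (fst \<gamma> * (x\<^sup>2 - w))) *
     ((complex_of_real (a1 (fst (snd \<gamma>))) * ee p (fst (snd \<gamma>) * (x - v))) *
     (complex_of_real (b (snd (snd \<gamma>))) * ee q (snd (snd \<gamma>) * (ind x - u))))"
      unfolding e1 e2 by (simp only: mult_ac)
    finally show "(complex_of_real (a2 (fst \<gamma>)) * ee p (fst \<gamma> * (x\<^sup>2 - w))) *
     ((complex_of_real (a1 (fst (snd \<gamma>))) * ee p (fst (snd \<gamma>) * (x - v))) *
     (complex_of_real (b (snd (snd \<gamma>))) * ee q (snd (snd \<gamma>) * (ind x - u)))) =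
     complex_of_real (mu \<gamma>) * (phi \<gamma> x * cnj (pc \<gamma> v w u)) * complex_of_real nrm" ..
  qed
  finally show ?thesis using pos by simp
qed

lemma wt_expand_cnj:
  "complex_of_real (wt x v w u) = (\<Sum>\<gamma>\<in>Dual. complex_of_real (mu \<gamma>) * (cnj (phi \<gamma> x) * pc \<gamma> v w u))"
  using arg_cong[OF wt_expand[of x v w u], of cnj] by (simp add: cnj_sum)

lemma sc_expand: "sc f v w u = (\<Sum>\<gamma>\<in>Dual. complex_of_real (mu \<gamma>) * fc f \<gamma> * pc \<gamma> v w u)"
proof -
  have "sc f v w u = M (\<lambda>x. \<Sum>\<gamma>\<in>Dual. (complex_of_real (mu \<gamma>) * pc \<gamma> v w u) * (f x * cnj (phi \<gamma> x)))"
    unfolding sc_def wt_expand_cnj by (simp add: sum_distrib_right sum_distrib_left mult_ac)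
  also have "\<dots> = (\<Sum>\<gamma>\<in>Dual. (complex_of_real (mu \<gamma>) * pc \<gamma> v w u) * fc f \<gamma>)"
    unfolding mean_sum mean_mult_left fc_def ..
  finally show ?thesis by (simp add: mult_ac)
qed

lemma sd_expand: "sd f s = (\<Sum>\<gamma>\<in>Dual. complex_of_real (mu \<gamma>) * fc f \<gamma> * phi \<gamma> s)"
  unfolding sd_def sc_expand phi_pc ..

lemma of_real_sm: "complex_of_real (sm f v w u) = sc (\<lambda>x. complex_of_real (f x)) v w u"
  by (simp add: sm_def sc_def mean_of_real[symmetric])

lemma per_sd: "per p (sd f)"
  unfolding sd_expand by (intro perI sum.cong refl arg_cong2[where f = "(*)"] perD[OF per_ph])

text \<open>Equidistribution of the positions: every nontrivial character has mean at most
  \<open>tau\<close> along the curve, and the multipliers have total mass at most C^3.\<close>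

lemma wt_mean: "\<bar>M (\<lambda>x. wt x v w u) - 1\<bar> \<le> tau * real C ^ 3"
proof -
  have z: "(0, 0, 0) \<in> Dual" using p_pos q_pos by (simp add: Dual_def)
  have mu0: "mu (0, 0, 0) = 1" using pos by (simp add: mu_def nrm_def)
  have "complex_of_real (M (\<lambda>x. wt x v w u)) = sc (\<lambda>_. 1) v w u"
    by (simp add: sc_def mean_of_real[symmetric])
  also have "\<dots> = 1 + (\<Sum>\<gamma>\<in>Dual - {(0, 0, 0)}. complex_of_real (mu \<gamma>) * fc (\<lambda>_. 1) \<gamma> * pc \<gamma> v w u)"
  proof -
    have "fc (\<lambda>_. 1) (0, 0, 0) = 1" unfolding fc_def using Zp_ne by (simp add: mean_const)
    thus ?thesis unfolding sc_expand by (subst sum.remove[OF finite_Dual z]) (simp add: mu0 pc_def)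
  qed
  finally have e: "complex_of_real (M (\<lambda>x. wt x v w u) - 1) = (\<Sum>\<gamma>\<in>Dual - {(0, 0, 0)}. complex_of_real (mu \<gamma>) * fc (\<lambda>_. 1) \<gamma> * pc \<gamma> v w u)"
    by simp
  have "\<bar>M (\<lambda>x. wt x v w u) - 1\<bar> = cmod (complex_of_real (M (\<lambda>x. wt x v w u) - 1))"
    by (simp only: norm_of_real)
  also have "\<dots> \<le> (\<Sum>\<gamma>\<in>Dual - {(0, 0, 0)}. mu \<gamma> * tau)"
    unfolding e
  proof (rule sum_norm_le)
    fix \<gamma> assume g: "\<gamma> \<in> Dual - {(0, 0, 0)}"
    hence "cmod (M (\<lambda>x. phi (0, 0, 0) x * cnj (phi \<gamma> x)) - (if (0, 0, 0) = \<gamma> then 1 else 0)) \<le> (if (0, 0, 0) = \<gamma> then 0 else tau)"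
      using z by (intro phi_orthogonal) auto
    moreover have "(0, 0, 0) \<noteq> \<gamma>" using g by blast
    ultimately have "cmod (fc (\<lambda>_. 1) \<gamma>) \<le> tau" by (simp add: fc_def)
    thus "cmod (complex_of_real (mu \<gamma>) * fc (\<lambda>_. 1) \<gamma> * pc \<gamma> v w u) \<le> mu \<gamma> * tau"
      using mu_nonneg[of \<gamma>] by (simp add: norm_mult mult_left_mono)
  qed
  also have "\<dots> \<le> (\<Sum>\<gamma>\<in>Dual. mu \<gamma> * tau)"
    using mu_nonneg tau_nonneg by (intro sum_mono2) auto
  also have "\<dots> \<le> tau * real C ^ 3"
    unfolding sum_distrib_right[symmetric] using mult_left_mono[OF sum_mu tau_nonneg] by (simp only: mult.commute)
  finally show ?thesis .
qed

lemma cmod_sc_le: "(\<And>x. cmod (f x) \<le> 1) \<Longrightarrow> cmod (sc f v w u) \<le> 1 + tau * real C ^ 3"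
proof -
  assume f: "\<And>x. cmod (f x) \<le> 1"
  have "cmod (sc f v w u) \<le> M (\<lambda>x. cmod (complex_of_real (wt x v w u) * f x))"
    unfolding sc_def by (rule norm_mean_le)
  also have "\<dots> \<le> M (\<lambda>x. wt x v w u)"
    using wt_nonneg by (intro mean_mono) (simp add: norm_mult mult_left_le f)
  finally show ?thesis using wt_mean[of v w u] by linarith
qed

text \<open>For exactly orthogonal phases this would be an identity. Each cross term costs
  \<open>tau\<close>, weighted by \<open>mu\<close>.\<close>

lemma fc_sd:
  assumes f: "\<And>x. cmod (f x) \<le> 1" and g: "\<gamma> \<in> Dual"
  shows "cmod (fc (sd f) \<gamma> - complex_of_real (mu \<gamma>) * fc f \<gamma>) \<le> tau * real C ^ 3"
proof -
  let ?o = "\<lambda>\<delta>. M (\<lambda>x. phi \<delta> x * cnj (phi \<gamma> x))"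
  have "fc (sd f) \<gamma> = M (\<lambda>x. \<Sum>\<delta>\<in>Dual. (complex_of_real (mu \<delta>) * fc f \<delta>) * (phi \<delta> x * cnj (phi \<gamma> x)))"
    unfolding fc_def[of "sd f"] sd_expand by (simp add: sum_distrib_right sum_distrib_left mult_ac)
  also have "\<dots> = (\<Sum>\<delta>\<in>Dual. (complex_of_real (mu \<delta>) * fc f \<delta>) * ?o \<delta>)"
    unfolding mean_sum mean_mult_left ..
  also have "\<dots> = (\<Sum>\<delta>\<in>Dual. (complex_of_real (mu \<delta>) * fc f \<delta>) * (if \<delta> = \<gamma> then 1 else 0)) +
     (\<Sum>\<delta>\<in>Dual. (complex_of_real (mu \<delta>) * fc f \<delta>) * (?o \<delta> - (if \<delta> = \<gamma> then 1 else 0)))"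
    unfolding sum.distrib[symmetric] by (simp add: algebra_simps)
  also have "(\<Sum>\<delta>\<in>Dual. (complex_of_real (mu \<delta>) * fc f \<delta>) * (if \<delta> = \<gamma> then 1 else 0)) = complex_of_real (mu \<gamma>) * fc f \<gamma>"
    using g by (simp add: if_distrib[of "\<lambda>z. _ * z"] cong: if_cong)
  finally have "cmod (fc (sd f) \<gamma> - complex_of_real (mu \<gamma>) * fc f \<gamma>) =
     cmod (\<Sum>\<delta>\<in>Dual. (complex_of_real (mu \<delta>) * fc f \<delta>) * (?o \<delta> - (if \<delta> = \<gamma> then 1 else 0)))" by simp
  also have "\<dots> \<le> (\<Sum>\<delta>\<in>Dual. mu \<delta> * tau)"
  proof (rule sum_norm_le)
    fix \<delta> assume d: "\<delta> \<in> Dual"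
    have "cmod (?o \<delta> - (if \<delta> = \<gamma> then 1 else 0)) \<le> (if \<delta> = \<gamma> then 0 else tau)"
      by (rule phi_orthogonal[OF d g])
    also have "\<dots> \<le> tau" using tau_nonneg by simp
    finally have o: "cmod (?o \<delta> - (if \<delta> = \<gamma> then 1 else 0)) \<le> tau" .
    have "cmod (complex_of_real (mu \<delta>) * fc f \<delta>) \<le> mu \<delta>"
      using mu_nonneg[of \<delta>] cmod_fc_le[of f 1 \<delta>] f by (simp add: norm_mult mult_left_le)
    hence "cmod (complex_of_real (mu \<delta>) * fc f \<delta>) * cmod (?o \<delta> - (if \<delta> = \<gamma> then 1 else 0)) \<le> mu \<delta> * tau"
      using o mu_nonneg by (intro mult_mono) auto
    thus "cmod ((complex_of_real (mu \<delta>) * fc f \<delta>) * (?o \<delta> - (if \<delta> = \<gamma> then 1 else 0))) \<le> mu \<delta> * tau"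
      by (simp only: norm_mult)
  qed
  also have "\<dots> \<le> tau * real C ^ 3"
    unfolding sum_distrib_right[symmetric] using mult_left_mono[OF sum_mu tau_nonneg] by (simp only: mult.commute)
  finally show ?thesis .
qed

text \<open>Up to the orthogonality error, the coefficient of f is multiplied by 1 - mu. This is
  small if the coefficient is small or if \<open>mu\<close> is near 1, and kernels are chosen so
  that one of the two holds at every \<gamma>.\<close>

lemma fc_diff_sd:
  assumes f: "\<And>x. cmod (f x) \<le> 1" and g: "\<gamma> \<in> Dual" and h: "cmod (fc f \<gamma>) \<le> \<eta> \<or> 1 - \<eta> \<le> mu \<gamma>"
  shows "cmod (fc (\<lambda>x. f x - sd f x) \<gamma>) \<le> \<eta> + tau * real C ^ 3"
proof -
  have "fc (\<lambda>x. f x - sd f x) \<gamma> = fc f \<gamma> - fc (sd f) \<gamma>"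
    by (simp add: fc_def left_diff_distrib mean_diff)
  also have "\<dots> = complex_of_real (1 - mu \<gamma>) * fc f \<gamma> - (fc (sd f) \<gamma> - complex_of_real (mu \<gamma>) * fc f \<gamma>)"
    by (simp add: algebra_simps)
  finally have "cmod (fc (\<lambda>x. f x - sd f x) \<gamma>) \<le> cmod (complex_of_real (1 - mu \<gamma>) * fc f \<gamma>) + tau * real C ^ 3"
    using norm_triangle_ineq4 fc_sd[of f, OF f g] by (smt (verit))
  also have "cmod (complex_of_real (1 - mu \<gamma>) * fc f \<gamma>) = (1 - mu \<gamma>) * cmod (fc f \<gamma>)"
    using mu_le_1[of \<gamma>] unfolding norm_mult norm_of_real by simp
  also have "\<dots> \<le> \<eta>"
    using h
  proof
    assume "cmod (fc f \<gamma>) \<le> \<eta>"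
    moreover have "(1 - mu \<gamma>) * cmod (fc f \<gamma>) \<le> cmod (fc f \<gamma>)"
      using mu_nonneg[of \<gamma>] mu_le_1[of \<gamma>] by (intro mult_left_le_one_le) auto
    ultimately show ?thesis by simp
  next
    assume "1 - \<eta> \<le> mu \<gamma>"
    moreover have "(1 - mu \<gamma>) * cmod (fc f \<gamma>) \<le> 1 - mu \<gamma>"
      using mu_le_1[of \<gamma>] cmod_fc_le[of f 1 \<gamma>] f by (intro mult_left_le) auto
    ultimately show ?thesis by simp
  qed
  finally show ?thesis by simp
qed

end

section \<open>Choosing kernels from the large spectrum\<close>

context prime_modulus
begin

lemma mean_ph_fc: "M (\<lambda>s. f s * ph a b k s) = fc f ((- a) mod int p, (- b) mod int p, (- k) mod int q)"
proof -
  have "ph ((- a) mod int p) ((- b) mod int p) ((- k) mod int q) = ph (- a) (- b) (- k)"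
    by (rule ph_cong) (simp_all add: Cong.cong_def)
  thus ?thesis by (simp add: fc_def ph_minus)
qed

lemma mod_Dual: "(a mod int p, b mod int p, k mod int q) \<in> Dual"
  using p_pos q_pos by (simp add: Dual_def)

text \<open>The large spectra have at most nd elements in total. A single kernel on Z/p serves both
  the quadratic and the linear coordinate, which doubles the number of frequencies to be
  preserved.\<close>

lemma exists_joint_kernel:
  assumes hC: "\<And>N \<Theta>. N > 0 \<Longrightarrow> finite \<Theta> \<Longrightarrow> card \<Theta> \<le> 2 * (n * d) \<Longrightarrow>
       \<exists>a H. kern N C a H \<and> (\<forall>\<theta>\<in>\<Theta>. (1 - \<epsilon>) * a 0 \<le> a \<theta>)"
    and I: "finite I" "card I \<le> n" and f: "\<And>i x. i \<in> I \<Longrightarrow> cmod (f i x) \<le> 1"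
    and d: "1 + (real d)\<^sup>2 * tau < real d * \<eta>\<^sup>2" and \<eta>: "\<eta> \<ge> 0"
  shows "\<exists>a H b P. kern p C a H \<and> kern q C b P \<and> (\<forall>i\<in>I. \<forall>\<gamma>\<in>Dual. cmod (fc (f i) \<gamma>) \<le> \<eta> \<or>
     ((1 - \<epsilon>) * a 0 \<le> a (fst \<gamma>) \<and> (1 - \<epsilon>) * a 0 \<le> a (fst (snd \<gamma>)) \<and> (1 - \<epsilon>) * b 0 \<le> b (snd (snd \<gamma>))))"
proof -
  define S where "S i = {\<gamma> \<in> Dual. cmod (fc (f i) \<gamma>) > \<eta>}" for i
  have finS: "finite (S i)" for i by (simp add: S_def)
  have cS: "card (S i) \<le> d" if "i \<in> I" for i
    unfolding S_def by (rule card_spectrum[OF _ d \<eta>]) (rule f[OF that])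
  define U where "U = (\<Union>i\<in>I. S i)"
  have finU: "finite U" unfolding U_def using I finS by blast
  have "card U \<le> (\<Sum>i\<in>I. card (S i))" unfolding U_def using I(1) finS by (intro card_UN_le) auto
  also have "\<dots> \<le> (\<Sum>i\<in>I. d)" by (intro sum_mono cS)
  also have "\<dots> \<le> n * d" using I by simp
  finally have cU: "card U \<le> n * d" .
  define \<Theta> where "\<Theta> = fst ` U \<union> (\<lambda>\<gamma>. fst (snd \<gamma>)) ` U"
  have "card \<Theta> \<le> card U + card U"
    unfolding \<Theta>_def by (intro order.trans[OF card_Un_le] add_mono card_image_le finU)
  hence "card \<Theta> \<le> 2 * (n * d)" using cU by simp
  then obtain a H where aH: "kern p C a H" "\<forall>\<theta>\<in>\<Theta>. (1 - \<epsilon>) * a 0 \<le> a \<theta>"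
    using hC[OF p_pos, of \<Theta>] finU unfolding \<Theta>_def by blast
  have "card ((\<lambda>\<gamma>. snd (snd \<gamma>)) ` U) \<le> card U" by (rule card_image_le[OF finU])
  hence "card ((\<lambda>\<gamma>. snd (snd \<gamma>)) ` U) \<le> 2 * (n * d)" using cU by simp
  then obtain b P where bP: "kern q C b P" "\<forall>\<theta>\<in>(\<lambda>\<gamma>. snd (snd \<gamma>)) ` U. (1 - \<epsilon>) * b 0 \<le> b \<theta>"
    using hC[OF q_pos, of "(\<lambda>\<gamma>. snd (snd \<gamma>)) ` U"] finU by blast
  have "\<forall>i\<in>I. \<forall>\<gamma>\<in>Dual. cmod (fc (f i) \<gamma>) \<le> \<eta> \<or>
     ((1 - \<epsilon>) * a 0 \<le> a (fst \<gamma>) \<and> (1 - \<epsilon>) * a 0 \<le> a (fst (snd \<gamma>)) \<and> (1 - \<epsilon>) * b 0 \<le> b (snd (snd \<gamma>)))"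
  proof (intro ballI)
    fix i \<gamma> assume i: "i \<in> I" "\<gamma> \<in> Dual"
    show "cmod (fc (f i) \<gamma>) \<le> \<eta> \<or>
     ((1 - \<epsilon>) * a 0 \<le> a (fst \<gamma>) \<and> (1 - \<epsilon>) * a 0 \<le> a (fst (snd \<gamma>)) \<and> (1 - \<epsilon>) * b 0 \<le> b (snd (snd \<gamma>)))"
    proof (cases "cmod (fc (f i) \<gamma>) \<le> \<eta>")
      case False
      hence "\<gamma> \<in> S i" using i by (simp add: S_def)
      hence "\<gamma> \<in> U" using i(1) unfolding U_def by blast
      thus ?thesis using aH(2) bP(2) unfolding \<Theta>_def by blast
    qed simp
  qed
  thus ?thesis using aH(1) bP(1) by blast
qed

end

section \<open>Replacing colour classes by their smoothings\<close>

context prime_modulus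
begin

lemma L_add3: "L f1 f2 (\<lambda>s. f s + h s) g = L f1 f2 f g + L f1 f2 h g"
  unfolding L_def by (simp add: distrib_left distrib_right mean_add)

lemma L_add4: "L f1 f2 f (\<lambda>s. g s + h s) = L f1 f2 f g + L f1 f2 f h"
  unfolding L_def by (simp add: distrib_left mean_add)

lemma L_scale3: "L f1 f2 (\<lambda>s. c * f s) g = c * L f1 f2 f g"
  unfolding L_def mean_mult_left[symmetric] by (simp add: mult_ac)

lemma L_scale4: "L f1 f2 f (\<lambda>s. c * g s) = c * L f1 f2 f g"
  unfolding L_def mean_mult_left[symmetric] by (simp add: mult_ac)

lemma L_sum3: "L f1 f2 (\<lambda>s. \<Sum>i\<in>I. c i * f i s) g = (\<Sum>i\<in>I. c i * L f1 f2 (f i) g)"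
proof -
  have "L f1 f2 (\<lambda>s. \<Sum>i\<in>I. c i * f i s) g = M (\<lambda>x. M (\<lambda>y. \<Sum>i\<in>I. c i * (f1 x * f2 y * f i (x + y) * g (x * y))))"
    unfolding L_def by (simp add: sum_distrib_left sum_distrib_right mult_ac)
  thus ?thesis unfolding mean_sum mean_mult_left L_def .
qed

lemma inverse_p_le_tau: "1 / real p \<le> tau"
  using p_gt_2 by (simp add: tau_def)

text \<open>\<open>f - sd f\<close> is bounded by 3 rather than 1, hence the factor 3. The error
  terms are folded into one condition on \<delta>.\<close>

lemma counting_sum_uniform_scaled:
  assumes f: "per p f" and g: "per p g"
    and b1: "\<And>x. cmod (f1 x) \<le> 1" and b2: "\<And>x. cmod (f2 x) \<le> 1"
    and bf: "\<And>x. cmod (f x) \<le> 3" and bg: "\<And>x. cmod (g x) \<le> 1"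
    and unif: "\<And>a b. cmod (M (\<lambda>s. f s * ph a b 0 s)) \<le> \<eta>"
    and \<delta>: "\<delta> \<ge> 0" "\<eta> + sqrt (5 * tau) + tau \<le> \<delta> ^ 4"
  shows "cmod (L f1 f2 f g) \<le> 3 * \<delta>"
proof -
  define h where "h s = (1 / 3) * f s" for s
  have \<eta>0: "\<eta> \<ge> 0" using unif[of 0 0] norm_ge_zero order.trans by blast
  have "cmod (L f1 f2 h g) ^ 4 \<le> sqrt (\<eta>\<^sup>2 + 5 / real p) + 1 / real p"
  proof (rule counting_sum_uniform)
    show "per p h" unfolding h_def by (rule perI) (simp add: perD[OF f])
    show "cmod (h x) \<le> 1" for x using bf[of x] by (simp add: h_def norm_mult)
    show "cmod (M (\<lambda>s. h s * ph a b 0 s)) \<le> \<eta>" for a b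
    proof -
      have "M (\<lambda>s. h s * ph a b 0 s) = (1 / 3) * M (\<lambda>s. f s * ph a b 0 s)"
        unfolding mean_mult_left[symmetric] h_def by (simp only: mult.assoc)
      hence "cmod (M (\<lambda>s. h s * ph a b 0 s)) = cmod (1 / 3) * cmod (M (\<lambda>s. f s * ph a b 0 s))"
        by (simp only: norm_mult)
      thus ?thesis using unif[of a b] \<eta>0 by simp
    qed
  qed (use g b1 b2 bg in auto)
  also have "sqrt (\<eta>\<^sup>2 + 5 / real p) \<le> sqrt (\<eta>\<^sup>2) + sqrt (5 / real p)"
    by (rule sqrt_add_le_add_sqrt) auto
  also have "sqrt (5 / real p) \<le> sqrt (5 * tau)" using inverse_p_le_tau by simp
  also have "1 / real p \<le> tau" by (rule inverse_p_le_tau)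
  finally have "cmod (L f1 f2 h g) ^ 4 \<le> \<eta> + sqrt (5 * tau) + tau" using \<eta>0 by simp
  also have "\<dots> \<le> \<delta> ^ 4" by (rule \<delta>)
  finally have "cmod (L f1 f2 h g) \<le> \<delta>"
    using \<delta>(1) by (metis norm_ge_zero not_le power_strict_mono zero_less_numeral)
  moreover have "L f1 f2 f g = 3 * L f1 f2 h g" unfolding h_def L_scale3 by simp
  ultimately show ?thesis by (simp add: norm_mult)
qed

end

context smoothing
begin

text \<open>\<open>b\<close> is the coefficient function of the constant kernel. A pure quadratic
  phase has trivial multiplicative frequency, so ignoring that coordinate loses nothing.\<close>

lemma smooth_additive_uniform:
  assumes b: "b = (\<lambda>\<kappa>. if int q dvd \<kappa> then 1 else 0)"
    and f: "\<And>x. cmod (f x) \<le> 1" and \<epsilon>: "0 \<le> \<epsilon>" "\<epsilon> \<le> 1" "3 * \<epsilon> \<le> \<eta>"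
    and h: "\<And>\<gamma>. \<gamma> \<in> Dual \<Longrightarrow> cmod (fc f \<gamma>) \<le> \<eta> \<or> ((1 - \<epsilon>) * a2 0 \<le> a2 (fst \<gamma>) \<and> (1 - \<epsilon>) * a1 0 \<le> a1 (fst (snd \<gamma>)))"
  shows "cmod (M (\<lambda>s. (f s - sd f s) * ph \<alpha> \<beta> 0 s)) \<le> \<eta> + tau * real C ^ 3"
proof -
  define \<gamma> where "\<gamma> = ((- \<alpha>) mod int p, (- \<beta>) mod int p, 0 :: int)"
  have \<gamma>: "\<gamma> \<in> Dual" using mod_Dual[of "- \<alpha>" "- \<beta>" 0] by (simp add: \<gamma>_def)
  have "cmod (fc f \<gamma>) \<le> \<eta> \<or> 1 - \<eta> \<le> mu \<gamma>"
    using h[OF \<gamma>]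
  proof
    assume a: "(1 - \<epsilon>) * a2 0 \<le> a2 (fst \<gamma>) \<and> (1 - \<epsilon>) * a1 0 \<le> a1 (fst (snd \<gamma>))"
    have "1 - 3 * \<epsilon> \<le> mu \<gamma>"
      by (rule mu_ge) (use a \<epsilon> in \<open>auto simp: \<gamma>_def b\<close>)
    thus ?thesis using \<epsilon> by simp
  qed simp
  thus ?thesis using fc_diff_sd[of f \<gamma> \<eta>] f \<gamma> by (simp add: mean_ph_fc \<gamma>_def)
qed

text \<open>The same with the quadratic coordinate ignored, since the test phases have quadratic
  frequency 0.\<close>

lemma smooth_multiplicative_uniform:
  assumes a2: "a2 = (\<lambda>\<kappa>. if int p dvd \<kappa> then 1 else 0)"
    and f: "\<And>x. cmod (f x) \<le> 1" and \<epsilon>: "0 \<le> \<epsilon>" "\<epsilon> \<le> 1" "3 * \<epsilon> \<le> \<eta>"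
    and h: "\<And>\<gamma>. \<gamma> \<in> Dual \<Longrightarrow> cmod (fc f \<gamma>) \<le> \<eta> \<or> ((1 - \<epsilon>) * a1 0 \<le> a1 (fst (snd \<gamma>)) \<and> (1 - \<epsilon>) * b 0 \<le> b (snd (snd \<gamma>)))"
  shows "cmod (M (\<lambda>s. (f s - sd f s) * ph 0 \<beta> \<kappa> s)) \<le> \<eta> + tau * real C ^ 3"
proof -
  define \<gamma> where "\<gamma> = (0 :: int, (- \<beta>) mod int p, (- \<kappa>) mod int q)"
  have \<gamma>: "\<gamma> \<in> Dual" using mod_Dual[of 0 "- \<beta>" "- \<kappa>"] by (simp add: \<gamma>_def)
  have "cmod (fc f \<gamma>) \<le> \<eta> \<or> 1 - \<eta> \<le> mu \<gamma>"
    using h[OF \<gamma>]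
  proof
    assume a: "(1 - \<epsilon>) * a1 0 \<le> a1 (fst (snd \<gamma>)) \<and> (1 - \<epsilon>) * b 0 \<le> b (snd (snd \<gamma>))"
    have "1 - 3 * \<epsilon> \<le> mu \<gamma>"
      by (rule mu_ge) (use a \<epsilon> in \<open>auto simp: \<gamma>_def a2\<close>)
    thus ?thesis using \<epsilon> by simp
  qed simp
  thus ?thesis using fc_diff_sd[of f \<gamma> \<eta>] f \<gamma> by (simp add: mean_ph_fc \<gamma>_def)
qed

lemma cmod_diff_sd_le:
  assumes f: "\<And>x. cmod (f x) \<le> 1" and t: "tau * real C ^ 3 \<le> 1"
  shows "cmod (f x - sd f x) \<le> 3"
proof -
  have "cmod (sd f x) \<le> 2" using cmod_sc_le[of f x "x\<^sup>2" "ind x"] f t unfolding sd_def by simp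
  thus ?thesis using f[of x] norm_triangle_ineq4[of "f x" "sd f x"] by simp
qed

text \<open>\<open>b\<close> kills all nontrivial multiplicative frequencies, so \<open>sd f\<close>
  is a combination of quadratic phases with total mass at most C^3, and
  \<open>counting_phase\<close> applies to each of them.\<close>

lemma counting_smooth_sum:
  assumes b: "b = (\<lambda>\<kappa>. if int q dvd \<kappa> then 1 else 0)"
    and f: "\<And>x. cmod (f x) \<le> 1" and g: "per p g"
    and b1: "\<And>x. cmod (f1 x) \<le> 1" and b2: "\<And>x. cmod (f2 x) \<le> 1" and bg: "\<And>x. cmod (g x) \<le> 1"
    and unif: "\<And>\<beta> \<kappa>. cmod (M (\<lambda>t. g t * ph 0 \<beta> \<kappa> t)) \<le> \<eta>"
  shows "cmod (L f1 f2 (sd f) g) \<le> real C ^ 3 * (\<eta> + 3 * tau)"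
proof -
  have "cmod (L f1 f2 (sd f) g) \<le> (\<Sum>\<gamma>\<in>Dual. mu \<gamma> * (\<eta> + 3 * tau))"
    unfolding sd_expand[abs_def] L_sum3
  proof (rule sum_norm_le)
    fix \<gamma> assume \<gamma>: "\<gamma> \<in> Dual"
    show "cmod (complex_of_real (mu \<gamma>) * fc f \<gamma> * L f1 f2 (phi \<gamma>) g) \<le> mu \<gamma> * (\<eta> + 3 * tau)"
    proof (cases "snd (snd \<gamma>) = 0")
      case True
      have "cmod (L f1 f2 (phi \<gamma>) g) \<le> \<eta> + 3 / real p"
        unfolding True by (rule counting_phase) (use g b1 b2 bg unif in auto)
      also have "\<dots> \<le> \<eta> + 3 * tau" using inverse_p_le_tau by simp
      finally have l: "cmod (L f1 f2 (phi \<gamma>) g) \<le> \<eta> + 3 * tau" .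
      have "cmod (complex_of_real (mu \<gamma>) * fc f \<gamma>) \<le> mu \<gamma>"
        using mu_nonneg[of \<gamma>] cmod_fc_le[of f 1 \<gamma>] f by (simp add: norm_mult mult_left_le)
      hence "cmod (complex_of_real (mu \<gamma>) * fc f \<gamma>) * cmod (L f1 f2 (phi \<gamma>) g) \<le> mu \<gamma> * (\<eta> + 3 * tau)"
        using l mu_nonneg by (intro mult_mono) auto
      thus ?thesis by (simp only: norm_mult)
    next
      case False
      hence "b (snd (snd \<gamma>)) = 0" using \<gamma> zdvd_imp_le[of "int q" "snd (snd \<gamma>)"] by (auto simp: b Dual_def)
      hence "mu \<gamma> = 0" by (simp add: mu_def)
      thus ?thesis by simp
    qed
  qed
  also have "\<dots> = (\<Sum>\<gamma>\<in>Dual. mu \<gamma>) * (\<eta> + 3 * tau)" by (rule sum_distrib_right[symmetric])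
  also have "\<dots> \<le> real C ^ 3 * (\<eta> + 3 * tau)"
  proof (rule mult_right_mono[OF sum_mu])
    have "\<eta> \<ge> 0" using unif[of 0 0] norm_ge_zero order.trans by blast
    thus "\<eta> + 3 * tau \<ge> 0" using tau_nonneg by simp
  qed
  finally show ?thesis .
qed

end

lemma kern_one_exists:
  assumes "N > 0" "C \<ge> 1"
  shows "kern N C (\<lambda>\<xi>. if int N dvd \<xi> then 1 else 0) (\<lambda>_. 1)"
proof -
  obtain a where a: "kern N 1 a (\<lambda>_. 1)" using kern_one[OF assms(1)] by blast
  have "a = (\<lambda>\<xi>. if int N dvd \<xi> then 1 else 0)" by (rule ext) (rule kern_one_coeff[OF a])
  thus ?thesis using kern_weaken[OF a assms(2)] by simp
qed

lemma small_parameter: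
  fixes \<eta> :: real
  assumes "\<eta> > 0"
  shows "\<exists>(d::nat) t. t > 0 \<and> (\<forall>\<tau>\<ge>0. \<tau> \<le> t \<longrightarrow> 1 + (real d)\<^sup>2 * \<tau> < real d * \<eta>\<^sup>2)"
proof -
  obtain d :: nat where d: "real d > 2 / \<eta>\<^sup>2" using reals_Archimedean2 by blast
  hence d2: "2 < real d * \<eta>\<^sup>2" using assms by (simp add: field_simps)
  have d0: "real d > 0" using d assms by (smt (verit) divide_pos_pos zero_less_power)
  show ?thesis
  proof (intro exI[of _ d] exI[of _ "1 / (real d)\<^sup>2"] conjI allI impI)
    fix \<tau> :: real assume "\<tau> \<ge> 0" "\<tau> \<le> 1 / (real d)\<^sup>2"
    hence "(real d)\<^sup>2 * \<tau> \<le> 1" using d0 by (simp add: field_simps)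
    thus "1 + (real d)\<^sup>2 * \<tau> < real d * \<eta>\<^sup>2" using d2 by simp
  qed (use d0 in simp)
qed

lemma sqrt_small: assumes "e > 0" "0 \<le> \<tau>" "\<tau> \<le> e\<^sup>2 / 5" shows "sqrt (5 * \<tau>) \<le> e"
  by (rule real_le_lsqrt) (use assms in auto)

text \<open>Split f into \<open>f - sd f\<close>, which is uniform itself, and \<open>sd f\<close>,
  against which the uniformity of g is used. The complexity of the kernel for f depends on
  \<epsilon> only, so the threshold for g can be fixed after it. All constants precede p, so the
  statement has to live outside the locale.\<close>

lemma counting_product_uniform:
  fixes \<epsilon> :: real
  assumes \<epsilon>: "\<epsilon> > 0"
  shows "\<exists>\<eta>>0. \<exists>t>0. \<forall>p. prime_modulus p \<longrightarrow> prime_modulus.tau p \<le> t \<longrightarrow>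
    (\<forall>f1 f2 f g. per p f \<longrightarrow> per p g \<longrightarrow> (\<forall>x. cmod (f1 x) \<le> 1 \<and> cmod (f2 x) \<le> 1 \<and> cmod (f x) \<le> 1 \<and> cmod (g x) \<le> 1) \<longrightarrow>
      (\<forall>\<beta> \<kappa>. cmod (mean (Z p) (\<lambda>t. g t * prime_modulus.ph p 0 \<beta> \<kappa> t)) \<le> \<eta>) \<longrightarrow>
      cmod (prime_modulus.L p f1 f2 f g) \<le> \<epsilon>)"
proof -
  define \<delta> where "\<delta> = \<epsilon> / 9"
  have \<delta>: "\<delta> > 0" using \<epsilon> by (simp add: \<delta>_def)
  \<comment> \<open>A quarter, because \<eta>, \<open>tau * real C ^ 3\<close>,
    \<open>sqrt (5 * tau)\<close> and \<open>tau\<close> are each made at most \<eta> and must sum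
    to at most \<delta>^4.\<close>
  define \<eta> where "\<eta> = \<delta> ^ 4 / 4"
  have \<eta>: "\<eta> > 0" using \<delta> by (simp add: \<eta>_def)
  define e where "e = min 1 (\<eta> / 3)"
  have e: "e > 0" "e \<le> 1" "3 * e \<le> \<eta>" using \<eta> by (auto simp: e_def)
  obtain d t1 where t1: "t1 > 0" "\<And>\<tau>. \<tau> \<ge> 0 \<Longrightarrow> \<tau> \<le> t1 \<Longrightarrow> 1 + (real d)\<^sup>2 * \<tau> < real d * \<eta>\<^sup>2"
    using small_parameter[OF \<eta>] by blast
  obtain C0 where C0: "\<forall>N \<Theta>. N > 0 \<longrightarrow> finite \<Theta> \<longrightarrow> card \<Theta> \<le> 2 * (1 * d) \<longrightarrow>
     (\<exists>a H. kern N C0 a H \<and> (\<forall>\<theta>\<in>\<Theta>. (1 - e) * a 0 \<le> a \<theta>))"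
    using exists_kernel[OF e(1)] by blast
  define C where "C = max C0 1"
  have C: "real C ^ 3 \<ge> 1" by (simp add: C_def one_le_power)
  hence C': "real C ^ 3 > 0" by linarith
  \<comment> \<open>Makes C^3 \<eta>' equal to \<epsilon>/3; the other two thirds go to 3\<delta>
    and to the term with \<open>tau\<close>.\<close>
  define \<eta>' where "\<eta>' = \<epsilon> / (3 * real C ^ 3)"
  have \<eta>': "\<eta>' > 0" using \<epsilon> C' by (simp add: \<eta>'_def)
  define t where "t = Min {t1, 1 / real C ^ 3, \<eta> / real C ^ 3, \<eta>\<^sup>2 / 5, \<eta>, \<epsilon> / (9 * real C ^ 3)}"
  have t: "t \<le> t1" "t \<le> 1 / real C ^ 3" "t \<le> \<eta> / real C ^ 3" "t \<le> \<eta>\<^sup>2 / 5" "t \<le> \<eta>" "t \<le> \<epsilon> / (9 * real C ^ 3)"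
    unfolding t_def by (intro Min_le; simp)+
  have t0: "t > 0" unfolding t_def using t1 \<eta> \<epsilon> C' by (subst Min_gr_iff) auto
  show ?thesis
  proof (rule exI[of _ \<eta>'], rule conjI[OF \<eta>'], rule exI[of _ t], rule conjI[OF t0], intro allI impI)
    fix p f1 f2 f g
    assume pm: "prime_modulus p" and tau: "prime_modulus.tau p \<le> t" and f: "per p f" and g: "per p g"
      and bd: "\<forall>x. cmod (f1 x) \<le> 1 \<and> cmod (f2 x) \<le> 1 \<and> cmod (f x) \<le> 1 \<and> cmod (g x) \<le> (1::real)"
      and unif: "\<forall>\<beta> \<kappa>. cmod (mean (Z p) (\<lambda>t. g t * prime_modulus.ph p 0 \<beta> \<kappa> t)) \<le> \<eta>'"
    interpret prime_modulus p by (rule pm)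
    have hC: "\<exists>a H. kern N C a H \<and> (\<forall>\<theta>\<in>\<Theta>. (1 - e) * a 0 \<le> a \<theta>)" if "N > 0" "finite \<Theta>" "card \<Theta> \<le> 2 * (1 * d)" for N \<Theta>
    proof -
      obtain a H where "kern N C0 a H" "\<forall>\<theta>\<in>\<Theta>. (1 - e) * a 0 \<le> a \<theta>" using C0 \<open>N > 0\<close> \<open>finite \<Theta>\<close> \<open>card \<Theta> \<le> 2 * (1 * d)\<close> by blast
      moreover have "C0 \<le> C" by (simp add: C_def)
      ultimately show ?thesis using kern_weaken by blast
    qed
    have tau1: "tau \<le> t" by (rule tau)
    obtain a H where aH: "kern p C a H" and sp: "\<And>\<gamma>. \<gamma> \<in> Dual \<Longrightarrow> cmod (fc f \<gamma>) \<le> \<eta> \<or> ((1 - e) * a 0 \<le> a (fst \<gamma>) \<and> (1 - e) * a 0 \<le> a (fst (snd \<gamma>)))"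
    proof -
      have "1 + (real d)\<^sup>2 * tau < real d * \<eta>\<^sup>2" using t1(2) tau1 t(1) tau_nonneg by simp
      hence "\<exists>a H b P. kern p C a H \<and> kern q C b P \<and> (\<forall>i\<in>{()}. \<forall>\<gamma>\<in>Dual. cmod (fc f \<gamma>) \<le> \<eta> \<or>
        ((1 - e) * a 0 \<le> a (fst \<gamma>) \<and> (1 - e) * a 0 \<le> a (fst (snd \<gamma>)) \<and> (1 - e) * b 0 \<le> b (snd (snd \<gamma>))))"
        using \<eta> bd by (intro exists_joint_kernel[where n = 1 and d = d and f = "\<lambda>_. f"] hC) auto
      thus ?thesis using that by blast
    qed
    define b where "b = (\<lambda>\<kappa>. if int q dvd \<kappa> then 1 else 0 :: real)"
    have kb: "kern q C b (\<lambda>_. 1)" unfolding b_def by (rule kern_one_exists[OF q_pos]) (simp add: C_def)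
    interpret smoothing p C a H a H b "\<lambda>_. 1"
      by unfold_locales (use aH kb in auto)
    have tc: "tau * real C ^ 3 \<le> 1" "tau * real C ^ 3 \<le> \<eta>" "3 * (real C ^ 3 * tau) \<le> \<epsilon> / 3"
    proof -
      have "tau \<le> 1 / real C ^ 3" "tau \<le> \<eta> / real C ^ 3" "tau \<le> \<epsilon> / (9 * real C ^ 3)"
        using tau1 t by linarith+
      thus "tau * real C ^ 3 \<le> 1" "tau * real C ^ 3 \<le> \<eta>" "3 * (real C ^ 3 * tau) \<le> \<epsilon> / 3"
        using C' by (simp_all add: field_simps)
    qed
    have ts: "sqrt (5 * tau) \<le> \<eta>" using tau1 t by (intro sqrt_small \<eta> tau_nonneg) simp
    have "cmod (L f1 f2 (\<lambda>s. f s - sd f s) g) \<le> 3 * \<delta>"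
    proof (rule counting_sum_uniform_scaled)
      show "per p (\<lambda>s. f s - sd f s)"
        by (rule perI) (simp add: perD[OF f] perD[OF per_sd])
      show "cmod (f x - sd f x) \<le> 3" for x by (rule cmod_diff_sd_le) (use bd tc in auto)
      show "cmod (M (\<lambda>s. (f s - sd f s) * ph \<alpha> \<beta> 0 s)) \<le> \<eta> + tau * real C ^ 3" for \<alpha> \<beta>
        by (rule smooth_additive_uniform[OF b_def, where \<epsilon> = e]) (use bd e sp in auto)
      show "\<eta> + tau * real C ^ 3 + sqrt (5 * tau) + tau \<le> \<delta> ^ 4"
        using tc ts tau1 t by (simp add: \<eta>_def)
    qed (use g bd \<delta> in auto)
    moreover have "cmod (L f1 f2 (sd f) g) \<le> real C ^ 3 * (\<eta>' + 3 * tau)"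
      by (rule counting_smooth_sum[OF b_def]) (use g bd unif in auto)
    moreover have "real C ^ 3 * (\<eta>' + 3 * tau) \<le> 2 * \<epsilon> / 3"
    proof -
      have "real C ^ 3 * \<eta>' = \<epsilon> / 3" using C' by (simp add: \<eta>'_def)
      thus ?thesis using tc by (simp add: distrib_left)
    qed
    moreover have "L f1 f2 f g = L f1 f2 (\<lambda>s. f s - sd f s) g + L f1 f2 (sd f) g"
      unfolding L_add3[symmetric] by simp
    moreover have "3 * \<delta> = \<epsilon> / 3" by (simp add: \<delta>_def)
    ultimately show "cmod (L f1 f2 f g) \<le> \<epsilon>"
      using norm_triangle_ineq[of "L f1 f2 (\<lambda>s. f s - sd f s) g" "L f1 f2 (sd f) g"] by simp
  qed
qed

section \<open>Ramsey argument for positions\<close>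

text \<open>Replacing one entry of a uniform random sequence by an independent uniform value
  preserves expectations. All independence below is used in this form.\<close>

lemma mean_PiE_resample:
  fixes F :: "(nat \<Rightarrow> int) \<Rightarrow> real"
  assumes I: "finite I" "j \<in> I" and N: "N > 0"
  shows "mean (PiE I (\<lambda>_. Z N)) F = mean (PiE I (\<lambda>_. Z N)) (\<lambda>V. mean (Z N) (\<lambda>a. F (V(j := a))))"
proof -
  define J where "J = I - {j}"
  have J: "I = insert j J" "j \<notin> J" using I by (auto simp: J_def)
  have s: "(\<Sum>V\<in>PiE I (\<lambda>_. Z N). G V) = (\<Sum>b\<in>Z N. \<Sum>V\<in>PiE J (\<lambda>_. Z N). G (V(j := b)))" for G :: "(nat \<Rightarrow> int) \<Rightarrow> real"
  proof -
    have "(\<Sum>V\<in>PiE I (\<lambda>_. Z N). G V) = (\<Sum>x\<in>Z N \<times> PiE J (\<lambda>_. Z N). G ((\<lambda>(y, g). g(j := y)) x))"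
      unfolding J(1) PiE_insert_eq
      by (subst sum.reindex[OF inj_combinator[OF J(2)]]) (simp add: comp_def)
    thus ?thesis by (simp add: sum.cartesian_product' split_def)
  qed
  have "(\<Sum>V\<in>PiE I (\<lambda>_. Z N). \<Sum>a\<in>Z N. F (V(j := a))) = (\<Sum>b\<in>Z N. \<Sum>V\<in>PiE J (\<lambda>_. Z N). \<Sum>a\<in>Z N. F (V(j := a)))"
    unfolding s by (simp only: fun_upd_upd)
  also have "\<dots> = real N * (\<Sum>V\<in>PiE J (\<lambda>_. Z N). \<Sum>a\<in>Z N. F (V(j := a)))" by simp
  also have "(\<Sum>V\<in>PiE J (\<lambda>_. Z N). \<Sum>a\<in>Z N. F (V(j := a))) = (\<Sum>V\<in>PiE I (\<lambda>_. Z N). F V)"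
    unfolding s by (rule sum.swap)
  finally have "(\<Sum>V\<in>PiE I (\<lambda>_. Z N). \<Sum>a\<in>Z N. F (V(j := a))) = real N * (\<Sum>V\<in>PiE I (\<lambda>_. Z N). F V)" .
  thus ?thesis using N by (simp add: mean_def sum_distrib_left[symmetric])
qed

abbreviation Fn :: "nat \<Rightarrow> nat \<Rightarrow> (nat \<Rightarrow> int) set" where "Fn n N \<equiv> PiE {..<n} (\<lambda>_. Z N)"

lemma Fn_finite_ne: "N > 0 \<Longrightarrow> finite (Fn n N) \<and> Fn n N \<noteq> {}"
  by (auto intro!: finite_PiE simp: PiE_eq_empty_iff)

lemma mean_Fn_const: "N > 0 \<Longrightarrow> mean (Fn n N) (\<lambda>_. c) = c"
  using Fn_finite_ne[of N n] by (intro mean_const) auto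

lemma mean_diff1:
  fixes g :: "int \<Rightarrow> real"
  assumes N: "N > 0" and g: "per N g" and i: "i < j" "j < n"
  shows "mean (Fn n N) (\<lambda>V. g (V j - V i)) = mean (Z N) g"
proof -
  have "mean (Fn n N) (\<lambda>V. g (V j - V i)) = mean (Fn n N) (\<lambda>V. mean (Z N) (\<lambda>a. g (a + - V i)))"
    using i by (subst mean_PiE_resample[of _ j]) (use N in auto)
  also have "\<dots> = mean (Fn n N) (\<lambda>V. mean (Z N) g)" by (simp only: mean_Z_shift[OF N g])
  also have "\<dots> = mean (Z N) g" by (rule mean_Fn_const[OF N])
  finally show ?thesis .
qed

text \<open>Two differences sharing the index j are still independent: resampling the largest index
  makes the last difference uniform whatever the others are.\<close>

lemma mean_diff2:
  fixes g :: "int \<Rightarrow> int \<Rightarrow> real"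
  assumes N: "N > 0" and g1: "\<And>b. per N (\<lambda>a. g a b)" and g2: "\<And>a. per N (g a)" and i: "i < j" "j < k" "k < n"
  shows "mean (Fn n N) (\<lambda>V. g (V j - V i) (V k - V j)) = mean (Z N) (\<lambda>a. mean (Z N) (g a))"
proof -
  have "mean (Fn n N) (\<lambda>V. g (V j - V i) (V k - V j)) = mean (Fn n N) (\<lambda>V. mean (Z N) (\<lambda>a. g (V j - V i) (a + - V j)))"
    using i by (subst mean_PiE_resample[of _ k]) (use N in auto)
  also have "\<dots> = mean (Fn n N) (\<lambda>V. mean (Z N) (g (V j - V i)))" by (simp only: mean_Z_shift[OF N g2])
  also have "\<dots> = mean (Z N) (\<lambda>a. mean (Z N) (g a))"
    by (rule mean_diff1[OF N]) (use i in \<open>auto intro!: perI mean_cong dest: perD[OF g1]\<close>)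
  finally show ?thesis .
qed

lemma mean_diff3:
  fixes g :: "int \<Rightarrow> int \<Rightarrow> int \<Rightarrow> real"
  assumes N: "N > 0" and g1: "\<And>b c. per N (\<lambda>a. g a b c)" and g2: "\<And>a c. per N (\<lambda>b. g a b c)" and g3: "\<And>a b. per N (g a b)"
    and i: "i < j" "j < k" "k < l" "l < m" "m < n"
  shows "mean (Fn n N) (\<lambda>V. g (V j - V i) (V k - V j) (V m - V l)) = mean (Z N) (\<lambda>a. mean (Z N) (\<lambda>b. mean (Z N) (g a b)))"
proof -
  have "mean (Fn n N) (\<lambda>V. g (V j - V i) (V k - V j) (V m - V l)) = mean (Fn n N) (\<lambda>V. mean (Z N) (\<lambda>a. g (V j - V i) (V k - V j) (a + - V l)))"
    using i by (subst mean_PiE_resample[of _ m]) (use N in auto)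
  also have "\<dots> = mean (Fn n N) (\<lambda>V. mean (Z N) (g (V j - V i) (V k - V j)))" by (simp only: mean_Z_shift[OF N g3])
  also have "\<dots> = mean (Z N) (\<lambda>a. mean (Z N) (\<lambda>b. mean (Z N) (g a b)))"
    by (rule mean_diff2[OF N]) (use i in \<open>auto intro!: perI mean_cong dest: perD[OF g1] perD[OF g2]\<close>)
  finally show ?thesis .
qed

text \<open>Converts an index pattern inside a large set into the increasing enumeration of the
  corresponding subset, from which its position is read.\<close>

lemma sorted_list_of_nth_set:
  fixes h :: "nat list"
  assumes h: "sorted_wrt (<) h" and js: "sorted_wrt (<) js" "\<And>j. j \<in> set js \<Longrightarrow> j < length h"
  shows "sorted_list_of_set (nth h ` set js) = map (nth h) js"
proof -
  have "sorted_wrt (<) (map (nth h) js)"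
    unfolding sorted_wrt_map
    by (rule sorted_wrt_mono_rel[OF _ js(1)]) (use h js(2) in \<open>auto simp: sorted_wrt_nth_less\<close>)
  hence "sorted_list_of_set (set (map (nth h) js)) = map (nth h) js"
    by (intro sorted_list_of_set.idem_if_sorted_distinct) (auto simp: strict_sorted_iff)
  thus ?thesis by simp
qed

lemma card_nth_image:
  fixes h :: "nat list"
  assumes h: "sorted_wrt (<) h" and js: "sorted_wrt (<) js" "\<And>j. j \<in> set js \<Longrightarrow> j < length h"
  shows "card (nth h ` set js) = length js"
proof -
  have "finite (nth h ` set js)" by simp
  hence "length (sorted_list_of_set (nth h ` set js)) = card (nth h ` set js)" by simp
  thus ?thesis by (simp add: sorted_list_of_nth_set[OF assms])
qed

text \<open>A concerns the positions of the factors, B that of their sum, G that of their product.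
  Random sequences V and Q modulo p and U modulo q give every 6-subset of an index set a uniform
  position. If none of these is bad, each 6-subset is coloured by some i good at its position, and
  Ramsey's theorem gives a 12-set with all 6-subsets of one colour. Four of them form a
  configuration, and taking expectations bounds the density of configurations from below.\<close>

lemma ramsey_positions:
  fixes r :: nat
  shows "\<exists>\<beta>>(0::real). \<exists>c>0. \<forall>p q A B G. p > 0 \<longrightarrow> q > 0 \<longrightarrow>
     (\<forall>i v v' w w' u u'. [v = v'] (mod int p) \<longrightarrow> [w = w'] (mod int p) \<longrightarrow> [u = u'] (mod int q) \<longrightarrow>
         A i v w u = A i v' w' u' \<and> B i v w = B i v' w' \<and> G i v u = G i v' u') \<longrightarrow>
     mean (Z p) (\<lambda>v. mean (Z p) (\<lambda>w. mean (Z q) (\<lambda>u. of_bool (\<not> (\<exists>i<r. A i v w u \<and> B i v w \<and> G i v u))))) \<le> \<beta> \<longrightarrow>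
     (c::real) \<le> (\<Sum>i<r. mean (Z p) (\<lambda>v. mean (Z p) (\<lambda>v'. mean (Z p) (\<lambda>D. mean (Z p) (\<lambda>w. mean (Z p) (\<lambda>w'.
        mean (Z q) (\<lambda>u. mean (Z q) (\<lambda>u'. of_bool (A i v w u \<and> A i v' w' u' \<and> B i (v + v') (w + w' + 2 * D) \<and> G i D (u + u'))))))))))"
proof -
  obtain n :: nat where n: "partn_lst {..<n} (replicate r 12) 6" using ramsey_full by blast
  define S6 where "S6 = nsets {..<n} 6"
  define S12 where "S12 = nsets {..<n} 12"
  have fin: "finite S6" "finite S12" by (simp_all add: S6_def S12_def finite_imp_finite_nsets)
  \<comment> \<open>By the union bound the expected number of bad 6-subsets is at most 1/2; the
    remaining 1/2 is shared among the 12-subsets, which gives c.\<close>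
  define \<beta> where "\<beta> = 1 / (2 * (real (card S6) + 1))"
  define c where "c = 1 / (2 * (real (card S12) + 1))"
  have pos: "\<beta> > 0" "c > 0" by (simp_all add: \<beta>_def c_def)
  show ?thesis
  proof (rule exI[of _ \<beta>], rule conjI[OF pos(1)], rule exI[of _ c], rule conjI[OF pos(2)], intro allI impI)
    fix p q :: nat and A :: "nat \<Rightarrow> int \<Rightarrow> int \<Rightarrow> int \<Rightarrow> bool" and B G :: "nat \<Rightarrow> int \<Rightarrow> int \<Rightarrow> bool"
    assume p: "p > 0" and q: "q > 0"
      and per: "\<forall>i v v' w w' u u'. [v = v'] (mod int p) \<longrightarrow> [w = w'] (mod int p) \<longrightarrow> [u = u'] (mod int q) \<longrightarrow>
         A i v w u = A i v' w' u' \<and> B i v w = B i v' w' \<and> G i v u = G i v' u'"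
    have A: "A i v w u = A i v' w' u'" if "[v = v'] (mod int p)" "[w = w'] (mod int p)" "[u = u'] (mod int q)" for i v v' w w' u u'
      using per that by blast
    have B: "B i v w = B i v' w'" if "[v = v'] (mod int p)" "[w = w'] (mod int p)" for i v v' w w'
      using per that cong_refl by blast
    have G: "G i v u = G i v' u'" if "[v = v'] (mod int p)" "[u = u'] (mod int q)" for i v v' u u'
      using per that cong_refl by blast
    define bad where "bad v w u = (\<not> (\<exists>i<r. A i v w u \<and> B i v w \<and> G i v u))" for v w u
    define cfg where "cfg i v v' D w w' u u' = (A i v w u \<and> A i v' w' u' \<and> B i (v + v') (w + w' + 2 * D) \<and> G i D (u + u'))" for i v v' D w w' u u'
    assume "mean (Z p) (\<lambda>v. mean (Z p) (\<lambda>w. mean (Z q) (\<lambda>u. of_bool (\<not> (\<exists>i<r. A i v w u \<and> B i v w \<and> G i v u))))) \<le> \<beta>"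
    hence hyp: "mean (Z p) (\<lambda>v. mean (Z p) (\<lambda>w. mean (Z q) (\<lambda>u. of_bool (bad v w u)))) \<le> \<beta>" by (simp only: bad_def)
    define X where "X i = mean (Z p) (\<lambda>v. mean (Z p) (\<lambda>v'. mean (Z p) (\<lambda>D. mean (Z p) (\<lambda>w. mean (Z p) (\<lambda>w'.
        mean (Z q) (\<lambda>u. mean (Z q) (\<lambda>u'. of_bool (cfg i v v' D w w' u u') :: real)))))))" for i
    define tv where "tv l V = (V (l ! 1) - V (l ! 0) :: int)" for l :: "nat list" and V
    \<comment> \<open>Q makes the quadratic coordinate uniform. The term in V is needed since this
      coordinate is additive only up to 2D: its V-differences telescope up to one link, and that
      link is D, the linear coordinate of the product.\<close>
    define tw where "tw l V Q = (Q (l ! 1) - Q (l ! 0) + 2 * (V (l ! 3) - V (l ! 2)) :: int)" for l :: "nat list" and V Q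
    define tu where "tu l U = (U (l ! 5) - U (l ! 4) :: int)" for l :: "nat list" and U
    define badS where "badS S V Q U = bad (tv (sorted_list_of_set S) V) (tw (sorted_list_of_set S) V Q) (tu (sorted_list_of_set S) U)" for S V Q U
    define cfgT where "cfgT i T V Q U = (let h = sorted_list_of_set T in
       cfg i (V (h!1) - V (h!0)) (V (h!2) - V (h!1)) (V (h!6) - V (h!5))
         (Q (h!1) - Q (h!0) + 2 * (V (h!4) - V (h!3))) (Q (h!2) - Q (h!1) + 2 * (V (h!5) - V (h!4)))
         (U (h!10) - U (h!9)) (U (h!11) - U (h!10)))" for i T and V Q U :: "nat \<Rightarrow> int"
    \<comment> \<open>Pointwise dichotomy: some 6-subset has a bad position, or some 12-subset
      carries a configuration.\<close>
    have one: "1 \<le> (\<Sum>S\<in>S6. of_bool (badS S V Q U) :: real) + (\<Sum>T\<in>S12. \<Sum>i<r. of_bool (cfgT i T V Q U))" for V Q U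
    proof (cases "\<exists>S\<in>S6. badS S V Q U")
      case True
      then obtain S where S: "S \<in> S6" "badS S V Q U" by blast
      have "1 \<le> (\<Sum>S\<in>S6. of_bool (badS S V Q U) :: real)"
        using member_le_sum[of S S6 "\<lambda>S. of_bool (badS S V Q U) :: real"] S fin by simp
      moreover have "0 \<le> (\<Sum>T\<in>S12. \<Sum>i<r. of_bool (cfgT i T V Q U) :: real)" by (intro sum_nonneg) simp
      ultimately show ?thesis by linarith
    next
      case False
      define gd where "gd l i = (i < r \<and> A i (tv l V) (tw l V Q) (tu l U) \<and> B i (tv l V) (tw l V Q) \<and> G i (tv l V) (tu l U))" for l i
      define good where "good S i = gd (sorted_list_of_set S) i" for S i
      define col where "col S = (SOME i. good S i)" for S
      have col: "good S (col S)" if "S \<in> S6" for S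
      proof -
        have "\<exists>i. good S i" using False that unfolding badS_def bad_def good_def gd_def by blast
        thus ?thesis unfolding col_def by (rule someI_ex)
      qed
      have "col \<in> nsets {..<n} 6 \<rightarrow> {..<length (replicate r (12::nat))}"
        using col by (auto simp: S6_def good_def gd_def)
      then obtain i where i: "i < length (replicate r (12::nat))" "monochromatic {..<n} (replicate r 12 ! i) 6 col i"
        using n unfolding partn_lst_def by blast
      hence "i < r" by simp
      with i obtain T where T: "T \<in> S12" "col ` nsets T 6 \<subseteq> {i}"
        unfolding monochromatic_def S12_def by auto
      have T': "T \<subseteq> {..<n}" "finite T" "card T = 12" using T(1) by (auto simp: S12_def nsets_def)
      define h where "h = sorted_list_of_set T"
      have h: "sorted_wrt (<) h" "length h = 12" "set h = T"
        using T' by (simp_all add: h_def)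
      have sub: "gd (map (nth h) js) i" if js: "sorted_wrt (<) js" "set js \<subseteq> {..<12}" "length js = 6" for js
      proof -
        have js': "\<And>j. j \<in> set js \<Longrightarrow> j < length h" using js(2) h by auto
        have "nth h ` set js \<subseteq> T" using js' h by (auto intro: nth_mem)
        moreover have "card (nth h ` set js) = 6" using card_nth_image[OF h(1) js(1) js'] js by simp
        ultimately have n6: "nth h ` set js \<in> nsets T 6" by (simp add: nsets_def)
        hence "nth h ` set js \<in> S6" using T' by (auto simp: S6_def nsets_def)
        from col[OF this] have "good (nth h ` set js) i" using T(2) n6 by auto
        moreover have "sorted_list_of_set (nth h ` set js) = map (nth h) js"
          by (rule sorted_list_of_nth_set[OF h(1) js(1)]) (rule js')
        ultimately show ?thesis by (simp only: good_def)
      qed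
      \<comment> \<open>The index sets are chosen so that the third position is the sum of the first two, up to
        \<open>2 * (V (h!6) - V (h!5))\<close> in the quadratic coordinate, and the fourth is the product.\<close>
      have sx: "gd (map (nth h) [0,1,3,4,9,10]) i" and sy: "gd (map (nth h) [1,2,4,5,10,11]) i"
        and ss: "gd (map (nth h) [0,2,3,6,9,10]) i" and st: "gd (map (nth h) [5,6,7,8,9,11]) i"
        by (rule sub; simp)+
      have "A i (V (h!1) - V (h!0)) (Q (h!1) - Q (h!0) + 2 * (V (h!4) - V (h!3))) (U (h!10) - U (h!9))"
        using sx by (simp add: gd_def tv_def tw_def tu_def)
      moreover have "A i (V (h!2) - V (h!1)) (Q (h!2) - Q (h!1) + 2 * (V (h!5) - V (h!4))) (U (h!11) - U (h!10))"
        using sy by (simp add: gd_def tv_def tw_def tu_def)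
      moreover have "B i (V (h!2) - V (h!0)) (Q (h!2) - Q (h!0) + 2 * (V (h!6) - V (h!3)))"
        using ss by (simp add: gd_def tv_def tw_def tu_def)
      moreover have "G i (V (h!6) - V (h!5)) (U (h!11) - U (h!9))"
        using st by (simp add: gd_def tv_def tw_def tu_def)
      ultimately have "cfgT i T V Q U"
        by (simp add: cfgT_def cfg_def h_def[symmetric] Let_def algebra_simps)
      hence "1 \<le> (\<Sum>i<r. of_bool (cfgT i T V Q U) :: real)"
        using member_le_sum[of i "{..<r}" "\<lambda>i. of_bool (cfgT i T V Q U) :: real"] \<open>i < r\<close> by simp
      also have "\<dots> \<le> (\<Sum>T\<in>S12. \<Sum>i<r. of_bool (cfgT i T V Q U))"
        by (rule member_le_sum[OF T(1)]) (auto intro: sum_nonneg fin)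
      finally show ?thesis by (simp add: sum_nonneg add_increasing)
    qed
    let ?E = "\<lambda>F. mean (Fn n p) (\<lambda>V. mean (Fn n p) (\<lambda>Q. mean (Fn n q) (\<lambda>U. F V Q U :: real)))"
    have E1: "?E (\<lambda>V Q U. of_bool (badS S V Q U)) \<le> \<beta>" if S: "S \<in> S6" for S
    proof -
      define l where "l = sorted_list_of_set S"
      have S': "S \<subseteq> {..<n}" "finite S" "card S = 6" using S by (auto simp: S6_def nsets_def)
      have l: "sorted_wrt (<) l" "length l = 6" "set l = S" using S' by (simp_all add: l_def)
      have lt: "l ! i < l ! j" if "i < j" "j < 6" for i j using l that by (simp add: sorted_wrt_nth_less)
      have ln: "l ! i < n" if "i < 6" for i using l that S' nth_mem[of i l] by auto
      have bc: "bad v w u = bad v' w' u'" if "[v = v'] (mod int p)" "[w = w'] (mod int p)" "[u = u'] (mod int q)" for v w u v' w' u'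
        unfolding bad_def using A[OF that] B[OF that(1,2)] G[OF that(1,3)] by simp
      \<comment> \<open>U is averaged out first, then Q, then V. By the time V is averaged, its
        contribution to the quadratic coordinate has been absorbed by translation invariance in
        Q.\<close>
      have "?E (\<lambda>V Q U. of_bool (badS S V Q U)) = mean (Fn n p) (\<lambda>V. mean (Fn n p) (\<lambda>Q. mean (Z q) (\<lambda>u. of_bool (bad (tv l V) (tw l V Q) u))))"
        unfolding badS_def l_def[symmetric] tu_def
        by (intro mean_cong mean_diff1 q perI arg_cong[where f = of_bool] bc cong_refl lt ln) auto
      also have "\<dots> = mean (Fn n p) (\<lambda>V. mean (Z p) (\<lambda>w. mean (Z q) (\<lambda>u. of_bool (bad (tv l V) (w + 2 * (V (l ! 3) - V (l ! 2))) u))))"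
        unfolding tw_def
        by (intro mean_cong mean_diff1[where g = "\<lambda>w. mean (Z q) (\<lambda>u. of_bool (bad (tv l _) (w + 2 * (_ (l ! 3) - _ (l ! 2))) u))"]
             p perI arg_cong[where f = of_bool] bc cong_refl cong_add lt ln) auto
      also have "\<dots> = mean (Fn n p) (\<lambda>V. mean (Z p) (\<lambda>w. mean (Z q) (\<lambda>u. of_bool (bad (tv l V) w u))))"
        by (intro mean_cong mean_Z_shift[where f = "\<lambda>w. mean (Z q) (\<lambda>u. of_bool (bad (tv l _) w u))"]
             p perI arg_cong[where f = of_bool] bc cong_refl)
      also have "\<dots> = mean (Z p) (\<lambda>v. mean (Z p) (\<lambda>w. mean (Z q) (\<lambda>u. of_bool (bad v w u))))"
        unfolding tv_def
        by (intro mean_diff1[where g = "\<lambda>v. mean (Z p) (\<lambda>w. mean (Z q) (\<lambda>u. of_bool (bad v w u)))"]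
             mean_cong p perI arg_cong[where f = of_bool] bc cong_refl lt ln) auto
      finally show ?thesis using hyp by simp
    qed
    \<comment> \<open>Within each sequence the differences used are consecutive or disjoint, hence
      independent and uniform; the V-dependent shifts of the Q-differences are again
      absorbed.\<close>
    have E2: "?E (\<lambda>V Q U. of_bool (cfgT i T V Q U)) = X i" if T: "T \<in> S12" for T i
    proof -
      define h where "h = sorted_list_of_set T"
      have T': "T \<subseteq> {..<n}" "finite T" "card T = 12" using T by (auto simp: S12_def nsets_def)
      have h: "sorted_wrt (<) h" "length h = 12" "set h = T" using T' by (simp_all add: h_def)
      have lt: "h ! i < h ! j" if "i < j" "j < 12" for i j using h that by (simp add: sorted_wrt_nth_less)
      have hn: "h ! i < n" if "i < 12" for i using h that T' nth_mem[of i h] by auto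
      have cc: "cfg i v v' D w w' u u' = cfg i v1 v1' D1 w1 w1' u1 u1'"
        if "[v = v1] (mod int p)" "[v' = v1'] (mod int p)" "[D = D1] (mod int p)" "[w = w1] (mod int p)" "[w' = w1'] (mod int p)"
          "[u = u1] (mod int q)" "[u' = u1'] (mod int q)" for v v' D w w' u u' v1 v1' D1 w1 w1' u1 u1'
        unfolding cfg_def
        using A[OF that(1,4,6)] A[OF that(2,5,7)]
          B[OF cong_add[OF that(1,2)] cong_add[OF cong_add[OF that(4,5)] cong_mult[OF cong_refl that(3)]]]
          G[OF that(3) cong_add[OF that(6,7)]] by simp
      have st1: "mean (Fn n q) (\<lambda>U. of_bool (cfg i v v' D w w' (U (h!10) - U (h!9)) (U (h!11) - U (h!10))) :: real)
         = mean (Z q) (\<lambda>u. mean (Z q) (\<lambda>u'. of_bool (cfg i v v' D w w' u u')))" for v v' D w w'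
        by (rule mean_diff2[where g = "\<lambda>u u'. of_bool (cfg i v v' D w w' u u')"])
           (intro q perI arg_cong[where f = of_bool] cc cong_refl lt hn; (assumption | simp))+
      define g1 where "g1 v v' D w w' = mean (Z q) (\<lambda>u. mean (Z q) (\<lambda>u'. of_bool (cfg i v v' D w w' u u') :: real))" for v v' D w w'
      have g1c: "g1 v v' D w w' = g1 v1 v1' D1 w1 w1'"
        if "[v = v1] (mod int p)" "[v' = v1'] (mod int p)" "[D = D1] (mod int p)" "[w = w1] (mod int p)" "[w' = w1'] (mod int p)"
        for v v' D w w' v1 v1' D1 w1 w1'
        unfolding g1_def by (intro mean_cong arg_cong[where f = of_bool] cc that cong_refl)
      define g2 where "g2 v v' D = mean (Z p) (\<lambda>w. mean (Z p) (\<lambda>w'. g1 v v' D w w'))" for v v' D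
      have g2c: "g2 v v' D = g2 v1 v1' D1" if "[v = v1] (mod int p)" "[v' = v1'] (mod int p)" "[D = D1] (mod int p)" for v v' D v1 v1' D1
        unfolding g2_def by (intro mean_cong g1c that cong_refl)
      have st2: "mean (Fn n p) (\<lambda>Q. g1 v v' D (Q (h!1) - Q (h!0) + s) (Q (h!2) - Q (h!1) + t)) = g2 v v' D" for v v' D s t
      proof -
        have "mean (Fn n p) (\<lambda>Q. g1 v v' D (Q (h!1) - Q (h!0) + s) (Q (h!2) - Q (h!1) + t))
          = mean (Z p) (\<lambda>w. mean (Z p) (\<lambda>w'. g1 v v' D (w + s) (w' + t)))"
          by (rule mean_diff2[where g = "\<lambda>w w'. g1 v v' D (w + s) (w' + t)"])
             (intro p perI g1c cong_refl cong_add lt hn; (assumption | simp))+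
        also have "\<dots> = mean (Z p) (\<lambda>w. mean (Z p) (\<lambda>w'. g1 v v' D (w + s) w'))"
          by (intro mean_cong mean_Z_shift[where f = "\<lambda>w'. g1 v v' D (_ + s) w'"] p perI g1c cong_refl)
        also have "\<dots> = mean (Z p) (\<lambda>w. mean (Z p) (\<lambda>w'. g1 v v' D w w'))"
          by (rule mean_Z_shift[where f = "\<lambda>w. mean (Z p) (\<lambda>w'. g1 v v' D w w')"])
             (intro p perI mean_cong g1c cong_refl)+
        finally show ?thesis by (simp only: g2_def)
      qed
      have "?E (\<lambda>V Q U. of_bool (cfgT i T V Q U)) =
         mean (Fn n p) (\<lambda>V. g2 (V (h!1) - V (h!0)) (V (h!2) - V (h!1)) (V (h!6) - V (h!5)))"
        unfolding cfgT_def h_def[symmetric] Let_def st1 g1_def[symmetric] st2 ..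
      also have "\<dots> = mean (Z p) (\<lambda>v. mean (Z p) (\<lambda>v'. mean (Z p) (g2 v v')))"
        by (rule mean_diff3[where g = g2]) (intro p perI g2c cong_refl lt hn; (assumption | simp))+
      finally show ?thesis by (simp only: X_def g2_def[abs_def] g1_def[abs_def])
    qed
    have "1 = ?E (\<lambda>V Q U. 1)" by (simp only: mean_Fn_const[OF p] mean_Fn_const[OF q])
    also have "\<dots> \<le> ?E (\<lambda>V Q U. (\<Sum>S\<in>S6. of_bool (badS S V Q U)) + (\<Sum>T\<in>S12. \<Sum>i<r. of_bool (cfgT i T V Q U)))"
      by (intro mean_mono one)
    also have "\<dots> = (\<Sum>S\<in>S6. ?E (\<lambda>V Q U. of_bool (badS S V Q U))) + (\<Sum>T\<in>S12. \<Sum>i<r. ?E (\<lambda>V Q U. of_bool (cfgT i T V Q U)))"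
      by (simp only: mean_add mean_sum)
    also have "\<dots> \<le> (\<Sum>S\<in>S6. \<beta>) + (\<Sum>T\<in>S12. \<Sum>i<r. X i)"
      by (intro add_mono sum_mono E1) (simp_all add: E2)
    also have "\<dots> = real (card S6) * \<beta> + real (card S12) * (\<Sum>i<r. X i)" by simp
    also have "real (card S6) * \<beta> \<le> 1 / 2" by (simp add: \<beta>_def field_simps)
    finally have "1 / 2 \<le> real (card S12) * (\<Sum>i<r. X i)" by simp
    moreover have "0 \<le> (\<Sum>i<r. X i)" unfolding X_def by (intro sum_nonneg mean_nonneg) simp
    ultimately have "1 / 2 \<le> (real (card S12) + 1) * (\<Sum>i<r. X i)" by (simp add: distrib_right)
    hence "c \<le> (\<Sum>i<r. X i)" by (simp add: c_def field_simps)
    thus "c \<le> (\<Sum>i<r. mean (Z p) (\<lambda>v. mean (Z p) (\<lambda>v'. mean (Z p) (\<lambda>D. mean (Z p) (\<lambda>w. mean (Z p) (\<lambda>w'.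
        mean (Z q) (\<lambda>u. mean (Z q) (\<lambda>u'. of_bool (A i v w u \<and> A i v' w' u' \<and> B i (v + v') (w + w' + 2 * D) \<and> G i D (u + u'))))))))))"
      by (simp only: X_def cfg_def)
  qed
qed

section \<open>Positivity\<close>

lemma norm_one_minus_mult2:
  assumes "cmod a = 1" shows "cmod (1 - a * b) \<le> cmod (1 - a) + cmod (1 - b)"
proof -
  have "cmod (1 - a * b) = cmod ((1 - a) + a * (1 - b))" by (simp add: algebra_simps)
  also have "\<dots> \<le> cmod (1 - a) + cmod (a * (1 - b))" by (rule norm_triangle_ineq)
  finally show ?thesis by (simp add: norm_mult assms)
qed

lemma dist_ee_add: "cmod (1 - ee N (a + b)) \<le> cmod (1 - ee N a) + cmod (1 - ee N b)"
  unfolding ee_add by (rule norm_one_minus_mult2) simp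

context smoothing
begin

lemma sm_nonneg: "(\<And>x. 0 \<le> f x) \<Longrightarrow> 0 \<le> sm f v w u"
  unfolding sm_def by (intro mean_nonneg mult_nonneg_nonneg wt_nonneg)

lemma sm_mono: "(\<And>x. f x \<le> g x) \<Longrightarrow> sm f v w u \<le> sm g v w u"
  unfolding sm_def by (intro mean_mono mult_left_mono wt_nonneg)

lemma sm_le: "(\<And>x. f x \<le> 1) \<Longrightarrow> sm f v w u \<le> 1 + tau * real C ^ 3"
proof -
  assume f: "\<And>x. f x \<le> 1"
  have "sm f v w u \<le> M (\<lambda>x. wt x v w u)"
    unfolding sm_def using wt_nonneg f by (intro mean_mono) (simp add: mult_left_le)
  thus ?thesis using wt_mean[of v w u] by linarith
qed

lemma wt_cong:
  assumes "[v = v'] (mod int p)" "[w = w'] (mod int p)" "[u = u'] (mod int q)"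
  shows "wt x v w u = wt x v' w' u'"
  unfolding wt_def using perD[OF kern_per[OF k1] cong_diff[OF cong_refl assms(1)]]
    perD[OF kern_per[OF k2] cong_diff[OF cong_refl assms(2)]] perD[OF kern_per[OF k3] cong_diff[OF cong_refl assms(3)]]
  by simp

lemma sm_cong:
  assumes "[v = v'] (mod int p)" "[w = w'] (mod int p)" "[u = u'] (mod int q)"
  shows "sm f v w u = sm f v' w' u'"
  unfolding sm_def wt_cong[OF assms] ..

text \<open>Moving the position multiplies each character by a phase, so the change is controlled by
  how far the frequencies of the kernel are from trivial on the displacement.\<close>

lemma sm_diff:
  assumes f: "\<And>x. \<bar>f x\<bar> \<le> 1"
  shows "\<bar>sm f v w u - sm f v' w' u'\<bar> \<le> (\<Sum>\<gamma>\<in>Dual. mu \<gamma> * (cmod (1 - ee p (fst (snd \<gamma>) * (v' - v)))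
     + cmod (1 - ee p (fst \<gamma> * (w' - w))) + cmod (1 - ee q (snd (snd \<gamma>) * (u' - u)))))"
proof -
  have "\<bar>sm f v w u - sm f v' w' u'\<bar> = cmod (complex_of_real (sm f v w u) - complex_of_real (sm f v' w' u'))"
    by (simp only: of_real_diff[symmetric] norm_of_real)
  also have "complex_of_real (sm f v w u) - complex_of_real (sm f v' w' u') =
    (\<Sum>\<gamma>\<in>Dual. complex_of_real (mu \<gamma>) * fc (\<lambda>x. complex_of_real (f x)) \<gamma> * (pc \<gamma> v w u - pc \<gamma> v' w' u'))"
    unfolding of_real_sm sc_expand sum_subtractf[symmetric] by (simp only: right_diff_distrib)
  also have "cmod \<dots> \<le> (\<Sum>\<gamma>\<in>Dual. mu \<gamma> * (cmod (1 - ee p (fst (snd \<gamma>) * (v' - v)))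
     + cmod (1 - ee p (fst \<gamma> * (w' - w))) + cmod (1 - ee q (snd (snd \<gamma>) * (u' - u)))))"
  proof (rule sum_norm_le)
    fix \<gamma> assume "\<gamma> \<in> Dual"
    let ?A = "pc \<gamma> v w u" and ?A' = "pc \<gamma> v' w' u'"
    let ?a = "ee p (fst (snd \<gamma>) * (v' - v))" and ?b = "ee p (fst \<gamma> * (w' - w))" and ?c = "ee q (snd (snd \<gamma>) * (u' - u))"
    have e: "?A' = ?A * (?a * (?b * ?c))"
    proof -
      have "?A * (?a * (?b * ?c)) = (ee p (fst \<gamma> * w + fst (snd \<gamma>) * v) * (?a * ?b)) * (ee q (snd (snd \<gamma>) * u) * ?c)"
        unfolding pc_def by (simp only: mult_ac)
      also have "\<dots> = ?A'" unfolding ee_add[symmetric] pc_def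
        by (intro arg_cong2[where f = "(*)"] arg_cong[where f = "ee p"] arg_cong[where f = "ee q"]) (simp_all add: algebra_simps)
      finally show ?thesis ..
    qed
    have "cmod (?A - ?A') = cmod (?A * (1 - ?a * (?b * ?c)))" unfolding e by (simp only: right_diff_distrib mult_1_right)
    also have "\<dots> = cmod (1 - ?a * (?b * ?c))" by (simp add: norm_mult)
    also have "\<dots> \<le> cmod (1 - ?a) + cmod (1 - ?b * ?c)" by (rule norm_one_minus_mult2) simp
    also have "cmod (1 - ?b * ?c) \<le> cmod (1 - ?b) + cmod (1 - ?c)" by (rule norm_one_minus_mult2) simp
    finally have d: "cmod (?A - ?A') \<le> cmod (1 - ?a) + cmod (1 - ?b) + cmod (1 - ?c)" by simp
    have "cmod (complex_of_real (mu \<gamma>) * fc (\<lambda>x. complex_of_real (f x)) \<gamma>) \<le> mu \<gamma>"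
      using mu_nonneg[of \<gamma>] cmod_fc_le[of "\<lambda>x. complex_of_real (f x)" 1 \<gamma>] f by (simp add: norm_mult mult_left_le)
    hence "cmod (complex_of_real (mu \<gamma>) * fc (\<lambda>x. complex_of_real (f x)) \<gamma>) * cmod (?A - ?A') \<le> mu \<gamma> * (cmod (1 - ?a) + cmod (1 - ?b) + cmod (1 - ?c))"
      using d mu_nonneg by (intro mult_mono) auto
    thus "cmod (complex_of_real (mu \<gamma>) * fc (\<lambda>x. complex_of_real (f x)) \<gamma> * (?A - ?A')) \<le> mu \<gamma> * (cmod (1 - ?a) + cmod (1 - ?b) + cmod (1 - ?c))"
      by (simp only: norm_mult)
  qed
  finally show ?thesis .
qed

text \<open>The smoothing operator is positive definite, so a function cannot live where its own
  smoothing is small.\<close>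

lemma mean_where_smoothing_small:
  assumes f: "\<And>x. 0 \<le> f x" "\<And>x. f x \<le> 1" and \<kappa>: "\<kappa> \<ge> 0"
  shows "M (\<lambda>x. f x * of_bool (sm f x (x\<^sup>2) (ind x) < \<kappa>)) \<le> \<kappa>"
proof -
  define g where "g x = f x * of_bool (sm f x (x\<^sup>2) (ind x) < \<kappa>)" for x
  have g: "0 \<le> g x" "g x \<le> f x" for x using f[of x] by (auto simp: g_def)
  let ?c = "\<lambda>x. complex_of_real (g x)"
  have z: "(0, 0, 0) \<in> Dual" using p_pos q_pos by (simp add: Dual_def)
  have mu0: "mu (0, 0, 0) = 1" using pos by (simp add: mu_def nrm_def)
  have "complex_of_real (M (\<lambda>s. g s * sm g s (s\<^sup>2) (ind s))) = M (\<lambda>s. \<Sum>\<gamma>\<in>Dual. complex_of_real (mu \<gamma>) * fc ?c \<gamma> * cnj (?c s * cnj (phi \<gamma> s)))"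
    unfolding mean_of_real[symmetric] of_real_mult of_real_sm sc_expand phi_pc
    by (simp add: sum_distrib_left mult_ac)
  also have "\<dots> = (\<Sum>\<gamma>\<in>Dual. complex_of_real (mu \<gamma> * (cmod (fc ?c \<gamma>))\<^sup>2))"
    unfolding mean_sum mean_mult_left mean_cnj[symmetric] fc_def[symmetric] of_real_mult complex_norm_square
    by (simp only: mult.assoc)
  also have "\<dots> = complex_of_real (\<Sum>\<gamma>\<in>Dual. mu \<gamma> * (cmod (fc ?c \<gamma>))\<^sup>2)" by (simp only: of_real_sum)
  finally have e: "M (\<lambda>s. g s * sm g s (s\<^sup>2) (ind s)) = (\<Sum>\<gamma>\<in>Dual. mu \<gamma> * (cmod (fc ?c \<gamma>))\<^sup>2)"
    by (simp only: of_real_eq_iff)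
  have "(M g)\<^sup>2 = mu (0, 0, 0) * (cmod (fc ?c (0, 0, 0)))\<^sup>2"
  proof -
    have "fc ?c (0, 0, 0) = complex_of_real (M g)" by (simp add: fc_def mean_of_real)
    thus ?thesis by (simp only: mu0 norm_of_real) simp
  qed
  \<comment> \<open>All spectral terms are non-negative, so the one of the trivial character is a
    lower bound for the whole form.\<close>
  also have "\<dots> \<le> (\<Sum>\<gamma>\<in>Dual. mu \<gamma> * (cmod (fc ?c \<gamma>))\<^sup>2)"
    by (rule member_le_sum[OF z]) (auto simp: mu_nonneg)
  also have "\<dots> = M (\<lambda>s. g s * sm g s (s\<^sup>2) (ind s))" by (rule e[symmetric])
  also have "\<dots> \<le> M (\<lambda>s. g s * \<kappa>)"
  proof (rule mean_mono)
    fix s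
    show "g s * sm g s (s\<^sup>2) (ind s) \<le> g s * \<kappa>"
    \<comment> \<open>On the support of g the smoothing of f is below \<kappa>, hence so is that of
      g, which is smaller.\<close>
    proof (cases "sm f s (s\<^sup>2) (ind s) < \<kappa>")
      case True
      have "sm g s (s\<^sup>2) (ind s) \<le> sm f s (s\<^sup>2) (ind s)" by (intro sm_mono g)
      thus ?thesis using True g by (intro mult_left_mono) auto
    qed (simp add: g_def)
  qed
  also have "\<dots> = M g * \<kappa>" by (rule mean_mult_right)
  finally have "(M g) * (M g) \<le> \<kappa> * M g" by (simp add: power2_eq_square mult.commute)
  moreover have "M g \<ge> 0" by (intro mean_nonneg g)
  ultimately have "M g \<le> \<kappa>" using \<kappa> by (cases "M g = 0") (auto simp: mult_le_cancel_right)
  thus ?thesis by (simp only: g_def[abs_def])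
qed

end

section \<open>Two scales: coarse smoothings at fine positions\<close>

context prime_modulus
begin

abbreviation E7 :: "(int \<Rightarrow> int \<Rightarrow> int \<Rightarrow> int \<Rightarrow> int \<Rightarrow> int \<Rightarrow> int \<Rightarrow> real) \<Rightarrow> real" where
  "E7 F \<equiv> M (\<lambda>v. M (\<lambda>v'. M (\<lambda>D. M (\<lambda>w. M (\<lambda>w'. mean (Z q) (\<lambda>u. mean (Z q) (\<lambda>u'. F v v' D w w' u u')))))))"

lemma E7_prod: "E7 (\<lambda>v v' D w w' u u'. A v * (A' v' * (B D * (G w * (G' w' * (P u * P' u'))))))
   = M A * (M A' * (M B * (M G * (M G' * (mean (Z q) P * mean (Z q) P')))))"
  by (simp only: mean_mult_left mean_mult_right)

end

text \<open>The fine kernels live where every frequency of the coarse kernels is, on average, within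
  s of trivial. Coarse smoothings therefore hardly vary over a fine neighbourhood.\<close>

locale coarse_fine = prime_modulus p + coarse: smoothing p C a1 H1 a2 H2 b P + fine: smoothing p C' a' H' a' H' b' P'
  for p C a1 H1 a2 H2 b P C' a' H' b' P' +
  fixes s :: real
  assumes near1: "\<And>\<xi>. \<xi> \<in> Z p \<Longrightarrow> a1 \<xi> \<noteq> 0 \<Longrightarrow> M (\<lambda>v. H' v * cmod (1 - ee p (\<xi> * v))) \<le> s * a' 0"
    and near2: "\<And>\<xi>. \<xi> \<in> Z p \<Longrightarrow> a2 \<xi> \<noteq> 0 \<Longrightarrow> M (\<lambda>v. H' v * cmod (1 - ee p (\<xi> * v))) \<le> s * a' 0"
    and near3: "\<And>\<kappa>. \<kappa> \<in> Z q \<Longrightarrow> b \<kappa> \<noteq> 0 \<Longrightarrow> mean (Z q) (\<lambda>u. P' u * cmod (1 - ee q (\<kappa> * u))) \<le> s * b' 0"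
    and s0: "s \<ge> 0"
begin

text \<open>\<open>hn\<close> and \<open>pn\<close> are densities of mean 1, so weighting by them is
  averaging over a random position close to a given point.\<close>

definition hn :: "int \<Rightarrow> real" where "hn v = H' v / a' 0"
definition pn :: "int \<Rightarrow> real" where "pn u = P' u / b' 0"

lemma hn_nonneg: "hn v \<ge> 0" and pn_nonneg: "pn v \<ge> 0"
  unfolding hn_def pn_def using fine.pos kernD(7)[OF fine.k1] kernD(7)[OF fine.k3] by simp_all

lemma fine_wt: "fine.wt x v w u = hn (x - v) * hn (x\<^sup>2 - w) * pn (ind x - u)"
  by (simp add: fine.wt_def fine.nrm_def hn_def pn_def)

lemma mean_hn: "M (\<lambda>v. hn (c - v)) = 1"
proof -
  have "M (\<lambda>v. H' (c - v)) = a' 0"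
    by (simp only: mean_Z_reflect[OF p_pos kern_per[OF fine.k1]] kern_mean[OF fine.k1])
  thus ?thesis using fine.pos by (simp add: hn_def mean_divide)
qed

lemma mean_pn: "mean (Z q) (\<lambda>u. pn (c - u)) = 1"
proof -
  have "mean (Z q) (\<lambda>u. P' (c - u)) = b' 0"
    by (simp only: mean_Z_reflect[OF q_pos kern_per[OF fine.k3]] kern_mean[OF fine.k3])
  thus ?thesis using fine.pos by (simp add: pn_def mean_divide)
qed

lemma mean_hn_near:
  assumes "\<xi> \<in> Z p" "a1 \<xi> \<noteq> 0 \<or> a2 \<xi> \<noteq> 0"
  shows "M (\<lambda>v. hn (c - v) * cmod (1 - ee p (\<xi> * (c - v)))) \<le> s"
proof -
  have "per p (\<lambda>v. H' v * cmod (1 - ee p (\<xi> * v)))"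
    by (intro perI arg_cong2[where f = "(*)"] arg_cong[where f = "\<lambda>z. cmod (1 - z)"]
        perD[OF kern_per[OF fine.k1]] ee_cong[OF p_pos] cong_mult cong_refl)
  from mean_Z_reflect[OF p_pos this, of c]
  have "M (\<lambda>v. H' (c - v) * cmod (1 - ee p (\<xi> * (c - v)))) \<le> s * a' 0"
    using near1[OF assms(1)] near2[OF assms(1)] assms(2) by auto
  moreover have "M (\<lambda>v. hn (c - v) * cmod (1 - ee p (\<xi> * (c - v)))) = M (\<lambda>v. H' (c - v) * cmod (1 - ee p (\<xi> * (c - v)))) / a' 0"
    unfolding hn_def mean_divide[symmetric] by simp
  ultimately show ?thesis using fine.pos by (simp add: divide_le_eq)
qed

lemma mean_pn_near:
  assumes "\<kappa> \<in> Z q" "b \<kappa> \<noteq> 0"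
  shows "mean (Z q) (\<lambda>u. pn (c - u) * cmod (1 - ee q (\<kappa> * (c - u)))) \<le> s"
proof -
  have "per q (\<lambda>v. P' v * cmod (1 - ee q (\<kappa> * v)))"
    by (intro perI arg_cong2[where f = "(*)"] arg_cong[where f = "\<lambda>z. cmod (1 - z)"]
        perD[OF kern_per[OF fine.k3]] ee_cong[OF q_pos] cong_mult cong_refl)
  from mean_Z_reflect[OF q_pos this, of c]
  have "mean (Z q) (\<lambda>u. P' (c - u) * cmod (1 - ee q (\<kappa> * (c - u)))) \<le> s * b' 0"
    using near3[OF assms] by auto
  moreover have "mean (Z q) (\<lambda>u. pn (c - u) * cmod (1 - ee q (\<kappa> * (c - u)))) = mean (Z q) (\<lambda>u. P' (c - u) * cmod (1 - ee q (\<kappa> * (c - u)))) / b' 0"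
    unfolding pn_def mean_divide[symmetric] by simp
  ultimately show ?thesis using fine.pos by (simp add: divide_le_eq)
qed

lemma mean_fine_wt: "M (\<lambda>v. M (\<lambda>w. mean (Z q) (\<lambda>u. fine.wt x v w u))) = 1"
  unfolding fine_wt by (simp only: mean_mult_left mean_mult_right mean_hn mean_pn mult_1)

lemma sum_mu_bound:
  assumes "\<And>\<gamma>. \<gamma> \<in> Dual \<Longrightarrow> coarse.mu \<gamma> \<noteq> 0 \<Longrightarrow> X \<gamma> \<le> B" "B \<ge> 0"
  shows "(\<Sum>\<gamma>\<in>Dual. coarse.mu \<gamma> * X \<gamma>) \<le> real C ^ 3 * B"
proof -
  have "(\<Sum>\<gamma>\<in>Dual. coarse.mu \<gamma> * X \<gamma>) \<le> (\<Sum>\<gamma>\<in>Dual. coarse.mu \<gamma> * B)"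
  proof (rule sum_mono)
    fix \<gamma> assume "\<gamma> \<in> Dual"
    thus "coarse.mu \<gamma> * X \<gamma> \<le> coarse.mu \<gamma> * B"
      using assms(1)[of \<gamma>] coarse.mu_nonneg[of \<gamma>] by (cases "coarse.mu \<gamma> = 0") (auto intro: mult_left_mono)
  qed
  also have "\<dots> = (\<Sum>\<gamma>\<in>Dual. coarse.mu \<gamma>) * B" by (rule sum_distrib_right[symmetric])
  also have "\<dots> \<le> real C ^ 3 * B" by (intro mult_right_mono coarse.sum_mu assms)
  finally show ?thesis .
qed

lemma mu_nonzeroD:
  assumes "\<gamma> \<in> Dual" "coarse.mu \<gamma> \<noteq> 0"
  shows "fst \<gamma> \<in> Z p" "fst (snd \<gamma>) \<in> Z p" "snd (snd \<gamma>) \<in> Z q" "a1 (fst (snd \<gamma>)) \<noteq> 0" "a2 (fst \<gamma>) \<noteq> 0" "b (snd (snd \<gamma>)) \<noteq> 0"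
  using assms by (auto simp: Dual_def coarse.mu_def)

text \<open>\<open>sm_diff\<close> bounds the deviation frequency by frequency; each of the three
  coordinates contributes a fine average of at most s.\<close>

lemma mean_position_error:
  assumes f: "\<And>x. \<bar>f x\<bar> \<le> 1"
  shows "M (\<lambda>v. M (\<lambda>w. mean (Z q) (\<lambda>u. fine.wt x v w u * \<bar>coarse.sm f v w u - coarse.sm f x (x\<^sup>2) (ind x)\<bar>))) \<le> 3 * s * real C ^ 3"
proof -
  let ?N = "\<lambda>\<xi> c. cmod (1 - ee p (\<xi> * c))" and ?N' = "\<lambda>\<xi> c. cmod (1 - ee q (\<xi> * c))"
  let ?E = "\<lambda>F. M (\<lambda>v. M (\<lambda>w. mean (Z q) (\<lambda>u. F v w u :: real)))"
  have "?E (\<lambda>v w u. fine.wt x v w u * \<bar>coarse.sm f v w u - coarse.sm f x (x\<^sup>2) (ind x)\<bar>)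
     \<le> ?E (\<lambda>v w u. \<Sum>\<gamma>\<in>Dual. coarse.mu \<gamma> * (fine.wt x v w u * (?N (fst (snd \<gamma>)) (x - v) + ?N (fst \<gamma>) (x\<^sup>2 - w) + ?N' (snd (snd \<gamma>)) (ind x - u))))"
  proof (intro mean_mono)
    fix v w u
    have "fine.wt x v w u * \<bar>coarse.sm f v w u - coarse.sm f x (x\<^sup>2) (ind x)\<bar> \<le> fine.wt x v w u * (\<Sum>\<gamma>\<in>Dual. coarse.mu \<gamma> * (?N (fst (snd \<gamma>)) (x - v) + ?N (fst \<gamma>) (x\<^sup>2 - w) + ?N' (snd (snd \<gamma>)) (ind x - u)))"
      by (intro mult_left_mono coarse.sm_diff f fine.wt_nonneg)
    thus "fine.wt x v w u * \<bar>coarse.sm f v w u - coarse.sm f x (x\<^sup>2) (ind x)\<bar> \<le> (\<Sum>\<gamma>\<in>Dual. coarse.mu \<gamma> * (fine.wt x v w u * (?N (fst (snd \<gamma>)) (x - v) + ?N (fst \<gamma>) (x\<^sup>2 - w) + ?N' (snd (snd \<gamma>)) (ind x - u))))"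
      unfolding sum_distrib_left by (simp only: mult.left_commute)
  qed
  also have "\<dots> = (\<Sum>\<gamma>\<in>Dual. coarse.mu \<gamma> * ?E (\<lambda>v w u. fine.wt x v w u * (?N (fst (snd \<gamma>)) (x - v) + ?N (fst \<gamma>) (x\<^sup>2 - w) + ?N' (snd (snd \<gamma>)) (ind x - u))))"
    by (simp only: mean_sum mean_mult_left)
  also have "\<dots> \<le> real C ^ 3 * (3 * s)"
  proof (rule sum_mu_bound)
    fix \<gamma> assume g: "\<gamma> \<in> Dual" "coarse.mu \<gamma> \<noteq> 0"
    note m = mu_nonzeroD[OF g]
    have e: "fine.wt x v w u * (?N (fst (snd \<gamma>)) (x - v) + ?N (fst \<gamma>) (x\<^sup>2 - w) + ?N' (snd (snd \<gamma>)) (ind x - u)) =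
       (hn (x - v) * ?N (fst (snd \<gamma>)) (x - v)) * (hn (x\<^sup>2 - w) * pn (ind x - u)) +
       hn (x - v) * ((hn (x\<^sup>2 - w) * ?N (fst \<gamma>) (x\<^sup>2 - w)) * pn (ind x - u)) +
       hn (x - v) * (hn (x\<^sup>2 - w) * (pn (ind x - u) * ?N' (snd (snd \<gamma>)) (ind x - u)))" for v w u
      unfolding fine_wt by (simp only: distrib_left mult_ac)
    have "?E (\<lambda>v w u. fine.wt x v w u * (?N (fst (snd \<gamma>)) (x - v) + ?N (fst \<gamma>) (x\<^sup>2 - w) + ?N' (snd (snd \<gamma>)) (ind x - u))) =
       M (\<lambda>v. hn (x - v) * ?N (fst (snd \<gamma>)) (x - v)) + M (\<lambda>w. hn (x\<^sup>2 - w) * ?N (fst \<gamma>) (x\<^sup>2 - w)) +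
       mean (Z q) (\<lambda>u. pn (ind x - u) * ?N' (snd (snd \<gamma>)) (ind x - u))"
      unfolding e mean_add by (simp only: mean_mult_left mean_mult_right mean_hn mean_pn mult_1 mult_1_right)
    also have "\<dots> \<le> s + s + s" using m by (intro add_mono mean_hn_near mean_pn_near) auto
    finally show "?E (\<lambda>v w u. fine.wt x v w u * (?N (fst (snd \<gamma>)) (x - v) + ?N (fst \<gamma>) (x\<^sup>2 - w) + ?N' (snd (snd \<gamma>)) (ind x - u))) \<le> 3 * s" by simp
  qed (simp add: s0)
  finally show ?thesis by (simp add: mult_ac)
qed

text \<open>The fine density at a position is made of points x close to it. If the coarse smoothing
  is below \<kappa> at the position, then either it is below 2\<kappa> at x itself, which
  \<open>mean_where_smoothing_small\<close> makes rare, or it differs by at least \<kappa> between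
  the two, which Markov's inequality makes rare.\<close>

lemma rarely_below:
  assumes f: "\<And>x. 0 \<le> f x" "\<And>x. f x \<le> 1" and \<kappa>: "\<kappa> > 0"
  shows "M (\<lambda>v. M (\<lambda>w. mean (Z q) (\<lambda>u. fine.sm f v w u * of_bool (coarse.sm f v w u < \<kappa>)))) \<le> 2 * \<kappa> + 3 * s * real C ^ 3 / \<kappa>"
proof -
  have f': "\<bar>f x\<bar> \<le> 1" for x using f[of x] by simp
  let ?F = "\<lambda>x. coarse.sm f x (x\<^sup>2) (ind x)"
  have "M (\<lambda>v. M (\<lambda>w. mean (Z q) (\<lambda>u. fine.sm f v w u * of_bool (coarse.sm f v w u < \<kappa>)))) =
     M (\<lambda>v. M (\<lambda>w. mean (Z q) (\<lambda>u. M (\<lambda>x. f x * (fine.wt x v w u * of_bool (coarse.sm f v w u < \<kappa>))))))"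
    unfolding fine.sm_def mean_mult_right[symmetric] by (simp only: mult_ac)
  also have "\<dots> = M (\<lambda>x. f x * M (\<lambda>v. M (\<lambda>w. mean (Z q) (\<lambda>u. fine.wt x v w u * of_bool (coarse.sm f v w u < \<kappa>)))))"
  proof -
    have "M (\<lambda>v. M (\<lambda>w. mean (Z q) (\<lambda>u. M (\<lambda>x. X v w u x)))) = M (\<lambda>x. M (\<lambda>v. M (\<lambda>w. mean (Z q) (\<lambda>u. X v w u x))))" for X :: "int \<Rightarrow> int \<Rightarrow> int \<Rightarrow> int \<Rightarrow> real"
    proof -
      have "M (\<lambda>v. M (\<lambda>w. mean (Z q) (\<lambda>u. M (\<lambda>x. X v w u x)))) = M (\<lambda>v. M (\<lambda>w. M (\<lambda>x. mean (Z q) (\<lambda>u. X v w u x))))"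
        by (rule mean_cong, rule mean_cong, rule mean_swap)
      also have "\<dots> = M (\<lambda>v. M (\<lambda>x. M (\<lambda>w. mean (Z q) (\<lambda>u. X v w u x))))" by (rule mean_cong, rule mean_swap)
      also have "\<dots> = M (\<lambda>x. M (\<lambda>v. M (\<lambda>w. mean (Z q) (\<lambda>u. X v w u x))))" by (rule mean_swap)
      finally show ?thesis .
    qed
    from this[of "\<lambda>v w u x. f x * (fine.wt x v w u * of_bool (coarse.sm f v w u < \<kappa>))"]
    show ?thesis by (simp only: mean_mult_left)
  qed
  also have "\<dots> \<le> M (\<lambda>x. f x * of_bool (?F x < 2 * \<kappa>) + 3 * s * real C ^ 3 / \<kappa>)"
  proof (rule mean_mono)
    fix x
    have "M (\<lambda>v. M (\<lambda>w. mean (Z q) (\<lambda>u. fine.wt x v w u * of_bool (coarse.sm f v w u < \<kappa>)))) \<le>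
       M (\<lambda>v. M (\<lambda>w. mean (Z q) (\<lambda>u. of_bool (?F x < 2 * \<kappa>) * fine.wt x v w u + (1 / \<kappa>) * (fine.wt x v w u * \<bar>coarse.sm f v w u - ?F x\<bar>))))"
    proof (intro mean_mono)
      fix v w u
      have "of_bool (coarse.sm f v w u < \<kappa>) \<le> (of_bool (?F x < 2 * \<kappa>) :: real) + (1 / \<kappa>) * \<bar>coarse.sm f v w u - ?F x\<bar>"
        using \<kappa> by (auto simp: field_simps)
      from mult_left_mono[OF this fine.wt_nonneg[of x v w u]]
      show "fine.wt x v w u * of_bool (coarse.sm f v w u < \<kappa>) \<le> of_bool (?F x < 2 * \<kappa>) * fine.wt x v w u + (1 / \<kappa>) * (fine.wt x v w u * \<bar>coarse.sm f v w u - ?F x\<bar>)"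
        by (simp only: distrib_left mult_ac)
    qed
    also have "\<dots> = of_bool (?F x < 2 * \<kappa>) * 1 + (1 / \<kappa>) * M (\<lambda>v. M (\<lambda>w. mean (Z q) (\<lambda>u. fine.wt x v w u * \<bar>coarse.sm f v w u - ?F x\<bar>)))"
      unfolding mean_add mean_mult_left mean_fine_wt ..
    also have "\<dots> \<le> of_bool (?F x < 2 * \<kappa>) * 1 + (1 / \<kappa>) * (3 * s * real C ^ 3)"
      using \<kappa> by (intro add_left_mono mult_left_mono mean_position_error f') simp
    finally have i: "M (\<lambda>v. M (\<lambda>w. mean (Z q) (\<lambda>u. fine.wt x v w u * of_bool (coarse.sm f v w u < \<kappa>)))) \<le> of_bool (?F x < 2 * \<kappa>) + 3 * s * real C ^ 3 / \<kappa>"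
      by simp
    have "f x * M (\<lambda>v. M (\<lambda>w. mean (Z q) (\<lambda>u. fine.wt x v w u * of_bool (coarse.sm f v w u < \<kappa>)))) \<le> f x * (of_bool (?F x < 2 * \<kappa>) + 3 * s * real C ^ 3 / \<kappa>)"
      by (intro mult_left_mono i f)
    also have "\<dots> \<le> f x * of_bool (?F x < 2 * \<kappa>) + 3 * s * real C ^ 3 / \<kappa>"
      unfolding distrib_left using f[of x] s0 \<kappa> by (intro add_left_mono mult_left_le_one_le) auto
    finally show "f x * M (\<lambda>v. M (\<lambda>w. mean (Z q) (\<lambda>u. fine.wt x v w u * of_bool (coarse.sm f v w u < \<kappa>)))) \<le> f x * of_bool (?F x < 2 * \<kappa>) + 3 * s * real C ^ 3 / \<kappa>" .
  qed
  also have "\<dots> = M (\<lambda>x. f x * of_bool (?F x < 2 * \<kappa>)) + 3 * s * real C ^ 3 / \<kappa>"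
    unfolding mean_add using mean_const[OF _ Zp_ne(1), of "3 * s * real C ^ 3 / \<kappa>"] by simp
  also have "M (\<lambda>x. f x * of_bool (?F x < 2 * \<kappa>)) \<le> 2 * \<kappa>"
    using \<kappa> by (intro coarse.mean_where_smoothing_small f) simp
  finally show ?thesis by simp
qed

text \<open>\<open>(v, w, u)\<close> and \<open>(v', w', u')\<close> are positions of \<open>x\<close> and \<open>y\<close>, and \<open>D\<close> is a linear position of \<open>x * y\<close>.\<close>

definition W :: "int \<Rightarrow> int \<Rightarrow> int \<Rightarrow> int \<Rightarrow> int \<Rightarrow> int \<Rightarrow> int \<Rightarrow> int \<Rightarrow> int \<Rightarrow> real" where
  "W x y v v' D w w' u u' = hn (x - v) * (hn (y - v') * (hn (x * y - D) * (hn (x\<^sup>2 - w) * (hn (y\<^sup>2 - w') * (pn (ind x - u) * pn (ind y - u'))))))"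

lemma W_nonneg: "W x y v v' D w w' u u' \<ge> 0"
  unfolding W_def by (intro mult_nonneg_nonneg hn_nonneg pn_nonneg)

lemma W_wt: "W x y v v' D w w' u u' = fine.wt x v w u * fine.wt y v' w' u' * hn (x * y - D)"
  unfolding W_def fine_wt by (simp only: mult_ac)

lemma E7_W: "E7 (W x y) = 1"
  unfolding W_def E7_prod mean_hn mean_pn by simp

text \<open>Since \<open>(x + y)\<^sup>2 = x\<^sup>2 + y\<^sup>2 + 2 * x * y\<close>, the position
  used is close to that of x + y. The 6 is one for each of x, y and their squares and two for the
  doubled product.\<close>

lemma sum_position_error:
  assumes f: "\<And>x. \<bar>f x\<bar> \<le> 1"
  shows "E7 (\<lambda>v v' D w w' u u'. W x y v v' D w w' u u' * \<bar>coarse.sm f (v + v') (w + w' + 2 * D) t - coarse.sm f (x + y) ((x + y)\<^sup>2) t\<bar>) \<le> 6 * s * real C ^ 3"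
proof -
  let ?N = "\<lambda>\<xi> c. cmod (1 - ee p (\<xi> * c))"
  let ?X = "\<lambda>\<gamma> v v' D w w' u u'. W x y v v' D w w' u u' * (?N (fst (snd \<gamma>)) (x - v) + ?N (fst (snd \<gamma>)) (y - v') + ?N (fst \<gamma>) (x\<^sup>2 - w) + ?N (fst \<gamma>) (y\<^sup>2 - w') + 2 * ?N (fst \<gamma>) (x * y - D))"
  have "E7 (\<lambda>v v' D w w' u u'. W x y v v' D w w' u u' * \<bar>coarse.sm f (v + v') (w + w' + 2 * D) t - coarse.sm f (x + y) ((x + y)\<^sup>2) t\<bar>)
    \<le> E7 (\<lambda>v v' D w w' u u'. \<Sum>\<gamma>\<in>Dual. coarse.mu \<gamma> * ?X \<gamma> v v' D w w' u u')"
  proof (intro mean_mono)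
    fix v v' D w w' u u'
    have "\<bar>coarse.sm f (v + v') (w + w' + 2 * D) t - coarse.sm f (x + y) ((x + y)\<^sup>2) t\<bar> \<le>
      (\<Sum>\<gamma>\<in>Dual. coarse.mu \<gamma> * (?N (fst (snd \<gamma>)) (x + y - (v + v')) + ?N (fst \<gamma>) ((x + y)\<^sup>2 - (w + w' + 2 * D)) + cmod (1 - ee q (snd (snd \<gamma>) * (t - t)))))"
      by (rule coarse.sm_diff[OF f])
    also have "\<dots> \<le> (\<Sum>\<gamma>\<in>Dual. coarse.mu \<gamma> * (?N (fst (snd \<gamma>)) (x - v) + ?N (fst (snd \<gamma>)) (y - v') + ?N (fst \<gamma>) (x\<^sup>2 - w) + ?N (fst \<gamma>) (y\<^sup>2 - w') + 2 * ?N (fst \<gamma>) (x * y - D)))"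
    proof (intro sum_mono mult_left_mono coarse.mu_nonneg)
      fix \<gamma> :: "int \<times> int \<times> int"
      have "fst (snd \<gamma>) * (x + y - (v + v')) = fst (snd \<gamma>) * (x - v) + fst (snd \<gamma>) * (y - v')" by (simp add: algebra_simps)
      hence 1: "?N (fst (snd \<gamma>)) (x + y - (v + v')) \<le> ?N (fst (snd \<gamma>)) (x - v) + ?N (fst (snd \<gamma>)) (y - v')"
        by (simp only: dist_ee_add)
      have e: "fst \<gamma> * ((x + y)\<^sup>2 - (w + w' + 2 * D)) = fst \<gamma> * (x\<^sup>2 - w) + (fst \<gamma> * (y\<^sup>2 - w') + (fst \<gamma> * (x * y - D) + fst \<gamma> * (x * y - D)))"
        by (simp add: power2_eq_square algebra_simps)
      have "?N (fst \<gamma>) ((x + y)\<^sup>2 - (w + w' + 2 * D)) \<le> ?N (fst \<gamma>) (x\<^sup>2 - w) + (?N (fst \<gamma>) (y\<^sup>2 - w') + (?N (fst \<gamma>) (x * y - D) + ?N (fst \<gamma>) (x * y - D)))"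
        unfolding e by (intro order.trans[OF dist_ee_add] add_left_mono order.refl)
      with 1 show "?N (fst (snd \<gamma>)) (x + y - (v + v')) + ?N (fst \<gamma>) ((x + y)\<^sup>2 - (w + w' + 2 * D)) + cmod (1 - ee q (snd (snd \<gamma>) * (t - t)))
         \<le> ?N (fst (snd \<gamma>)) (x - v) + ?N (fst (snd \<gamma>)) (y - v') + ?N (fst \<gamma>) (x\<^sup>2 - w) + ?N (fst \<gamma>) (y\<^sup>2 - w') + 2 * ?N (fst \<gamma>) (x * y - D)"
        by simp
    qed
    finally have "W x y v v' D w w' u u' * \<bar>coarse.sm f (v + v') (w + w' + 2 * D) t - coarse.sm f (x + y) ((x + y)\<^sup>2) t\<bar> \<le> W x y v v' D w w' u u' * \<dots>"
      by (intro mult_left_mono W_nonneg)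
    thus "W x y v v' D w w' u u' * \<bar>coarse.sm f (v + v') (w + w' + 2 * D) t - coarse.sm f (x + y) ((x + y)\<^sup>2) t\<bar> \<le> (\<Sum>\<gamma>\<in>Dual. coarse.mu \<gamma> * ?X \<gamma> v v' D w w' u u')"
      unfolding sum_distrib_left by (simp only: mult.left_commute)
  qed
  also have "\<dots> = (\<Sum>\<gamma>\<in>Dual. coarse.mu \<gamma> * E7 (?X \<gamma>))"
    by (simp only: mean_sum mean_mult_left)
  also have "\<dots> \<le> real C ^ 3 * (6 * s)"
  proof (rule sum_mu_bound)
    fix \<gamma> assume g: "\<gamma> \<in> Dual" "coarse.mu \<gamma> \<noteq> 0"
    note m = mu_nonzeroD[OF g]
    let ?\<beta> = "fst (snd \<gamma>)" and ?\<alpha> = "fst \<gamma>"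
    have e: "?X \<gamma> v v' D w w' u u' =
       (hn (x - v) * ?N ?\<beta> (x - v)) * (hn (y - v') * (hn (x * y - D) * (hn (x\<^sup>2 - w) * (hn (y\<^sup>2 - w') * (pn (ind x - u) * pn (ind y - u')))))) +
       hn (x - v) * ((hn (y - v') * ?N ?\<beta> (y - v')) * (hn (x * y - D) * (hn (x\<^sup>2 - w) * (hn (y\<^sup>2 - w') * (pn (ind x - u) * pn (ind y - u')))))) +
       hn (x - v) * (hn (y - v') * (hn (x * y - D) * ((hn (x\<^sup>2 - w) * ?N ?\<alpha> (x\<^sup>2 - w)) * (hn (y\<^sup>2 - w') * (pn (ind x - u) * pn (ind y - u')))))) +
       hn (x - v) * (hn (y - v') * (hn (x * y - D) * (hn (x\<^sup>2 - w) * ((hn (y\<^sup>2 - w') * ?N ?\<alpha> (y\<^sup>2 - w')) * (pn (ind x - u) * pn (ind y - u')))))) +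
       2 * (hn (x - v) * (hn (y - v') * ((hn (x * y - D) * ?N ?\<alpha> (x * y - D)) * (hn (x\<^sup>2 - w) * (hn (y\<^sup>2 - w') * (pn (ind x - u) * pn (ind y - u')))))))" for v v' D w w' u u'
      unfolding W_def by (simp only: distrib_left mult_ac)
    have "E7 (?X \<gamma>) = M (\<lambda>v. hn (x - v) * ?N ?\<beta> (x - v)) + M (\<lambda>v. hn (y - v) * ?N ?\<beta> (y - v)) +
       M (\<lambda>v. hn (x\<^sup>2 - v) * ?N ?\<alpha> (x\<^sup>2 - v)) + M (\<lambda>v. hn (y\<^sup>2 - v) * ?N ?\<alpha> (y\<^sup>2 - v)) + 2 * M (\<lambda>v. hn (x * y - v) * ?N ?\<alpha> (x * y - v))"
      unfolding e by (simp only: mean_add mean_mult_left mean_mult_right mean_hn mean_pn mult_1 mult_1_right)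
    also have "\<dots> \<le> s + s + s + s + 2 * s" using m by (intro add_mono mult_left_mono mean_hn_near) auto
    finally show "E7 (?X \<gamma>) \<le> 6 * s" by simp
  qed (simp add: s0)
  finally show ?thesis by (simp add: mult_ac)
qed

text \<open>The displacements of D and of the two logarithms contribute s each. The sum
  \<open>ind x + ind y\<close> stands in for \<open>ind (x * y)\<close>; the two are known to agree
  modulo q only if neither x nor y is divisible by p.\<close>

lemma product_position_error:
  assumes f: "\<And>x. \<bar>f x\<bar> \<le> 1"
  shows "E7 (\<lambda>v v' D w w' u u'. W x y v v' D w w' u u' * \<bar>coarse.sm f D t (u + u') - coarse.sm f (x * y) t (ind x + ind y)\<bar>) \<le> 3 * s * real C ^ 3"
proof -
  let ?N = "\<lambda>\<xi> c. cmod (1 - ee p (\<xi> * c))" and ?N' = "\<lambda>\<xi> c. cmod (1 - ee q (\<xi> * c))"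
  let ?X = "\<lambda>\<gamma> v v' D w w' u u'. W x y v v' D w w' u u' * (?N (fst (snd \<gamma>)) (x * y - D) + ?N' (snd (snd \<gamma>)) (ind x - u) + ?N' (snd (snd \<gamma>)) (ind y - u'))"
  have "E7 (\<lambda>v v' D w w' u u'. W x y v v' D w w' u u' * \<bar>coarse.sm f D t (u + u') - coarse.sm f (x * y) t (ind x + ind y)\<bar>)
    \<le> E7 (\<lambda>v v' D w w' u u'. \<Sum>\<gamma>\<in>Dual. coarse.mu \<gamma> * ?X \<gamma> v v' D w w' u u')"
  proof (intro mean_mono)
    fix v v' D w w' u u'
    have "\<bar>coarse.sm f D t (u + u') - coarse.sm f (x * y) t (ind x + ind y)\<bar> \<le>
      (\<Sum>\<gamma>\<in>Dual. coarse.mu \<gamma> * (?N (fst (snd \<gamma>)) (x * y - D) + ?N (fst \<gamma>) (t - t) + ?N' (snd (snd \<gamma>)) (ind x + ind y - (u + u'))))"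
      by (rule coarse.sm_diff[OF f])
    also have "\<dots> \<le> (\<Sum>\<gamma>\<in>Dual. coarse.mu \<gamma> * (?N (fst (snd \<gamma>)) (x * y - D) + ?N' (snd (snd \<gamma>)) (ind x - u) + ?N' (snd (snd \<gamma>)) (ind y - u')))"
    proof (intro sum_mono mult_left_mono coarse.mu_nonneg)
      fix \<gamma> :: "int \<times> int \<times> int"
      have "snd (snd \<gamma>) * (ind x + ind y - (u + u')) = snd (snd \<gamma>) * (ind x - u) + snd (snd \<gamma>) * (ind y - u')" by (simp add: algebra_simps)
      hence "?N' (snd (snd \<gamma>)) (ind x + ind y - (u + u')) \<le> ?N' (snd (snd \<gamma>)) (ind x - u) + ?N' (snd (snd \<gamma>)) (ind y - u')"
        by (simp only: dist_ee_add)
      thus "?N (fst (snd \<gamma>)) (x * y - D) + ?N (fst \<gamma>) (t - t) + ?N' (snd (snd \<gamma>)) (ind x + ind y - (u + u'))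
         \<le> ?N (fst (snd \<gamma>)) (x * y - D) + ?N' (snd (snd \<gamma>)) (ind x - u) + ?N' (snd (snd \<gamma>)) (ind y - u')"
        by simp
    qed
    finally have "W x y v v' D w w' u u' * \<bar>coarse.sm f D t (u + u') - coarse.sm f (x * y) t (ind x + ind y)\<bar> \<le> W x y v v' D w w' u u' * \<dots>"
      by (intro mult_left_mono W_nonneg)
    thus "W x y v v' D w w' u u' * \<bar>coarse.sm f D t (u + u') - coarse.sm f (x * y) t (ind x + ind y)\<bar> \<le> (\<Sum>\<gamma>\<in>Dual. coarse.mu \<gamma> * ?X \<gamma> v v' D w w' u u')"
      unfolding sum_distrib_left by (simp only: mult.left_commute)
  qed
  also have "\<dots> = (\<Sum>\<gamma>\<in>Dual. coarse.mu \<gamma> * E7 (?X \<gamma>))"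
    by (simp only: mean_sum mean_mult_left)
  also have "\<dots> \<le> real C ^ 3 * (3 * s)"
  proof (rule sum_mu_bound)
    fix \<gamma> assume g: "\<gamma> \<in> Dual" "coarse.mu \<gamma> \<noteq> 0"
    note m = mu_nonzeroD[OF g]
    let ?\<beta> = "fst (snd \<gamma>)" and ?\<kappa> = "snd (snd \<gamma>)"
    have e: "?X \<gamma> v v' D w w' u u' =
       hn (x - v) * (hn (y - v') * ((hn (x * y - D) * ?N ?\<beta> (x * y - D)) * (hn (x\<^sup>2 - w) * (hn (y\<^sup>2 - w') * (pn (ind x - u) * pn (ind y - u')))))) +
       hn (x - v) * (hn (y - v') * (hn (x * y - D) * (hn (x\<^sup>2 - w) * (hn (y\<^sup>2 - w') * ((pn (ind x - u) * ?N' ?\<kappa> (ind x - u)) * pn (ind y - u')))))) +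
       hn (x - v) * (hn (y - v') * (hn (x * y - D) * (hn (x\<^sup>2 - w) * (hn (y\<^sup>2 - w') * (pn (ind x - u) * (pn (ind y - u') * ?N' ?\<kappa> (ind y - u')))))))" for v v' D w w' u u'
      unfolding W_def by (simp only: distrib_left mult_ac)
    have "E7 (?X \<gamma>) = M (\<lambda>v. hn (x * y - v) * ?N ?\<beta> (x * y - v)) +
       mean (Z q) (\<lambda>v. pn (ind x - v) * ?N' ?\<kappa> (ind x - v)) + mean (Z q) (\<lambda>v. pn (ind y - v) * ?N' ?\<kappa> (ind y - v))"
      unfolding e by (simp only: mean_add mean_mult_left mean_mult_right mean_hn mean_pn mult_1 mult_1_right)
    also have "\<dots> \<le> s + s + s" using m by (intro add_mono mean_hn_near mean_pn_near) auto
    finally show "E7 (?X \<gamma>) \<le> 3 * s" by simp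
  qed (simp add: s0)
  finally show ?thesis by (simp add: mult_ac)
qed

end

section \<open>Lower bound for the count with smoothed colour classes\<close>

context prime_modulus
begin

lemma bilinear_additive_scaled:
  assumes \<xi>: "\<not> int p dvd \<xi>" and K: "K > 0" and a: "\<And>x. cmod (f x) \<le> K" and b: "\<And>x. cmod (g x) \<le> K"
  shows "cmod (M (\<lambda>x. M (\<lambda>y. f x * g y * ee p (\<xi> * (x * y))))) \<le> K\<^sup>2 * sqrt tau"
proof -
  let ?k = "complex_of_real K"
  have "(cmod (M (\<lambda>x. M (\<lambda>y. (f x / ?k) * (g y / ?k) * ee p (\<xi> * (x * y))))))\<^sup>2 \<le> 1 / real p"
    using a b K by (intro bilinear_additive[OF \<xi>]) (simp_all add: norm_divide divide_le_eq)
  also have "\<dots> \<le> tau" by (rule inverse_p_le_tau)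
  finally have "cmod (M (\<lambda>x. M (\<lambda>y. (f x / ?k) * (g y / ?k) * ee p (\<xi> * (x * y))))) \<le> sqrt tau"
    by (rule real_le_rsqrt)
  moreover have "M (\<lambda>x. M (\<lambda>y. f x * g y * ee p (\<xi> * (x * y)))) = ?k\<^sup>2 * M (\<lambda>x. M (\<lambda>y. (f x / ?k) * (g y / ?k) * ee p (\<xi> * (x * y))))"
    unfolding mean_mult_left[symmetric] using K by (intro mean_cong) (simp add: power2_eq_square)
  ultimately show ?thesis using K by (simp add: norm_mult norm_power)
qed

lemma M_E7_swap:
  "M (\<lambda>x. E7 (G x)) = E7 (\<lambda>v v' D w w' u u'. M (\<lambda>x. G x v v' D w w' u u'))"
  by ((rule trans[OF mean_swap], rule mean_cong)+, rule refl)

end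

context coarse_fine
begin

text \<open>Expand the density at D into characters of xy. The trivial one gives the product of the
  two fine densities; each other one gives a bilinear sum, which is small because the product is
  independent of the factors. The seventh power is C' for normalising \<open>hn\<close> and C'^3 for
  each of the two weights.\<close>

lemma weighted_pairs_ge:
  assumes f: "\<And>x. 0 \<le> f x" "\<And>x. f x \<le> (1::real)"
  shows "fine.sm f v w u * fine.sm f v' w' u' - real C' ^ 7 * sqrt tau
    \<le> M (\<lambda>x. M (\<lambda>y. f x * f y * W x y v v' D w w' u u'))"
proof -
  define A where "A x = complex_of_real (f x * fine.wt x v w u)" for x
  define B where "B x = complex_of_real (f x * fine.wt x v' w' u')" for x
  have C'1: "real C' \<ge> 1" using kern_C_pos[OF fine.k1] by simp
  have bnd: "cmod (complex_of_real (f x * fine.wt x v w u)) \<le> real C' ^ 3" for x v w u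
  proof -
    have "f x * fine.wt x v w u \<le> 1 * real C' ^ 3"
      using f fine.wt_le fine.wt_nonneg by (intro mult_mono) auto
    moreover have "0 \<le> f x * fine.wt x v w u" using f fine.wt_nonneg by (intro mult_nonneg_nonneg)
    ultimately show ?thesis unfolding norm_of_real by simp
  qed
  define J where "J \<xi> = M (\<lambda>x. M (\<lambda>y. A x * B y * ee p (\<xi> * (x * y))))" for \<xi>
  define c where "c \<xi> = complex_of_real (a' \<xi> / a' 0) * ee p (- (\<xi> * D))" for \<xi>
  have hn: "complex_of_real (hn (x * y - D)) = (\<Sum>\<xi>\<in>Z p. c \<xi> * ee p (\<xi> * (x * y)))" for x y
    unfolding hn_def of_real_divide kernD(8)[OF fine.k1] sum_divide_distrib c_def
  proof (intro sum.cong refl)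
    fix \<xi>
    have "ee p (\<xi> * (x * y - D)) = ee p (- (\<xi> * D)) * ee p (\<xi> * (x * y))"
      unfolding ee_add[symmetric] by (rule arg_cong[where f = "ee p"]) (simp add: algebra_simps)
    thus "complex_of_real (a' \<xi>) * ee p (\<xi> * (x * y - D)) / complex_of_real (a' 0) =
       complex_of_real (a' \<xi>) / complex_of_real (a' 0) * ee p (- (\<xi> * D)) * ee p (\<xi> * (x * y))"
      by simp
  qed
  let ?T = "M (\<lambda>x. M (\<lambda>y. f x * f y * W x y v v' D w w' u u'))"
  have "complex_of_real ?T = M (\<lambda>x. M (\<lambda>y. \<Sum>\<xi>\<in>Z p. c \<xi> * (A x * B y * ee p (\<xi> * (x * y)))))"
    unfolding mean_of_real[symmetric]
  proof (intro mean_cong)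
    fix x y
    have "complex_of_real (f x * f y * W x y v v' D w w' u u') = A x * B y * complex_of_real (hn (x * y - D))"
      unfolding W_wt A_def B_def of_real_mult by (simp only: mult_ac)
    also have "\<dots> = (\<Sum>\<xi>\<in>Z p. c \<xi> * (A x * B y * ee p (\<xi> * (x * y))))"
      unfolding hn sum_distrib_left by (simp only: mult_ac)
    finally show "complex_of_real (f x * f y * W x y v v' D w w' u u') = \<dots>" .
  qed
  also have "\<dots> = (\<Sum>\<xi>\<in>Z p. c \<xi> * J \<xi>)" unfolding mean_sum mean_mult_left J_def ..
  also have "\<dots> = c 0 * J 0 + (\<Sum>\<xi>\<in>Z p - {0}. c \<xi> * J \<xi>)" using p_pos by (intro sum.remove) auto
  also have "c 0 * J 0 = complex_of_real (fine.sm f v w u * fine.sm f v' w' u')"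
  proof -
    have "c 0 = 1" using fine.pos by (simp add: c_def)
    moreover have "J 0 = M A * M B" unfolding J_def mean_mult by simp
    moreover have "M A = complex_of_real (fine.sm f v w u)" "M B = complex_of_real (fine.sm f v' w' u')"
      unfolding A_def B_def mean_of_real fine.sm_def by (simp_all only: mult.commute)
    ultimately show ?thesis by simp
  qed
  finally have e: "complex_of_real (?T - fine.sm f v w u * fine.sm f v' w' u') = (\<Sum>\<xi>\<in>Z p - {0}. c \<xi> * J \<xi>)"
    by simp
  have "\<bar>?T - fine.sm f v w u * fine.sm f v' w' u'\<bar> = cmod (\<Sum>\<xi>\<in>Z p - {0}. c \<xi> * J \<xi>)"
    unfolding e[symmetric] by (simp only: norm_of_real)
  also have "\<dots> \<le> (\<Sum>\<xi>\<in>Z p - {0}. a' \<xi> * (real C' * ((real C' ^ 3)\<^sup>2 * sqrt tau)))"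
  proof (rule sum_norm_le)
    fix \<xi> assume \<xi>: "\<xi> \<in> Z p - {0}"
    have "cmod (J \<xi>) \<le> (real C' ^ 3)\<^sup>2 * sqrt tau"
      unfolding J_def A_def B_def
      by (rule bilinear_additive_scaled[OF Z_nonzero[OF \<xi>]]) (use C'1 bnd in auto)
    moreover have "cmod (c \<xi>) \<le> a' \<xi> * real C'"
    proof -
      have "1 / a' 0 \<le> real C'" using kern_mean_ge[OF fine.k1] fine.pos by (simp add: field_simps)
      hence "a' \<xi> * (1 / a' 0) \<le> a' \<xi> * real C'" using kernD(2)[OF fine.k1] by (intro mult_left_mono)
      moreover have "cmod (c \<xi>) = a' \<xi> * (1 / a' 0)"
        using kernD(2)[OF fine.k1, of \<xi>] fine.pos unfolding c_def norm_mult cmod_ee norm_of_real by simp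
      ultimately show ?thesis by simp
    qed
    ultimately have "cmod (c \<xi>) * cmod (J \<xi>) \<le> (a' \<xi> * real C') * ((real C' ^ 3)\<^sup>2 * sqrt tau)"
      using kernD(2)[OF fine.k1, of \<xi>] by (intro mult_mono) auto
    thus "cmod (c \<xi> * J \<xi>) \<le> a' \<xi> * (real C' * ((real C' ^ 3)\<^sup>2 * sqrt tau))"
      by (simp only: norm_mult mult.assoc)
  qed
  also have "\<dots> \<le> (\<Sum>\<xi>\<in>Z p. a' \<xi> * (real C' * ((real C' ^ 3)\<^sup>2 * sqrt tau)))"
    using kernD(2)[OF fine.k1] tau_nonneg by (intro sum_mono2) auto
  also have "\<dots> = real C' ^ 7 * sqrt tau"
    unfolding sum_distrib_right[symmetric] kernD(5)[OF fine.k1] by (simp add: power2_eq_square power_add[symmetric] power_Suc[symmetric] del: power_Suc)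
  finally show ?thesis by linarith
qed

end

text \<open>\<open>e1\<close> and \<open>e2\<close> are the coefficients of constant kernels, so \<open>F\<close> ignores the multiplicative and
  \<open>G\<close> the quadratic position.\<close>

locale colour_setup = prime_modulus p +
  F: coarse_fine p C a H a H e1 "\<lambda>_. 1" C' a' H' b' P' s +
  G: coarse_fine p C a H e2 "\<lambda>_. 1" b P C' a' H' b' P' s
  for p C a H e1 e2 b P C' a' H' b' P' s +
  assumes tau_C: "tau * real C ^ 3 \<le> 1"
begin

definition Fs :: "(int \<Rightarrow> real) \<Rightarrow> int \<Rightarrow> int \<Rightarrow> real" where "Fs f v w = F.coarse.sm f v w 0"
definition Gs :: "(int \<Rightarrow> real) \<Rightarrow> int \<Rightarrow> int \<Rightarrow> real" where "Gs f v u = G.coarse.sm f v 0 u"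

lemma F_sm: "F.coarse.sm f v w u = Fs f v w"
  by (simp add: Fs_def F.coarse.sm_def F.coarse.wt_def)

lemma G_sm: "G.coarse.sm f v w u = Gs f v u"
  by (simp add: Gs_def G.coarse.sm_def G.coarse.wt_def)

definition cfg :: "real \<Rightarrow> real \<Rightarrow> (int \<Rightarrow> real) \<Rightarrow> int \<Rightarrow> int \<Rightarrow> int \<Rightarrow> int \<Rightarrow> int \<Rightarrow> int \<Rightarrow> int \<Rightarrow> bool" where
  "cfg m \<kappa> f v v' D w w' u u' \<longleftrightarrow> m \<le> F.fine.sm f v w u \<and> m \<le> F.fine.sm f v' w' u' \<and>
     \<kappa> \<le> Fs f (v + v') (w + w' + 2 * D) \<and> \<kappa> \<le> Gs f D (u + u')"

text \<open>The count is averaged over fine positions of x, y and xy. At a position in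
  \<open>cfg\<close> both smoothings are at least \<kappa>, and \<open>weighted_pairs_ge\<close>
  bounds the mass of pairs. Moving the smoothings between positions and actual points costs 18 s
  C^3, where 18 is twice 6 + 3 because the smoothings are bounded by 2. The 8 tau covers x = 0 or y
  = 0, where the summand is at most 4 and \<open>ind\<close> need not be additive.\<close>

lemma structured_count_ge:
  assumes f: "\<And>x. 0 \<le> f x" "\<And>x. f x \<le> (1::real)" and \<kappa>: "\<kappa> \<ge> 0" and m: "m \<ge> 0" "real C' ^ 7 * sqrt tau \<le> m\<^sup>2"
  shows "\<kappa>\<^sup>2 * (m\<^sup>2 - real C' ^ 7 * sqrt tau) * E7 (\<lambda>v v' D w w' u u'. of_bool (cfg m \<kappa> f v v' D w w' u u')) - 18 * s * real C ^ 3 - 8 * tau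
    \<le> M (\<lambda>x. M (\<lambda>y. f x * f y * Fs f (x + y) ((x + y)\<^sup>2) * Gs f (x * y) (ind (x * y))))"
proof -
  have f': "\<bar>f x\<bar> \<le> 1" for x using f[of x] by simp
  have F0: "0 \<le> Fs f v w" for v w unfolding Fs_def by (intro F.coarse.sm_nonneg f)
  have G0: "0 \<le> Gs f v u" for v u unfolding Gs_def by (intro G.coarse.sm_nonneg f)
  have F2: "Fs f v w \<le> 2" for v w unfolding Fs_def using F.coarse.sm_le[of f v w 0, OF f(2)] tau_C by linarith
  have G2: "Gs f v u \<le> 2" for v u unfolding Gs_def using G.coarse.sm_le[of f v 0 u, OF f(2)] tau_C by linarith
  have ff: "0 \<le> f x * f y" "f x * f y \<le> 1" for x y using f by (auto simp: mult_le_one)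
  let ?T = "\<lambda>x y. f x * f y * Fs f (x + y) ((x + y)\<^sup>2) * Gs f (x * y) (ind (x * y))"
  let ?T' = "\<lambda>x y. f x * f y * (Fs f (x + y) ((x + y)\<^sup>2) * Gs f (x * y) (ind x + ind y))"
  have T': "?T' x y \<le> 4" for x y
  proof -
    have "f x * f y * (Fs f (x + y) ((x + y)\<^sup>2) * Gs f (x * y) (ind x + ind y)) \<le> 1 * (2 * 2)"
      using ff F0 G0 F2 G2 by (intro mult_mono) auto
    thus ?thesis by simp
  qed
  have T0: "0 \<le> ?T x y" for x y using f F0 G0 by (intro mult_nonneg_nonneg)
  have A: "M (\<lambda>x. M (\<lambda>y. ?T' x y)) \<le> M (\<lambda>x. M (\<lambda>y. ?T x y)) + 8 * tau"
  proof -
    let ?o = "\<lambda>x::int. if x = 0 then 1 else 0 :: real"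
    have mo: "M ?o = 1 / real p" using of_bool_mean_single[of p 0 "1::real"] p_pos by (simp add: divide_inverse)
    have "M (\<lambda>x. M (\<lambda>y. ?T' x y)) \<le> M (\<lambda>x. M (\<lambda>y. ?T x y + (4 * ?o x + 4 * ?o y)))"
    proof (intro mean_mono)
      fix x y assume xy: "x \<in> Z p" "y \<in> Z p"
      show "?T' x y \<le> ?T x y + (4 * ?o x + 4 * ?o y)"
      proof (cases "x = 0 \<or> y = 0")
        case True
        thus ?thesis using T'[of x y] T0[of x y] by auto
      next
        case False
        hence "\<not> int p dvd x" "\<not> int p dvd y" using xy Z_nonzero by auto
        hence "Gs f (x * y) (ind x + ind y) = Gs f (x * y) (ind (x * y))"
          unfolding Gs_def by (intro G.coarse.sm_cong cong_refl cong_sym[OF ind_mult])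
        thus ?thesis using False by simp
      qed
    qed
    also have "\<dots> = M (\<lambda>x. M (\<lambda>y. ?T x y)) + (4 * M ?o + 4 * M ?o)"
      by (simp only: mean_add mean_mult_left mean_const[OF finite_atLeastLessThan_int Zp_ne(1)])
    finally show ?thesis unfolding mo using inverse_p_le_tau by simp
  qed
  have B: "E7 (\<lambda>v v' D w w' u u'. F.W x y v v' D w w' u u' * (Fs f (v + v') (w + w' + 2 * D) * Gs f D (u + u')))
     \<le> Fs f (x + y) ((x + y)\<^sup>2) * Gs f (x * y) (ind x + ind y) + 18 * s * real C ^ 3" for x y
  proof -
    let ?F = "Fs f (x + y) ((x + y)\<^sup>2)" and ?G = "Gs f (x * y) (ind x + ind y)"
    have "E7 (\<lambda>v v' D w w' u u'. F.W x y v v' D w w' u u' * (Fs f (v + v') (w + w' + 2 * D) * Gs f D (u + u')))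
      \<le> E7 (\<lambda>v v' D w w' u u'. (?F * ?G) * F.W x y v v' D w w' u u' +
          (2 * (F.W x y v v' D w w' u u' * \<bar>Fs f (v + v') (w + w' + 2 * D) - ?F\<bar>) +
           2 * (F.W x y v v' D w w' u u' * \<bar>Gs f D (u + u') - ?G\<bar>)))"
    proof (intro mean_mono)
      fix v v' D w w' u u'
      let ?f = "Fs f (v + v') (w + w' + 2 * D)" and ?g = "Gs f D (u + u')"
      have "?f * ?g = ?F * ?G + ((?f - ?F) * ?g + ?F * (?g - ?G))" by (simp add: algebra_simps)
      moreover have "(?f - ?F) * ?g \<le> \<bar>?f - ?F\<bar> * 2"
        using mult_mono[OF abs_ge_self G2[of D "u + u'"] abs_ge_zero G0[of D "u + u'"]] .
      moreover have "?F * (?g - ?G) \<le> 2 * \<bar>?g - ?G\<bar>"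
        using order_trans[OF mult_left_mono[OF abs_ge_self F0[of "x + y" "(x + y)\<^sup>2"]]
          mult_right_mono[OF F2[of "x + y" "(x + y)\<^sup>2"] abs_ge_zero]] .
      ultimately have "?f * ?g \<le> ?F * ?G + (2 * \<bar>?f - ?F\<bar> + 2 * \<bar>?g - ?G\<bar>)" by linarith
      from mult_left_mono[OF this F.W_nonneg[of x y v v' D w w' u u']]
      show "F.W x y v v' D w w' u u' * (?f * ?g) \<le> (?F * ?G) * F.W x y v v' D w w' u u' +
          (2 * (F.W x y v v' D w w' u u' * \<bar>?f - ?F\<bar>) + 2 * (F.W x y v v' D w w' u u' * \<bar>?g - ?G\<bar>))"
        by (simp only: distrib_left mult_ac)
    qed
    also have "\<dots> = (?F * ?G) * E7 (F.W x y) +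
       (2 * E7 (\<lambda>v v' D w w' u u'. F.W x y v v' D w w' u u' * \<bar>Fs f (v + v') (w + w' + 2 * D) - ?F\<bar>) +
        2 * E7 (\<lambda>v v' D w w' u u'. F.W x y v v' D w w' u u' * \<bar>Gs f D (u + u') - ?G\<bar>))"
      by (simp only: mean_add mean_mult_left)
    also have "\<dots> \<le> (?F * ?G) * 1 + (2 * (6 * s * real C ^ 3) + 2 * (3 * s * real C ^ 3))"
      unfolding F.E7_W
      using F.sum_position_error[of f x y 0, OF f'] G.product_position_error[of f x y 0, OF f']
        mult_nonneg_nonneg[OF F0 G0]
      unfolding F_sm G_sm by (intro add_mono mult_left_mono) auto
    finally show ?thesis by simp
  qed
  have "\<kappa>\<^sup>2 * (m\<^sup>2 - real C' ^ 7 * sqrt tau) * E7 (\<lambda>v v' D w w' u u'. of_bool (cfg m \<kappa> f v v' D w w' u u')) =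
     E7 (\<lambda>v v' D w w' u u'. \<kappa>\<^sup>2 * (m\<^sup>2 - real C' ^ 7 * sqrt tau) * of_bool (cfg m \<kappa> f v v' D w w' u u'))"
    by (simp only: mean_mult_left)
  also have "\<dots> \<le> E7 (\<lambda>v v' D w w' u u'. M (\<lambda>x. M (\<lambda>y. f x * f y * (F.W x y v v' D w w' u u' * (Fs f (v + v') (w + w' + 2 * D) * Gs f D (u + u'))))))"
  proof (intro mean_mono)
    fix v v' D w w' u u'
    let ?f = "Fs f (v + v') (w + w' + 2 * D)" and ?g = "Gs f D (u + u')"
    let ?S = "M (\<lambda>x. M (\<lambda>y. f x * f y * F.W x y v v' D w w' u u'))"
    have S0: "0 \<le> ?S" by (intro mean_nonneg mult_nonneg_nonneg F.W_nonneg f)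
    have eq: "M (\<lambda>x. M (\<lambda>y. f x * f y * (F.W x y v v' D w w' u u' * (?f * ?g)))) = (?f * ?g) * ?S"
      unfolding mean_mult_left[symmetric] by (simp only: mult_ac)
    show "\<kappa>\<^sup>2 * (m\<^sup>2 - real C' ^ 7 * sqrt tau) * of_bool (cfg m \<kappa> f v v' D w w' u u') \<le> M (\<lambda>x. M (\<lambda>y. f x * f y * (F.W x y v v' D w w' u u' * (?f * ?g))))"
      unfolding eq
    proof (cases "cfg m \<kappa> f v v' D w w' u u'")
      case True
      hence t: "m \<le> F.fine.sm f v w u" "m \<le> F.fine.sm f v' w' u'" "\<kappa> \<le> ?f" "\<kappa> \<le> ?g" by (auto simp: cfg_def)
      have "m * m \<le> F.fine.sm f v w u * F.fine.sm f v' w' u'" using t m by (intro mult_mono) auto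
      hence "m\<^sup>2 - real C' ^ 7 * sqrt tau \<le> ?S"
        using F.weighted_pairs_ge[of f v w u v' w' u' D, OF f] by (simp add: power2_eq_square)
      moreover have "\<kappa> * \<kappa> \<le> ?f * ?g" using t \<kappa> by (intro mult_mono) auto
      ultimately have "(\<kappa> * \<kappa>) * (m\<^sup>2 - real C' ^ 7 * sqrt tau) \<le> (?f * ?g) * ?S"
        using F0 G0 m t \<kappa> by (intro mult_mono) auto
      thus "\<kappa>\<^sup>2 * (m\<^sup>2 - real C' ^ 7 * sqrt tau) * of_bool (cfg m \<kappa> f v v' D w w' u u') \<le> (?f * ?g) * ?S"
        using True by (simp add: power2_eq_square)
    next
      case False
      have "0 \<le> (?f * ?g) * ?S" using F0 G0 S0 by (intro mult_nonneg_nonneg)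
      thus "\<kappa>\<^sup>2 * (m\<^sup>2 - real C' ^ 7 * sqrt tau) * of_bool (cfg m \<kappa> f v v' D w w' u u') \<le> (?f * ?g) * ?S"
        using False by simp
    qed
  qed
  also have "\<dots> = M (\<lambda>x. M (\<lambda>y. f x * f y * E7 (\<lambda>v v' D w w' u u'. F.W x y v v' D w w' u u' * (Fs f (v + v') (w + w' + 2 * D) * Gs f D (u + u')))))"
  proof -
    have "M (\<lambda>x. M (\<lambda>y. E7 (X x y))) = E7 (\<lambda>v v' D w w' u u'. M (\<lambda>x. M (\<lambda>y. X x y v v' D w w' u u')))" for X
      unfolding M_E7_swap ..
    note this[of "\<lambda>x y v v' D w w' u u'. f x * f y * (F.W x y v v' D w w' u u' * (Fs f (v + v') (w + w' + 2 * D) * Gs f D (u + u')))"]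
    thus ?thesis by (simp only: mean_mult_left)
  qed
  also have "\<dots> \<le> M (\<lambda>x. M (\<lambda>y. ?T' x y + 18 * s * real C ^ 3))"
  proof (intro mean_mono)
    fix x y
    have s: "0 \<le> 18 * s * real C ^ 3" using F.s0 by simp
    have "f x * f y * E7 (\<lambda>v v' D w w' u u'. F.W x y v v' D w w' u u' * (Fs f (v + v') (w + w' + 2 * D) * Gs f D (u + u')))
      \<le> f x * f y * (Fs f (x + y) ((x + y)\<^sup>2) * Gs f (x * y) (ind x + ind y) + 18 * s * real C ^ 3)"
      by (intro mult_left_mono B ff)
    also have "\<dots> \<le> ?T' x y + 18 * s * real C ^ 3"
      unfolding distrib_left[of "f x * f y"] using ff[of x y] s by (intro add_left_mono mult_left_le_one_le) auto
    finally show "f x * f y * E7 (\<lambda>v v' D w w' u u'. F.W x y v v' D w w' u u' * (Fs f (v + v') (w + w' + 2 * D) * Gs f D (u + u'))) \<le> ?T' x y + 18 * s * real C ^ 3" .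
  qed
  also have "\<dots> = M (\<lambda>x. M (\<lambda>y. ?T' x y)) + 18 * s * real C ^ 3"
    by (simp only: mean_add mean_const[OF finite_atLeastLessThan_int Zp_ne(1)])
  finally show ?thesis using A by linarith
qed

text \<open>The fine densities of the colours sum to at least 3/4, so one of them is at least m. The
  position can be bad only if one of the two coarse smoothings of that colour is below \<kappa>, an
  event bounded by \<open>rarely_below\<close>. The factor is 2r/m, for two smoothings, r colours
  and division by m.\<close>

lemma mean_bad_positions_le:
  assumes r: "r > 0" and f: "\<And>i x. 0 \<le> f i x" "\<And>i x. f i x \<le> (1::real)" "\<And>x. (\<Sum>i<r. f i x) = 1"
    and \<kappa>: "\<kappa> > 0" and t: "tau * real C' ^ 3 \<le> 1 / 4" and m: "m = 3 / (4 * real r)"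
  shows "M (\<lambda>v. M (\<lambda>w. mean (Z q) (\<lambda>u. of_bool (\<not> (\<exists>i<r. m \<le> F.fine.sm (f i) v w u \<and> \<kappa> \<le> Fs (f i) v w \<and> \<kappa> \<le> Gs (f i) v u)))))
    \<le> (8 * (real r)\<^sup>2 / 3) * (2 * \<kappa> + 3 * s * real C ^ 3 / \<kappa>)"
proof -
  let ?E = "\<lambda>X. M (\<lambda>v. M (\<lambda>w. mean (Z q) (\<lambda>u. X v w u :: real)))"
  let ?M = "\<lambda>i v w u. F.fine.sm (f i) v w u"
  have m0: "m > 0" using r m by simp
  have M0: "0 \<le> ?M i v w u" for i v w u by (intro F.fine.sm_nonneg f)
  have tot: "(\<Sum>i<r. ?M i v w u) \<ge> 3 / 4" for v w u
  proof -
    have "(\<Sum>i<r. ?M i v w u) = M (\<lambda>x. F.fine.wt x v w u)"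
      unfolding F.fine.sm_def mean_sum[symmetric] sum_distrib_left[symmetric] f(3) by simp
    thus ?thesis using F.fine.wt_mean[of v w u] t by linarith
  qed
  have "?E (\<lambda>v w u. of_bool (\<not> (\<exists>i<r. m \<le> ?M i v w u \<and> \<kappa> \<le> Fs (f i) v w \<and> \<kappa> \<le> Gs (f i) v u)))
     \<le> ?E (\<lambda>v w u. \<Sum>i<r. (1 / m) * (?M i v w u * of_bool (F.coarse.sm (f i) v w u < \<kappa>) + ?M i v w u * of_bool (G.coarse.sm (f i) v w u < \<kappa>)))"
  proof (intro mean_mono)
    fix v w u
    let ?g = "\<lambda>i. (1 / m) * (?M i v w u * of_bool (F.coarse.sm (f i) v w u < \<kappa>) + ?M i v w u * of_bool (G.coarse.sm (f i) v w u < \<kappa>))"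
    have g0: "0 \<le> ?g i" for i using m0 M0 by simp
    show "of_bool (\<not> (\<exists>i<r. m \<le> ?M i v w u \<and> \<kappa> \<le> Fs (f i) v w \<and> \<kappa> \<le> Gs (f i) v u)) \<le> (\<Sum>i<r. ?g i)"
    proof (cases "\<exists>i<r. m \<le> ?M i v w u \<and> \<kappa> \<le> Fs (f i) v w \<and> \<kappa> \<le> Gs (f i) v u")
      case True
      thus ?thesis using g0 by (simp add: sum_nonneg)
    next
      case False
      obtain i where i: "i < r" "m \<le> ?M i v w u"
      proof (rule ccontr)
        assume "\<not> thesis"
        hence "\<forall>i\<in>{..<r}. ?M i v w u < m" using that by force
        hence "(\<Sum>i<r. ?M i v w u) < (\<Sum>i<r. m)" using r by (intro sum_strict_mono) auto
        also have "\<dots> = 3 / 4" using r by (simp add: m)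
        finally show False using tot[of v w u] by simp
      qed
      hence "Fs (f i) v w < \<kappa> \<or> Gs (f i) v u < \<kappa>" using False by force
      hence "1 \<le> (of_bool (F.coarse.sm (f i) v w u < \<kappa>) + of_bool (G.coarse.sm (f i) v w u < \<kappa>) :: real)"
        unfolding F_sm G_sm by auto
      hence "m * 1 \<le> ?M i v w u * (of_bool (F.coarse.sm (f i) v w u < \<kappa>) + of_bool (G.coarse.sm (f i) v w u < \<kappa>))"
        using i M0 m0 by (intro mult_mono) auto
      hence "1 \<le> ?g i" using m0 by (simp add: field_simps)
      also have "\<dots> \<le> (\<Sum>i<r. ?g i)" using i g0 by (intro member_le_sum) auto
      finally show ?thesis using False by simp
    qed
  qed
  also have "\<dots> = (\<Sum>i<r. (1 / m) * (?E (\<lambda>v w u. ?M i v w u * of_bool (F.coarse.sm (f i) v w u < \<kappa>)) + ?E (\<lambda>v w u. ?M i v w u * of_bool (G.coarse.sm (f i) v w u < \<kappa>))))"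
    by (simp only: mean_sum mean_mult_left mean_add)
  also have "\<dots> \<le> (\<Sum>i<r. (1 / m) * ((2 * \<kappa> + 3 * s * real C ^ 3 / \<kappa>) + (2 * \<kappa> + 3 * s * real C ^ 3 / \<kappa>)))"
    using m0 by (intro sum_mono mult_left_mono add_mono F.rarely_below G.rarely_below f \<kappa>) auto
  also have "\<dots> = (8 * (real r)\<^sup>2 / 3) * (2 * \<kappa> + 3 * s * real C ^ 3 / \<kappa>)"
    using r by (simp add: m power2_eq_square field_simps)
  finally show ?thesis .
qed

end

text \<open>c is fixed before C, since m, \<kappa> and the Ramsey constants depend on r only. The
  fine scale s and its complexity C' are chosen after C, and wherever C' appears, taking
  \<open>tau\<close> small compensates.\<close>

lemma smoothed_count_ge:
  fixes r :: nat
  assumes r: "r \<ge> 1"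
  shows "\<exists>c>(0::real). \<forall>C. \<exists>t>(0::real). \<forall>p a H b P f. prime_modulus p \<longrightarrow> prime_modulus.tau p \<le> t \<longrightarrow>
    kern p C a H \<longrightarrow> kern (prime_modulus.q p) C b P \<longrightarrow>
    (\<forall>i x. 0 \<le> f i x \<and> f i x \<le> (1::real)) \<longrightarrow> (\<forall>x. (\<Sum>i<r. f i x) = 1) \<longrightarrow>
    c \<le> (\<Sum>i<r. mean (Z p) (\<lambda>x. mean (Z p) (\<lambda>y. f i x * f i y *
      smoothing.sm p a H a H (\<lambda>\<kappa>. if int (prime_modulus.q p) dvd \<kappa> then 1 else 0) (\<lambda>_. 1) (f i) (x + y) ((x + y)\<^sup>2) 0 *
      smoothing.sm p a H (\<lambda>\<kappa>. if int p dvd \<kappa> then 1 else 0) (\<lambda>_. 1) b P (f i) (x * y) 0 (prime_modulus.ind p (x * y)))))"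
proof -
  have r0: "real r > 0" using r by simp
  obtain \<beta> cR :: real where \<beta>: "\<beta> > 0" and cR: "cR > 0"
    and ramsey: "\<forall>p q A B G. p > 0 \<longrightarrow> q > 0 \<longrightarrow>
     (\<forall>i v v' w w' u u'. [v = v'] (mod int p) \<longrightarrow> [w = w'] (mod int p) \<longrightarrow> [u = u'] (mod int q) \<longrightarrow>
         A i v w u = A i v' w' u' \<and> B i v w = B i v' w' \<and> G i v u = G i v' u') \<longrightarrow>
     mean (Z p) (\<lambda>v. mean (Z p) (\<lambda>w. mean (Z q) (\<lambda>u. of_bool (\<not> (\<exists>i<r. A i v w u \<and> B i v w \<and> G i v u))))) \<le> \<beta> \<longrightarrow>
     cR \<le> (\<Sum>i<r. mean (Z p) (\<lambda>v. mean (Z p) (\<lambda>v'. mean (Z p) (\<lambda>D. mean (Z p) (\<lambda>w. mean (Z p) (\<lambda>w'.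
        mean (Z q) (\<lambda>u. mean (Z q) (\<lambda>u'. of_bool (A i v w u \<and> A i v' w' u' \<and> B i (v + v') (w + w' + 2 * D) \<and> G i D (u + u'))))))))))"
    using ramsey_positions[of r] by (elim exE conjE)
  define m where "m = 3 / (4 * real r)"
  \<comment> \<open>Makes the part of the bound in \<open>mean_bad_positions_le\<close> without s
    equal to \<beta>/2.\<close>
  define \<kappa> where "\<kappa> = 3 * \<beta> / (32 * (real r)\<^sup>2)"
  have m: "m > 0" and \<kappa>: "\<kappa> > 0" using r0 \<beta> by (simp_all add: m_def \<kappa>_def)
  \<comment> \<open>Half of the square of m is given up to the error
    \<open>real C' ^ 7 * sqrt tau\<close>.\<close>
  define c0 where "c0 = \<kappa>\<^sup>2 * (m\<^sup>2 / 2) * cR"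
  have c0: "c0 > 0" using m \<kappa> cR by (simp add: c0_def)
  show ?thesis
  proof (rule exI[of _ "c0 / 2"], rule conjI, use c0 in simp, rule allI)
    fix C0 :: nat
    define C where "C = max C0 1"
    have C: "real C ^ 3 > 0" by (simp add: C_def)
    \<comment> \<open>The first bound keeps the part with s in \<open>mean_bad_positions_le\<close>
      below \<beta>/2; the second keeps the total error 18 s C^3 over r colours below c0/4.\<close>
    define s where "s = min (\<beta> * \<kappa> / (16 * (real r)\<^sup>2 * real C ^ 3)) (c0 / (72 * real r * real C ^ 3))"
    have s: "s > 0" "s \<le> \<beta> * \<kappa> / (16 * (real r)\<^sup>2 * real C ^ 3)" "s \<le> c0 / (72 * real r * real C ^ 3)"
      using \<beta> \<kappa> r0 C c0 by (auto simp: s_def)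
    obtain C1 where C1: "\<forall>N \<Theta>. N > 0 \<longrightarrow> finite \<Theta> \<longrightarrow> card \<Theta> \<le> C \<longrightarrow>
       (\<exists>a H. kern N C1 a H \<and> (\<forall>\<theta>\<in>\<Theta>. (1 - s\<^sup>2 / 2) * a 0 \<le> a \<theta>))"
      using exists_kernel[of "s\<^sup>2 / 2" C] s(1) by auto
    define C' where "C' = max C1 1"
    have C': "real C' > 0" by (simp add: C'_def)
    define t where "t = Min {1 / real C ^ 3, 1 / (4 * real C' ^ 3), (m\<^sup>2 / (2 * real C' ^ 7))\<^sup>2, c0 / (32 * real r)}"
    have t: "t \<le> 1 / real C ^ 3" "t \<le> 1 / (4 * real C' ^ 3)" "t \<le> (m\<^sup>2 / (2 * real C' ^ 7))\<^sup>2" "t \<le> c0 / (32 * real r)"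
      unfolding t_def by (intro Min_le; simp)+
    have t0: "t > 0" unfolding t_def using C C' m c0 r0 by (subst Min_gr_iff) auto
    show "\<exists>t>0. \<forall>p a H b P f. prime_modulus p \<longrightarrow> prime_modulus.tau p \<le> t \<longrightarrow>
    kern p C0 a H \<longrightarrow> kern (prime_modulus.q p) C0 b P \<longrightarrow>
    (\<forall>i x. 0 \<le> f i x \<and> f i x \<le> (1::real)) \<longrightarrow> (\<forall>x. (\<Sum>i<r. f i x) = 1) \<longrightarrow>
    c0 / 2 \<le> (\<Sum>i<r. mean (Z p) (\<lambda>x. mean (Z p) (\<lambda>y. f i x * f i y *
      smoothing.sm p a H a H (\<lambda>\<kappa>. if int (prime_modulus.q p) dvd \<kappa> then 1 else 0) (\<lambda>_. 1) (f i) (x + y) ((x + y)\<^sup>2) 0 *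
      smoothing.sm p a H (\<lambda>\<kappa>. if int p dvd \<kappa> then 1 else 0) (\<lambda>_. 1) b P (f i) (x * y) 0 (prime_modulus.ind p (x * y)))))"
    proof (rule exI[of _ t], rule conjI[OF t0], intro allI impI)
      fix p a H b P and f :: "nat \<Rightarrow> int \<Rightarrow> real"
      assume pm: "prime_modulus p" and tau: "prime_modulus.tau p \<le> t" and aH0: "kern p C0 a H"
        and bP0: "kern (prime_modulus.q p) C0 b P" and fb: "\<forall>i x. 0 \<le> f i x \<and> f i x \<le> 1" and fs: "\<forall>x. (\<Sum>i<r. f i x) = 1"
      interpret prime_modulus p by (rule pm)
      have "C0 \<le> C" by (simp add: C_def)
      hence aH: "kern p C a H" and bP: "kern q C b P" using aH0 bP0 kern_weaken by blast+
      have "C1 \<le> C'" by (simp add: C'_def)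
      obtain a' H' where aH': "kern p C' a' H'" "\<forall>\<theta>\<in>{\<xi> \<in> Z p. a \<xi> \<noteq> 0}. (1 - s\<^sup>2 / 2) * a' 0 \<le> a' \<theta>"
      proof -
        have fin: "finite {\<xi> \<in> Z p. a \<xi> \<noteq> 0}" by (rule finite_subset[of _ "Z p"]) auto
        have cd: "card {\<xi> \<in> Z p. a \<xi> \<noteq> 0} \<le> C" by (rule kernD(6)[OF aH])
        show ?thesis using C1[rule_format, OF p_pos fin cd] kern_weaken[OF _ \<open>C1 \<le> C'\<close>] that by blast
      qed
      obtain b' P' where bP': "kern q C' b' P'" "\<forall>\<theta>\<in>{\<xi> \<in> Z q. b \<xi> \<noteq> 0}. (1 - s\<^sup>2 / 2) * b' 0 \<le> b' \<theta>"
      proof -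
        have fin: "finite {\<xi> \<in> Z q. b \<xi> \<noteq> 0}" by (rule finite_subset[of _ "Z q"]) auto
        have cd: "card {\<xi> \<in> Z q. b \<xi> \<noteq> 0} \<le> C" by (rule kernD(6)[OF bP])
        show ?thesis using C1[rule_format, OF q_pos fin cd] kern_weaken[OF _ \<open>C1 \<le> C'\<close>] that by blast
      qed
      define e1 where "e1 = (\<lambda>\<kappa>. if int q dvd \<kappa> then 1 else 0 :: real)"
      define e2 where "e2 = (\<lambda>\<kappa>. if int p dvd \<kappa> then 1 else 0 :: real)"
      have C1': "C \<ge> 1" by (simp add: C_def)
      have ke1: "kern q C e1 (\<lambda>_. 1)" unfolding e1_def by (rule kern_one_exists[OF q_pos C1'])
      have ke2: "kern p C e2 (\<lambda>_. 1)" unfolding e2_def by (rule kern_one_exists[OF p_pos C1'])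
      have sq: "sqrt (2 * (s\<^sup>2 / 2)) = s" using s(1) by simp
      have na: "M (\<lambda>v. H' v * cmod (1 - ee p (\<xi> * v))) \<le> s * a' 0" if "\<xi> \<in> Z p" "a \<xi> \<noteq> 0" for \<xi>
        using kern_close[OF aH'(1), of "s\<^sup>2 / 2" \<xi>] aH'(2) that unfolding sq by blast
      have nb: "mean (Z q) (\<lambda>v. P' v * cmod (1 - ee q (\<xi> * v))) \<le> s * b' 0" if "\<xi> \<in> Z q" "b \<xi> \<noteq> 0" for \<xi>
        using kern_close[OF bP'(1), of "s\<^sup>2 / 2" \<xi>] bP'(2) that unfolding sq by blast
      have n1: "mean (Z q) (\<lambda>v. P' v * cmod (1 - ee q (\<xi> * v))) \<le> s * b' 0" if "\<xi> \<in> Z q" "e1 \<xi> \<noteq> 0" for \<xi>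
      proof -
        have "int q dvd \<xi>" using that(2) by (simp add: e1_def split: if_splits)
        hence "\<xi> = 0" using that(1) zdvd_imp_le[of "int q" \<xi>] by force
        thus ?thesis using s(1) kernD(2)[OF bP'(1)] by simp
      qed
      have n2: "M (\<lambda>v. H' v * cmod (1 - ee p (\<xi> * v))) \<le> s * a' 0" if "\<xi> \<in> Z p" "e2 \<xi> \<noteq> 0" for \<xi>
      proof -
        have "int p dvd \<xi>" using that(2) by (simp add: e2_def split: if_splits)
        hence "\<xi> = 0" using that(1) zdvd_imp_le[of "int p" \<xi>] by force
        thus ?thesis using s(1) kernD(2)[OF aH'(1)] by simp
      qed
      have tau1: "tau \<le> 1 / real C ^ 3" "tau \<le> 1 / (4 * real C' ^ 3)" "tau \<le> (m\<^sup>2 / (2 * real C' ^ 7))\<^sup>2" "tau \<le> c0 / (32 * real r)"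
        using tau t by linarith+
      have tc: "tau * real C ^ 3 \<le> 1" using tau1(1) C by (simp add: field_simps)
      have tc': "tau * real C' ^ 3 \<le> 1 / 4" using tau1(2) C' by (simp add: field_simps)
      have tm: "real C' ^ 7 * sqrt tau \<le> m\<^sup>2 / 2"
      proof -
        have "sqrt tau \<le> m\<^sup>2 / (2 * real C' ^ 7)" by (rule real_le_lsqrt) (use tau1(3) C' in auto)
        thus ?thesis using C' by (simp add: field_simps)
      qed
      interpret S: colour_setup p C a H e1 e2 b P C' a' H' b' P' s
        by unfold_locales (use aH bP ke1 ke2 aH'(1) bP'(1) na nb n1 n2 s(1) tc in auto)
      have f0: "0 \<le> f i x" and f1: "f i x \<le> 1" for i x using fb by auto
      have bad: "M (\<lambda>v. M (\<lambda>w. mean (Z q) (\<lambda>u. of_bool (\<not> (\<exists>i<r. m \<le> S.F.fine.sm (f i) v w u \<and> \<kappa> \<le> S.Fs (f i) v w \<and> \<kappa> \<le> S.Gs (f i) v u))))) \<le> \<beta>"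
      proof -
        have "M (\<lambda>v. M (\<lambda>w. mean (Z q) (\<lambda>u. of_bool (\<not> (\<exists>i<r. m \<le> S.F.fine.sm (f i) v w u \<and> \<kappa> \<le> S.Fs (f i) v w \<and> \<kappa> \<le> S.Gs (f i) v u)))))
          \<le> (8 * (real r)\<^sup>2 / 3) * (2 * \<kappa> + 3 * s * real C ^ 3 / \<kappa>)"
          by (rule S.mean_bad_positions_le[OF _ _ _ _ \<kappa> tc' m_def]) (use r f0 f1 fs in auto)
        also have "\<dots> = \<beta> / 2 + (8 * (real r)\<^sup>2 * real C ^ 3 / \<kappa>) * s"
          using r0 by (simp add: \<kappa>_def distrib_left)
        also have "(8 * (real r)\<^sup>2 * real C ^ 3 / \<kappa>) * s \<le> (8 * (real r)\<^sup>2 * real C ^ 3 / \<kappa>) * (\<beta> * \<kappa> / (16 * (real r)\<^sup>2 * real C ^ 3))"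
          using C \<kappa> by (intro mult_left_mono s(2)) simp
        also have "\<dots> = \<beta> / 2" using C \<kappa> r0 by simp
        finally show ?thesis by simp
      qed
      let ?P = "\<lambda>i. E7 (\<lambda>v v' D w w' u u'. of_bool (S.cfg m \<kappa> (f i) v v' D w w' u u'))"
      have P: "cR \<le> (\<Sum>i<r. ?P i)"
      proof -
        have "\<forall>i v v' w w' u u'. [v = v'] (mod int p) \<longrightarrow> [w = w'] (mod int p) \<longrightarrow> [u = u'] (mod int q) \<longrightarrow>
         (m \<le> S.F.fine.sm (f i) v w u) = (m \<le> S.F.fine.sm (f i) v' w' u') \<and> (\<kappa> \<le> S.Fs (f i) v w) = (\<kappa> \<le> S.Fs (f i) v' w') \<and> (\<kappa> \<le> S.Gs (f i) v u) = (\<kappa> \<le> S.Gs (f i) v' u')"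
        proof (intro allI impI)
          fix i v v' w w' u u' assume c: "[v = v'] (mod int p)" "[w = w'] (mod int p)" "[u = u'] (mod int q)"
          show "(m \<le> S.F.fine.sm (f i) v w u) = (m \<le> S.F.fine.sm (f i) v' w' u') \<and> (\<kappa> \<le> S.Fs (f i) v w) = (\<kappa> \<le> S.Fs (f i) v' w') \<and> (\<kappa> \<le> S.Gs (f i) v u) = (\<kappa> \<le> S.Gs (f i) v' u')"
            using S.F.fine.sm_cong[OF c, of "f i"] S.F.coarse.sm_cong[OF c(1,2) cong_refl[of 0], of "f i"] S.G.coarse.sm_cong[OF c(1) cong_refl[of 0] c(3), of "f i"]
            unfolding S.Fs_def S.Gs_def by simp
        qed
        from ramsey[rule_format, OF p_pos q_pos _ bad, OF this[rule_format]]
        show ?thesis unfolding S.cfg_def .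
      qed
      have "c0 / 2 \<le> \<kappa>\<^sup>2 * (m\<^sup>2 - real C' ^ 7 * sqrt tau) * (\<Sum>i<r. ?P i) - real r * (18 * s * real C ^ 3) - real r * (8 * tau)"
      proof -
        have "c0 \<le> \<kappa>\<^sup>2 * (m\<^sup>2 - real C' ^ 7 * sqrt tau) * (\<Sum>i<r. ?P i)"
        proof -
          have "0 \<le> m\<^sup>2 - real C' ^ 7 * sqrt tau" using tm zero_le_power2[of m] by linarith
          thus ?thesis unfolding c0_def using tm P cR by (intro mult_mono) auto
        qed
        moreover have "real r * (18 * s * real C ^ 3) \<le> c0 / 4"
        proof -
          have "real r * (18 * s * real C ^ 3) = (18 * real r * real C ^ 3) * s" by simp
          also have "\<dots> \<le> (18 * real r * real C ^ 3) * (c0 / (72 * real r * real C ^ 3))"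
            using C r0 by (intro mult_left_mono s(3)) simp
          also have "\<dots> = c0 / 4" using C r0 by simp
          finally show ?thesis .
        qed
        moreover have "real r * (8 * tau) \<le> c0 / 4" using tau1(4) r0 by (simp add: field_simps)
        ultimately show ?thesis by simp
      qed
      also have "\<dots> = (\<Sum>i<r. \<kappa>\<^sup>2 * (m\<^sup>2 - real C' ^ 7 * sqrt tau) * ?P i - 18 * s * real C ^ 3 - 8 * tau)"
        by (simp add: sum_subtractf sum_distrib_left)
      also have "\<dots> \<le> (\<Sum>i<r. M (\<lambda>x. M (\<lambda>y. f i x * f i y * S.Fs (f i) (x + y) ((x + y)\<^sup>2) * S.Gs (f i) (x * y) (ind (x * y)))))"
      proof (rule sum_mono)
        fix i
        show "\<kappa>\<^sup>2 * (m\<^sup>2 - real C' ^ 7 * sqrt tau) * ?P i - 18 * s * real C ^ 3 - 8 * tau \<le> M (\<lambda>x. M (\<lambda>y. f i x * f i y * S.Fs (f i) (x + y) ((x + y)\<^sup>2) * S.Gs (f i) (x * y) (ind (x * y))))"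
        proof (rule S.structured_count_ge)
          show "real C' ^ 7 * sqrt tau \<le> m\<^sup>2" using tm zero_le_power2[of m] by linarith
        qed (use f0 f1 m \<kappa> in auto)
      qed
      finally show "c0 / 2 \<le> (\<Sum>i<r. M (\<lambda>x. M (\<lambda>y. f i x * f i y *
        smoothing.sm p a H a H (\<lambda>\<kappa>. if int q dvd \<kappa> then 1 else 0) (\<lambda>_. 1) (f i) (x + y) ((x + y)\<^sup>2) 0 *
        smoothing.sm p a H (\<lambda>\<kappa>. if int p dvd \<kappa> then 1 else 0) (\<lambda>_. 1) b P (f i) (x * y) 0 (ind (x * y)))))"
        unfolding S.Fs_def S.Gs_def unfolding e1_def e2_def .
    qed
  qed
qed

section \<open>From smoothed to true counts, and the case of small primes\<close>

lemma tau_tendsto: "(\<lambda>p. root 4 (4 / (real p - 1)) + 1 / real p) \<longlonglongrightarrow> 0"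
proof -
  have "(\<lambda>p::nat. 4 / (real p - 1)) \<longlonglongrightarrow> 0" "(\<lambda>p::nat. 1 / real p) \<longlonglongrightarrow> 0" by real_asymp+
  from tendsto_add[OF tendsto_real_root[OF this(1), of 4] this(2)] show ?thesis by simp
qed

lemma tau_small:
  assumes "t > 0"
  shows "\<exists>p0. \<forall>p\<ge>p0. prime_modulus p \<longrightarrow> prime_modulus.tau p \<le> t"
proof -
  have "eventually (\<lambda>p. root 4 (4 / (real p - 1)) + 1 / real p < t) sequentially"
    using tau_tendsto assms by (rule order_tendstoD)
  then obtain p0 where p0: "\<And>p. p \<ge> p0 \<Longrightarrow> root 4 (4 / (real p - 1)) + 1 / real p < t"
    by (auto simp: eventually_sequentially)
  show ?thesis
    using p0 by (intro exI[of _ p0] allI impI) (simp add: prime_modulus.tau_def less_imp_le)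
qed

text \<open>For each colour the function at x + y is smoothed first, while the one at xy is still
  the raw class; then the function at xy is smoothed, with the one at x + y already smooth. The
  accuracy is measured against c, which is available before any kernel is chosen.\<close>

lemma partition_count_ge:
  fixes r :: nat
  assumes r: "r \<ge> 1"
  shows "\<exists>c>(0::real). \<exists>t>(0::real). \<forall>p f. prime_modulus p \<longrightarrow> prime_modulus.tau p \<le> t \<longrightarrow>
    (\<forall>i. per p (f i)) \<longrightarrow> (\<forall>i x. 0 \<le> f i x \<and> f i x \<le> (1::real)) \<longrightarrow> (\<forall>x. (\<Sum>i<r. f i x) = 1) \<longrightarrow>
    c \<le> (\<Sum>i<r. mean (Z p) (\<lambda>x. mean (Z p) (\<lambda>y. f i x * f i y * f i (x + y) * f i (x * y))))"
proof -
  have r0: "real r > 0" using r by simp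
  obtain c :: real where c: "c > 0" and sc: "\<forall>C. \<exists>t>(0::real). \<forall>p a H b P f. prime_modulus p \<longrightarrow> prime_modulus.tau p \<le> t \<longrightarrow>
    kern p C a H \<longrightarrow> kern (prime_modulus.q p) C b P \<longrightarrow>
    (\<forall>i x. 0 \<le> f i x \<and> f i x \<le> (1::real)) \<longrightarrow> (\<forall>x. (\<Sum>i<r. f i x) = 1) \<longrightarrow>
    c \<le> (\<Sum>i<r. mean (Z p) (\<lambda>x. mean (Z p) (\<lambda>y. f i x * f i y *
      smoothing.sm p a H a H (\<lambda>\<kappa>. if int (prime_modulus.q p) dvd \<kappa> then 1 else 0) (\<lambda>_. 1) (f i) (x + y) ((x + y)\<^sup>2) 0 *
      smoothing.sm p a H (\<lambda>\<kappa>. if int p dvd \<kappa> then 1 else 0) (\<lambda>_. 1) b P (f i) (x * y) 0 (prime_modulus.ind p (x * y)))))"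
    using smoothed_count_ge[OF r] by (elim exE conjE)
  \<comment> \<open>The two replacements cost 3\<delta> and 6\<epsilon> per colour, each equal to
    c/(8r); 6 is 2 times 3, from rescaling the smoothing and the difference to 1-bounded
    functions.\<close>
  define \<epsilon> where "\<epsilon> = c / (48 * real r)"
  define \<delta> where "\<delta> = c / (24 * real r)"
  have \<epsilon>: "\<epsilon> > 0" and \<delta>: "\<delta> > 0" using c r0 by (simp_all add: \<epsilon>_def \<delta>_def)
  obtain \<eta>4 t4 :: real where \<eta>4: "\<eta>4 > 0" and t4: "t4 > 0" and prod: "\<forall>p. prime_modulus p \<longrightarrow> prime_modulus.tau p \<le> t4 \<longrightarrow>
    (\<forall>f1 f2 f g. per p f \<longrightarrow> per p g \<longrightarrow> (\<forall>x. cmod (f1 x) \<le> 1 \<and> cmod (f2 x) \<le> 1 \<and> cmod (f x) \<le> 1 \<and> cmod (g x) \<le> 1) \<longrightarrow>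
      (\<forall>\<beta> \<kappa>. cmod (mean (Z p) (\<lambda>t. g t * prime_modulus.ph p 0 \<beta> \<kappa> t)) \<le> \<eta>4) \<longrightarrow>
      cmod (prime_modulus.L p f1 f2 f g) \<le> \<epsilon>)"
    using counting_product_uniform[OF \<epsilon>] by (elim exE conjE)
  define \<eta> where "\<eta> = min (\<delta> ^ 4 / 4) (\<eta>4 / 2)"
  have \<eta>: "\<eta> > 0" "4 * \<eta> \<le> \<delta> ^ 4" "2 * \<eta> \<le> \<eta>4" using \<delta> \<eta>4 by (auto simp: \<eta>_def)
  define e where "e = min 1 (\<eta> / 3)"
  have e: "e > 0" "e \<le> 1" "3 * e \<le> \<eta>" using \<eta> by (auto simp: e_def)
  obtain d t1 where t1: "t1 > 0" "\<And>\<tau>. \<tau> \<ge> 0 \<Longrightarrow> \<tau> \<le> t1 \<Longrightarrow> 1 + (real d)\<^sup>2 * \<tau> < real d * \<eta>\<^sup>2"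
    using small_parameter[OF \<eta>(1)] by blast
  obtain C0 where C0: "\<forall>N \<Theta>. N > 0 \<longrightarrow> finite \<Theta> \<longrightarrow> card \<Theta> \<le> 2 * (r * d) \<longrightarrow>
     (\<exists>a H. kern N C0 a H \<and> (\<forall>\<theta>\<in>\<Theta>. (1 - e) * a 0 \<le> a \<theta>))"
    using exists_kernel[OF e(1)] by blast
  define C where "C = max C0 1"
  have C: "real C ^ 3 > 0" and C1: "C \<ge> 1" by (simp_all add: C_def)
  obtain t5 :: real where t5: "t5 > 0" and pos: "\<forall>p a H b P f. prime_modulus p \<longrightarrow> prime_modulus.tau p \<le> t5 \<longrightarrow>
    kern p C a H \<longrightarrow> kern (prime_modulus.q p) C b P \<longrightarrow>
    (\<forall>i x. 0 \<le> f i x \<and> f i x \<le> (1::real)) \<longrightarrow> (\<forall>x. (\<Sum>i<r. f i x) = 1) \<longrightarrow>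
    c \<le> (\<Sum>i<r. mean (Z p) (\<lambda>x. mean (Z p) (\<lambda>y. f i x * f i y *
      smoothing.sm p a H a H (\<lambda>\<kappa>. if int (prime_modulus.q p) dvd \<kappa> then 1 else 0) (\<lambda>_. 1) (f i) (x + y) ((x + y)\<^sup>2) 0 *
      smoothing.sm p a H (\<lambda>\<kappa>. if int p dvd \<kappa> then 1 else 0) (\<lambda>_. 1) b P (f i) (x * y) 0 (prime_modulus.ind p (x * y)))))"
    using sc[rule_format, of C] by (elim exE conjE)
  define t where "t = Min {t1, t4, t5, 1 / real C ^ 3, \<eta> / real C ^ 3, \<eta>\<^sup>2 / 5, \<eta>}"
  have t: "t \<le> t1" "t \<le> t4" "t \<le> t5" "t \<le> 1 / real C ^ 3" "t \<le> \<eta> / real C ^ 3" "t \<le> \<eta>\<^sup>2 / 5" "t \<le> \<eta>"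
    unfolding t_def by (intro Min_le; simp)+
  have t0: "t > 0" unfolding t_def using t1 t4 t5 \<eta> C by (subst Min_gr_iff) auto
  show ?thesis
  proof (rule exI[of _ "c / 2"], rule conjI, use c in simp, rule exI[of _ t], rule conjI[OF t0], intro allI impI)
    fix p and f :: "nat \<Rightarrow> int \<Rightarrow> real"
    assume pm: "prime_modulus p" and tau: "prime_modulus.tau p \<le> t" and perf: "\<forall>i. per p (f i)"
      and fb: "\<forall>i x. 0 \<le> f i x \<and> f i x \<le> 1" and fs: "\<forall>x. (\<Sum>i<r. f i x) = 1"
    interpret prime_modulus p by (rule pm)
    define g where "g i x = complex_of_real (f i x)" for i x
    have g1: "cmod (g i x) \<le> 1" for i x using fb by (simp add: g_def)
    have perg: "per p (g i)" for i unfolding g_def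
      by (intro perI arg_cong[where f = complex_of_real] perD[OF perf[rule_format]])
    have hC: "\<exists>a H. kern N C a H \<and> (\<forall>\<theta>\<in>\<Theta>. (1 - e) * a 0 \<le> a \<theta>)" if "N > 0" "finite \<Theta>" "card \<Theta> \<le> 2 * (r * d)" for N \<Theta>
    proof -
      have "C0 \<le> C" by (simp add: C_def)
      thus ?thesis using C0[rule_format, OF that] kern_weaken by blast
    qed
    have "1 + (real d)\<^sup>2 * tau < real d * \<eta>\<^sup>2" using t1(2)[OF tau_nonneg] tau t(1) by simp
    hence "\<exists>a H b P. kern p C a H \<and> kern q C b P \<and> (\<forall>i\<in>{..<r}. \<forall>\<gamma>\<in>Dual. cmod (fc (g i) \<gamma>) \<le> \<eta> \<or>
        ((1 - e) * a 0 \<le> a (fst \<gamma>) \<and> (1 - e) * a 0 \<le> a (fst (snd \<gamma>)) \<and> (1 - e) * b 0 \<le> b (snd (snd \<gamma>))))"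
      using \<eta> by (intro exists_joint_kernel[where n = r and d = d] hC g1) auto
    then obtain a H b P where aH: "kern p C a H" and bP: "kern q C b P"
      and sp: "\<And>i \<gamma>. i < r \<Longrightarrow> \<gamma> \<in> Dual \<Longrightarrow> cmod (fc (g i) \<gamma>) \<le> \<eta> \<or>
        ((1 - e) * a 0 \<le> a (fst \<gamma>) \<and> (1 - e) * a 0 \<le> a (fst (snd \<gamma>)) \<and> (1 - e) * b 0 \<le> b (snd (snd \<gamma>)))"
      by (elim exE conjE) auto
    define e1 where "e1 = (\<lambda>\<kappa>. if int q dvd \<kappa> then 1 else 0 :: real)"
    define e2 where "e2 = (\<lambda>\<kappa>. if int p dvd \<kappa> then 1 else 0 :: real)"
    have ke1: "kern q C e1 (\<lambda>_. 1)" unfolding e1_def by (rule kern_one_exists[OF q_pos C1])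
    have ke2: "kern p C e2 (\<lambda>_. 1)" unfolding e2_def by (rule kern_one_exists[OF p_pos C1])
    interpret F: smoothing p C a H a H e1 "\<lambda>_. 1" by unfold_locales (use aH ke1 in auto)
    interpret G: smoothing p C a H e2 "\<lambda>_. 1" b P by unfold_locales (use aH ke2 bP in auto)
    have tau1: "tau \<le> 1 / real C ^ 3" "tau \<le> \<eta> / real C ^ 3" "tau \<le> \<eta>\<^sup>2 / 5" "tau \<le> \<eta>" "tau \<le> t4" "tau \<le> t5"
      using tau t by linarith+
    have tc: "tau * real C ^ 3 \<le> 1" "tau * real C ^ 3 \<le> \<eta>" using tau1(1,2) C by (simp_all add: field_simps)
    have ts: "sqrt (5 * tau) \<le> \<eta>" by (rule sqrt_small[OF \<eta>(1) tau_nonneg tau1(3)])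
    have main: "c \<le> (\<Sum>i<r. Re (L (g i) (g i) (F.sd (g i)) (G.sd (g i))))"
    proof -
      have Lre: "L (g i) (g i) (F.sd (g i)) (G.sd (g i)) = complex_of_real (M (\<lambda>x. M (\<lambda>y. f i x * f i y * F.sm (f i) (x + y) ((x + y)\<^sup>2) 0 * G.sm (f i) (x * y) 0 (ind (x * y)))))" for i
      proof -
        have "F.sd (g i) z = complex_of_real (F.sm (f i) z (z\<^sup>2) 0)" for z
        proof -
          have "F.sm (f i) z (z\<^sup>2) (ind z) = F.sm (f i) z (z\<^sup>2) 0" by (simp add: F.sm_def F.wt_def)
          thus ?thesis unfolding F.sd_def g_def[abs_def] F.of_real_sm[symmetric] by simp
        qed
        moreover have "G.sd (g i) z = complex_of_real (G.sm (f i) z 0 (ind z))" for z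
        proof -
          have "G.sm (f i) z (z\<^sup>2) (ind z) = G.sm (f i) z 0 (ind z)" by (simp add: G.sm_def G.wt_def)
          thus ?thesis unfolding G.sd_def g_def[abs_def] G.of_real_sm[symmetric] by simp
        qed
        ultimately show ?thesis unfolding L_def mean_of_real[symmetric] by (simp add: g_def)
      qed
      have "c \<le> (\<Sum>i<r. M (\<lambda>x. M (\<lambda>y. f i x * f i y * F.sm (f i) (x + y) ((x + y)\<^sup>2) 0 * G.sm (f i) (x * y) 0 (ind (x * y)))))"
        unfolding e1_def e2_def
        by (rule pos[rule_format, OF pm tau1(6) aH bP]) (use fb fs in auto)
      thus ?thesis unfolding Lre Re_complex_of_real .
    qed
    have err: "cmod (L (g i) (g i) (g i) (g i) - L (g i) (g i) (F.sd (g i)) (G.sd (g i))) \<le> c / (4 * real r)" if i: "i < r" for i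
    proof -
      let ?f = "\<lambda>s. g i s - F.sd (g i) s" and ?g = "\<lambda>s. g i s - G.sd (g i) s"
      have A: "cmod (L (g i) (g i) ?f (g i)) \<le> 3 * \<delta>"
      proof (rule counting_sum_uniform_scaled)
        show "per p ?f" by (rule perI) (simp add: perD[OF perg] perD[OF F.per_sd])
        show "cmod (?f x) \<le> 3" for x by (rule F.cmod_diff_sd_le[OF g1 tc(1)])
        show "cmod (M (\<lambda>s. ?f s * ph \<alpha> \<beta> 0 s)) \<le> \<eta> + tau * real C ^ 3" for \<alpha> \<beta>
          by (rule F.smooth_additive_uniform[OF e1_def g1, where \<epsilon> = e]) (use e sp[OF i] in auto)
        show "\<eta> + tau * real C ^ 3 + sqrt (5 * tau) + tau \<le> \<delta> ^ 4"
          using tc ts tau1 \<eta> by linarith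
      qed (use perg g1 \<delta> in auto)
      have B: "cmod (L (g i) (g i) (\<lambda>s. (1 / 2) * F.sd (g i) s) (\<lambda>s. (1 / 3) * ?g s)) \<le> \<epsilon>"
      proof (rule prod[rule_format, OF pm tau1(5)])
        show "per p (\<lambda>s. (1 / 2) * F.sd (g i) s)" by (rule perI) (simp add: perD[OF F.per_sd])
        show "per p (\<lambda>s. (1 / 3) * ?g s)" by (rule perI) (simp add: perD[OF perg] perD[OF G.per_sd])
        show "cmod (g i x) \<le> 1 \<and> cmod (g i x) \<le> 1 \<and> cmod ((1 / 2) * F.sd (g i) x) \<le> 1 \<and> cmod ((1 / 3) * ?g x) \<le> 1" for x
        proof -
          have "cmod (F.sd (g i) x) \<le> 2"
            using F.cmod_sc_le[of "g i" x "x\<^sup>2" "ind x", OF g1] tc(1) unfolding F.sd_def by linarith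
          moreover have "cmod (?g x) \<le> 3" by (rule G.cmod_diff_sd_le[OF g1 tc(1)])
          ultimately show ?thesis using g1[of i x] by (simp add: norm_mult)
        qed
        show "cmod (M (\<lambda>t. (1 / 3) * ?g t * ph 0 \<beta> \<kappa> t)) \<le> \<eta>4" for \<beta> \<kappa>
        proof -
          have "cmod (M (\<lambda>s. ?g s * ph 0 \<beta> \<kappa> s)) \<le> \<eta> + tau * real C ^ 3"
            by (rule G.smooth_multiplicative_uniform[OF e2_def g1, where \<epsilon> = e]) (use e sp[OF i] in auto)
          also have "\<dots> \<le> \<eta>4" using tc \<eta> by linarith
          finally have "cmod (M (\<lambda>s. ?g s * ph 0 \<beta> \<kappa> s)) \<le> \<eta>4" .
          moreover have e: "M (\<lambda>t. (1 / 3) * ?g t * ph 0 \<beta> \<kappa> t) = (1 / 3) * M (\<lambda>s. ?g s * ph 0 \<beta> \<kappa> s)"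
            unfolding mean_mult_left[symmetric] by (simp only: mult.assoc)
          ultimately show ?thesis using \<eta>4 unfolding e norm_mult by simp
        qed
      qed
      have "L (g i) (g i) (F.sd (g i)) ?g = 6 * L (g i) (g i) (\<lambda>s. (1 / 2) * F.sd (g i) s) (\<lambda>s. (1 / 3) * ?g s)"
        unfolding L_scale3 L_scale4 by simp
      hence B': "cmod (L (g i) (g i) (F.sd (g i)) ?g) \<le> 6 * \<epsilon>" using B by (simp add: norm_mult)
      have "L (g i) (g i) (g i) (g i) = L (g i) (g i) (F.sd (g i)) (g i) + L (g i) (g i) ?f (g i)"
        unfolding L_add3[symmetric] by simp
      also have "L (g i) (g i) (F.sd (g i)) (g i) = L (g i) (g i) (F.sd (g i)) (G.sd (g i)) + L (g i) (g i) (F.sd (g i)) ?g"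
        unfolding L_add4[symmetric] by simp
      finally have D: "L (g i) (g i) (g i) (g i) - L (g i) (g i) (F.sd (g i)) (G.sd (g i)) = L (g i) (g i) (F.sd (g i)) ?g + L (g i) (g i) ?f (g i)"
        by simp
      have "cmod (L (g i) (g i) (g i) (g i) - L (g i) (g i) (F.sd (g i)) (G.sd (g i))) \<le> 6 * \<epsilon> + 3 * \<delta>"
        using A B' norm_triangle_ineq[of "L (g i) (g i) (F.sd (g i)) ?g" "L (g i) (g i) ?f (g i)"] unfolding D by linarith
      also have "6 * \<epsilon> + 3 * \<delta> = c / (4 * real r)" using r0 by (simp add: \<epsilon>_def \<delta>_def field_simps)
      finally show ?thesis .
    qed
    have Lf: "L (g i) (g i) (g i) (g i) = complex_of_real (M (\<lambda>x. M (\<lambda>y. f i x * f i y * f i (x + y) * f i (x * y))))" for i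
      unfolding L_def mean_of_real[symmetric] by (simp add: g_def)
    have "c - c / 4 \<le> (\<Sum>i<r. Re (L (g i) (g i) (F.sd (g i)) (G.sd (g i))) - c / (4 * real r))"
      using main r0 by (simp add: sum_subtractf)
    also have "\<dots> \<le> (\<Sum>i<r. Re (L (g i) (g i) (g i) (g i)))"
    proof (rule sum_mono)
      fix i assume "i \<in> {..<r}"
      hence "cmod (L (g i) (g i) (g i) (g i) - L (g i) (g i) (F.sd (g i)) (G.sd (g i))) \<le> c / (4 * real r)" using err by simp
      thus "Re (L (g i) (g i) (F.sd (g i)) (G.sd (g i))) - c / (4 * real r) \<le> Re (L (g i) (g i) (g i) (g i))"
        using abs_Re_le_cmod[of "L (g i) (g i) (g i) (g i) - L (g i) (g i) (F.sd (g i)) (G.sd (g i))"] by simp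
    qed
    finally show "c / 2 \<le> (\<Sum>i<r. M (\<lambda>x. M (\<lambda>y. f i x * f i y * f i (x + y) * f i (x * y))))"
      unfolding Lf Re_complex_of_real using c by simp
  qed
qed

theorem theorem1p2:
  fixes r :: nat
  assumes "r \<ge> 1"
  shows "\<exists>c::real. c > 0 \<and>
    (\<forall>p::nat. prime p \<longrightarrow>
      (\<forall>\<chi> \<in> carrier (prime_field p) \<rightarrow> {1..r}.
        real (card (mono_pairs p \<chi>)) \<ge> c * real p ^ 2))"
proof -
  obtain c t :: real where c: "c > 0" and t: "t > 0" and main: "\<forall>p f. prime_modulus p \<longrightarrow> prime_modulus.tau p \<le> t \<longrightarrow>
    (\<forall>i. per p (f i)) \<longrightarrow> (\<forall>i x. 0 \<le> f i x \<and> f i x \<le> (1::real)) \<longrightarrow> (\<forall>x. (\<Sum>i<r. f i x) = 1) \<longrightarrow>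
    c \<le> (\<Sum>i<r. mean (Z p) (\<lambda>x. mean (Z p) (\<lambda>y. f i x * f i y * f i (x + y) * f i (x * y))))"
    using partition_count_ge[OF assms] by (elim exE conjE)
  obtain p0 where p0: "\<forall>p\<ge>p0. prime_modulus p \<longrightarrow> prime_modulus.tau p \<le> t" using tau_small[OF t] by blast
  define P where "P = real (max p0 3)"
  have P: "P \<ge> 3" by (simp add: P_def)
  \<comment> \<open>For small p, including 2, the pair (0, 0) is always monochromatic, and p is at
    most P, so c' p^2 is at most 1.\<close>
  define c' where "c' = min c (1 / P\<^sup>2)"
  have c': "c' > 0" "c' \<le> c" "c' \<le> 1 / P\<^sup>2" using c P by (auto simp: c'_def)
  show ?thesis
  proof (rule exI[of _ c'], intro conjI c'(1) allI impI ballI)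
    fix p :: nat and \<chi> assume pr: "prime p" and chi: "\<chi> \<in> carrier (prime_field p) \<rightarrow> {1..r}"
    have p2: "p \<ge> 2" using pr by (rule prime_ge_2_nat)
    have carr: "carrier (prime_field p) = Z p"
      using p2 by (auto simp: residue_ring_def)
    have mp: "mono_pairs p \<chi> = {(x, y) \<in> Z p \<times> Z p. \<chi> x = \<chi> y \<and> \<chi> x = \<chi> ((x + y) mod int p) \<and> \<chi> x = \<chi> ((x * y) mod int p)}"
      unfolding mono_pairs_def carr by (simp add: residue_ring_def)
    have fin: "finite (mono_pairs p \<chi>)"
      unfolding mp by (rule finite_subset[of _ "Z p \<times> Z p"]) auto
    show "c' * real p ^ 2 \<le> real (card (mono_pairs p \<chi>))"
    proof (cases "p > 2 \<and> p \<ge> p0")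
      case False
      hence "real p \<le> P" using p2 by (auto simp: P_def)
      hence "c' * real p ^ 2 \<le> (1 / P\<^sup>2) * P ^ 2" using c' P by (intro mult_mono power_mono) auto
      also have "\<dots> = 1" using P by simp
      also have "(0, 0) \<in> mono_pairs p \<chi>" using p2 by (simp add: mp)
      hence "1 \<le> real (card (mono_pairs p \<chi>))" using fin by (auto simp: Suc_le_eq card_gt_0_iff)
      finally show ?thesis by simp
    next
      case True
      interpret prime_modulus p by unfold_locales (use pr True in auto)
      \<comment> \<open>Colours run from 1 to r and the classes are indexed from 0, hence i + 1;
        reducing x extends the colouring periodically.\<close>
      define f where "f i x = (of_bool (\<chi> (x mod int p) = i + 1) :: real)" for i x
      have "c \<le> (\<Sum>i<r. M (\<lambda>x. M (\<lambda>y. f i x * f i y * f i (x + y) * f i (x * y))))"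
      proof (rule main[rule_format])
        show "prime_modulus p" by unfold_locales
        thus "tau \<le> t" using p0 True by blast
        show "per p (f i)" for i unfolding f_def by (rule perI) (simp add: Cong.cong_def)
        show "0 \<le> f i x \<and> f i x \<le> 1" for i x by (simp add: f_def)
        show "(\<Sum>i<r. f i x) = 1" for x
        proof -
          have "x mod int p \<in> Z p" using p_pos by simp
          hence ch: "\<chi> (x mod int p) \<in> {1..r}" using chi unfolding carr by auto
          have "(\<Sum>i<r. f i x) = (\<Sum>i<r. if i = \<chi> (x mod int p) - 1 then 1 else 0)"
            using ch by (intro sum.cong refl) (auto simp: f_def)
          also have "\<dots> = 1" using ch by (auto simp: sum.delta)
          finally show ?thesis .
        qed
      qed
      also have "\<dots> = M (\<lambda>x. M (\<lambda>y. \<Sum>i<r. f i x * f i y * f i (x + y) * f i (x * y)))"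
        by (simp only: mean_sum)
      also have "\<dots> \<le> M (\<lambda>x. M (\<lambda>y. of_bool ((x, y) \<in> mono_pairs p \<chi>)))"
      proof (intro mean_mono)
        fix x y assume xy: "x \<in> Z p" "y \<in> Z p"
        have "(\<Sum>i<r. f i x * f i y * f i (x + y) * f i (x * y)) \<le> (\<Sum>i<r. of_bool ((x, y) \<in> mono_pairs p \<chi>) * f i x)"
          using xy by (intro sum_mono) (auto simp: f_def mp)
        also have "\<dots> = of_bool ((x, y) \<in> mono_pairs p \<chi>) * (\<Sum>i<r. f i x)" by (rule sum_distrib_left[symmetric])
        also have "\<dots> \<le> of_bool ((x, y) \<in> mono_pairs p \<chi>) * 1"
        proof (rule mult_left_mono)
          have ch: "\<chi> x \<in> {1..r}" using chi xy unfolding carr by auto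
          have "(\<Sum>i<r. f i x) = (\<Sum>i<r. if i = \<chi> x - 1 then 1 else 0)"
            using ch xy by (intro sum.cong refl) (auto simp: f_def)
          also have "\<dots> \<le> 1" by (simp add: sum.delta)
          finally show "(\<Sum>i<r. f i x) \<le> 1" .
        qed simp
        finally show "(\<Sum>i<r. f i x * f i y * f i (x + y) * f i (x * y)) \<le> of_bool ((x, y) \<in> mono_pairs p \<chi>)" by simp
      qed
      also have "\<dots> = real (card (mono_pairs p \<chi>)) / (real p)\<^sup>2"
      proof -
        have sub: "mono_pairs p \<chi> \<subseteq> Z p \<times> Z p" unfolding mp by blast
        have "M (\<lambda>x. M (\<lambda>y. of_bool ((x, y) \<in> mono_pairs p \<chi>))) = mean (Z p \<times> Z p) (\<lambda>z. of_bool (z \<in> mono_pairs p \<chi>) :: real)"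
          by (subst mean_Times) auto
        also have "\<dots> = (\<Sum>z\<in>Z p \<times> Z p. of_bool (z \<in> mono_pairs p \<chi>)) / (real p)\<^sup>2"
          by (simp add: mean_def card_cartesian_product divide_inverse power2_eq_square)
        also have "(\<Sum>z\<in>Z p \<times> Z p. of_bool (z \<in> mono_pairs p \<chi>) :: real) = real (card (mono_pairs p \<chi>))"
          using sub by (simp add: of_bool_def sum.If_cases Int_absorb1)
        finally show ?thesis .
      qed
      finally have "c * (real p)\<^sup>2 \<le> real (card (mono_pairs p \<chi>))" using p_pos by (simp add: field_simps)
      moreover have "c' * real p ^ 2 \<le> c * real p ^ 2" using c' by (intro mult_right_mono) auto
      ultimately show ?thesis by simp
    qed
  qed
qed

end
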